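(* Let $p \in [1, \infty)$. Let $\big( (A_i)_{i \in I}, ( \varphi_{j, i} )_{i \leq j} \big)$ be a contractive direct system of $L^p$ operator algebras indexed by an infinite directed set $I$. Then the Banach algebra direct limit $\varinjlim_i A_i$ is an $L^p$ operator algebra.
   Context: All algebras are over $\mathbb{C}$. An $L^p$ operator algebra is a Banach algebra isometrically isomorphic to a norm closed subalgebra of the algebra $L(L^p(X,\mu))$ of bounded operators on $L^p(X,\mu)$, for some measure space $(X,\mathcal{B},\mu)$. A contractive direct system of Banach algebras consists of Banach algebras $A_i$ and contractive (not necessarily unital) homomorphisms $\varphi_{j,i}\colon A_i\to A_j$ for $i\le j$, with $\varphi_{i,i}=\mathrm{id}_{A_i}$ and $\varphi_{k,j}\circ\varphi_{j,i}=\varphi_{k,i}$ for $i\le j\le k$. Its direct limit is the completion of the quotient of the algebraic direct limit by the elements of seminorm zero, for the seminorm that sends the class of $a\in A_i$ to $\lim_j\|\varphi_{j,i}(a)\|$. *)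

theory Defs
  imports
    "HOL-Analysis.Analysis"
    "HOL-Algebra.QuotRing"
    "HOL-Algebra.Module"
begin

section \<open>Complex (semi)normed spaces and Banach algebras\<close>

text \<open>
  Complex (semi)normed spaces and algebras are HOL-Algebra modules over the field of complex
  numbers, with an additional field for the (semi)norm. Algebras are not assumed to be unital,
  so the field \<open>one\<close> of the record plays no role; for mere vector spaces \<open>mult\<close> plays no role
  either (as is already the case for modules in HOL-Algebra).
\<close>

record 'a normed_algebra = "(complex, 'a) module" +
  vnorm :: "'a \<Rightarrow> real"

abbreviation complex_ring :: "complex ring"
  where "complex_ring \<equiv> \<lparr>carrier = UNIV, monoid.mult = (*), one = 1, zero = 0, add = (+)\<rparr>"

definition Cauchy_in :: "('a, 'm) normed_algebra_scheme \<Rightarrow> (nat \<Rightarrow> 'a) \<Rightarrow> bool" where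
  "Cauchy_in V s \<longleftrightarrow> (\<forall>n. s n \<in> carrier V) \<and>
     (\<forall>e>0. \<exists>N. \<forall>m\<ge>N. \<forall>n\<ge>N. vnorm V (s m \<ominus>\<^bsub>V\<^esub> s n) < e)"

definition converges_in :: "('a, 'm) normed_algebra_scheme \<Rightarrow> (nat \<Rightarrow> 'a) \<Rightarrow> 'a \<Rightarrow> bool" where
  "converges_in V s l \<longleftrightarrow> (\<lambda>n. vnorm V (s n \<ominus>\<^bsub>V\<^esub> l)) \<longlonglongrightarrow> 0"

locale complex_banach_algebra =
  module complex_ring A for A :: "('a, 'm) normed_algebra_scheme" (structure) +
  assumes mult_closed: "\<lbrakk>x \<in> carrier A; y \<in> carrier A\<rbrakk> \<Longrightarrow> x \<otimes> y \<in> carrier A"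
    and mult_assoc: "\<lbrakk>x \<in> carrier A; y \<in> carrier A; z \<in> carrier A\<rbrakk> \<Longrightarrow>
      (x \<otimes> y) \<otimes> z = x \<otimes> (y \<otimes> z)"
    and mult_l_distr: "\<lbrakk>x \<in> carrier A; y \<in> carrier A; z \<in> carrier A\<rbrakk> \<Longrightarrow>
      (x \<oplus> y) \<otimes> z = (x \<otimes> z) \<oplus> (y \<otimes> z)"
    and mult_r_distr: "\<lbrakk>x \<in> carrier A; y \<in> carrier A; z \<in> carrier A\<rbrakk> \<Longrightarrow>
      z \<otimes> (x \<oplus> y) = (z \<otimes> x) \<oplus> (z \<otimes> y)"
    and smult_mult_l: "\<lbrakk>x \<in> carrier A; y \<in> carrier A\<rbrakk> \<Longrightarrow> (c \<odot> x) \<otimes> y = c \<odot> (x \<otimes> y)"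
    and smult_mult_r: "\<lbrakk>x \<in> carrier A; y \<in> carrier A\<rbrakk> \<Longrightarrow> x \<otimes> (c \<odot> y) = c \<odot> (x \<otimes> y)"
    and vnorm_nonneg: "x \<in> carrier A \<Longrightarrow> 0 \<le> vnorm A x"
    and vnorm_eq_0_iff: "x \<in> carrier A \<Longrightarrow> vnorm A x = 0 \<longleftrightarrow> x = \<zero>"
    and vnorm_triangle: "\<lbrakk>x \<in> carrier A; y \<in> carrier A\<rbrakk> \<Longrightarrow>
      vnorm A (x \<oplus> y) \<le> vnorm A x + vnorm A y"
    and vnorm_smult: "x \<in> carrier A \<Longrightarrow> vnorm A (c \<odot> x) = cmod c * vnorm A x"
    and vnorm_mult: "\<lbrakk>x \<in> carrier A; y \<in> carrier A\<rbrakk> \<Longrightarrow>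
      vnorm A (x \<otimes> y) \<le> vnorm A x * vnorm A y"
    and complete: "Cauchy_in A s \<Longrightarrow> \<exists>l\<in>carrier A. converges_in A s l"

text \<open>Note that \<^const>\<open>hom\<close> refers to the multiplications and does not involve units.\<close>

definition algebra_hom ::
  "('a, 'm) normed_algebra_scheme \<Rightarrow> ('b, 'n) normed_algebra_scheme \<Rightarrow> ('a \<Rightarrow> 'b) set" where
  "algebra_hom A B = {h \<in> hom A B \<inter> hom (add_monoid A) (add_monoid B).
     \<forall>c. \<forall>x\<in>carrier A. h (c \<odot>\<^bsub>A\<^esub> x) = c \<odot>\<^bsub>B\<^esub> h x}"

definition contractive_hom ::
  "('a, 'm) normed_algebra_scheme \<Rightarrow> ('b, 'n) normed_algebra_scheme \<Rightarrow> ('a \<Rightarrow> 'b) set" where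
  "contractive_hom A B = {h \<in> algebra_hom A B. \<forall>x\<in>carrier A. vnorm B (h x) \<le> vnorm A x}"

definition isometrically_isomorphic ::
  "('a, 'm) normed_algebra_scheme \<Rightarrow> ('b, 'n) normed_algebra_scheme \<Rightarrow> bool" where
  "isometrically_isomorphic A B \<longleftrightarrow>
     (\<exists>h\<in>algebra_hom A B. bij_betw h (carrier A) (carrier B) \<and>
        (\<forall>x\<in>carrier A. vnorm B (h x) = vnorm A x))"

definition closed_subalgebra :: "'a set \<Rightarrow> ('a, 'm) normed_algebra_scheme \<Rightarrow> bool" where
  "closed_subalgebra B A \<longleftrightarrow> submodule B complex_ring A \<and>
     (\<forall>x\<in>B. \<forall>y\<in>B. x \<otimes>\<^bsub>A\<^esub> y \<in> B) \<and>
     (\<forall>s l. (\<forall>n. s n \<in> B) \<longrightarrow> l \<in> carrier A \<longrightarrow> converges_in A s l \<longrightarrow> l \<in> B)"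

definition bounded_operators :: "('v, 'm) normed_algebra_scheme \<Rightarrow> ('v \<Rightarrow> 'v) normed_algebra" where
  "bounded_operators V = \<lparr>
     carrier = {T \<in> carrier V \<rightarrow>\<^sub>E carrier V.
        (\<forall>x\<in>carrier V. \<forall>y\<in>carrier V. T (x \<oplus>\<^bsub>V\<^esub> y) = T x \<oplus>\<^bsub>V\<^esub> T y) \<and>
        (\<forall>c. \<forall>x\<in>carrier V. T (c \<odot>\<^bsub>V\<^esub> x) = c \<odot>\<^bsub>V\<^esub> T x) \<and>
        (\<exists>C. \<forall>x\<in>carrier V. vnorm V (T x) \<le> C * vnorm V x)},
     monoid.mult = (\<lambda>S T. compose (carrier V) S T),
     one = (\<lambda>x\<in>carrier V. x),
     zero = (\<lambda>x\<in>carrier V. \<zero>\<^bsub>V\<^esub>),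
     add = (\<lambda>S T. \<lambda>x\<in>carrier V. S x \<oplus>\<^bsub>V\<^esub> T x),
     smult = (\<lambda>c T. \<lambda>x\<in>carrier V. c \<odot>\<^bsub>V\<^esub> T x),
     vnorm = (\<lambda>T. SUP x\<in>{x \<in> carrier V. vnorm V x \<le> 1}. vnorm V (T x))\<rparr>"

text \<open>
  The quotient of a seminormed space or algebra by a subspace (ideal) of elements of seminorm
  zero; ring-theoretically this is \<^const>\<open>FactRing\<close>. The seminorm is constant on cosets.
\<close>

definition seminormed_quotient ::
  "('a, 'm) normed_algebra_scheme \<Rightarrow> 'a set \<Rightarrow> 'a set normed_algebra" where
  "seminormed_quotient V N = \<lparr>
     carrier = carrier (V Quot N),
     monoid.mult = monoid.mult (V Quot N),
     one = one (V Quot N),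
     zero = zero (V Quot N),
     add = add (V Quot N),
     smult = (\<lambda>c X. \<Union>x\<in>X. N +>\<^bsub>V\<^esub> (c \<odot>\<^bsub>V\<^esub> x)),
     vnorm = (\<lambda>X. the_elem (vnorm V ` X))\<rparr>"

text \<open>The completion of a normed algebra: Cauchy sequences modulo null sequences.\<close>

definition Cauchy_sequence_algebra ::
  "('a, 'm) normed_algebra_scheme \<Rightarrow> (nat \<Rightarrow> 'a) normed_algebra" where
  "Cauchy_sequence_algebra A = \<lparr>
     carrier = {s. Cauchy_in A s},
     monoid.mult = (\<lambda>s t n. s n \<otimes>\<^bsub>A\<^esub> t n),
     one = (\<lambda>n. \<one>\<^bsub>A\<^esub>),
     zero = (\<lambda>n. \<zero>\<^bsub>A\<^esub>),
     add = (\<lambda>s t n. s n \<oplus>\<^bsub>A\<^esub> t n),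
     smult = (\<lambda>c s n. c \<odot>\<^bsub>A\<^esub> s n),
     vnorm = (\<lambda>s. lim (\<lambda>n. vnorm A (s n)))\<rparr>"

definition completion ::
  "('a, 'm) normed_algebra_scheme \<Rightarrow> (nat \<Rightarrow> 'a) set normed_algebra" where
  "completion A = seminormed_quotient (Cauchy_sequence_algebra A)
     {s. Cauchy_in A s \<and> converges_in A s \<zero>\<^bsub>A\<^esub>}"


section \<open>\<open>L\<^sup>p\<close> operator algebras\<close>

text \<open>The seminormed space of complex-valued \<open>p\<close>-integrable functions; \<open>mult\<close> and \<open>one\<close> are dummies.\<close>

definition pre_Lp_space :: "real \<Rightarrow> 'x measure \<Rightarrow> ('x \<Rightarrow> complex) normed_algebra" where
  "pre_Lp_space p M = \<lparr>
     carrier = {f \<in> borel_measurable M. integrable M (\<lambda>x. cmod (f x) powr p)},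
     monoid.mult = undefined,
     one = undefined,
     zero = (\<lambda>x. 0),
     add = (\<lambda>f g x. f x + g x),
     smult = (\<lambda>c f x. c * f x),
     vnorm = (\<lambda>f. (LINT x|M. cmod (f x) powr p) powr (1 / p))\<rparr>"

definition Lp_space :: "real \<Rightarrow> 'x measure \<Rightarrow> ('x \<Rightarrow> complex) set normed_algebra" where
  "Lp_space p M = seminormed_quotient (pre_Lp_space p M)
     {f \<in> carrier (pre_Lp_space p M). AE x in M. f x = 0}"

text \<open>
  Since HOL cannot quantify over types inside a formula, the type of the points of the measure
  space is a parameter. The measure space itself is arbitrary (its space may be a proper subset
  of the type), without any finiteness assumption.
\<close>

definition Lp_operator_algebra :: "'x itself \<Rightarrow> real \<Rightarrow> 'a normed_algebra \<Rightarrow> bool" where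
  "Lp_operator_algebra (_ :: 'x itself) p A \<longleftrightarrow> complex_banach_algebra A \<and>
     (\<exists>(M :: 'x measure) B. closed_subalgebra B (bounded_operators (Lp_space p M)) \<and>
        isometrically_isomorphic A ((bounded_operators (Lp_space p M))\<lparr>carrier := B\<rparr>))"


section \<open>Direct limits of contractive direct systems\<close>

definition directed_set :: "'i set \<Rightarrow> 'i rel \<Rightarrow> bool" where
  "directed_set I r \<longleftrightarrow> I \<noteq> {} \<and> preorder_on I r \<and>
     (\<forall>i\<in>I. \<forall>j\<in>I. \<exists>k\<in>I. (i, k) \<in> r \<and> (j, k) \<in> r)"

text \<open>The map \<open>A\<^sub>i \<rightarrow> A\<^sub>j\<close> is \<open>\<phi> j i\<close>, and \<open>(i, j) \<in> r\<close> means \<open>i \<le> j\<close>.\<close>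

definition contractive_direct_system ::
  "'i set \<Rightarrow> 'i rel \<Rightarrow> ('i \<Rightarrow> 'a normed_algebra) \<Rightarrow> ('i \<Rightarrow> 'i \<Rightarrow> 'a \<Rightarrow> 'a) \<Rightarrow> bool" where
  "contractive_direct_system I r A \<phi> \<longleftrightarrow> directed_set I r \<and>
     (\<forall>i\<in>I. complex_banach_algebra (A i)) \<and>
     (\<forall>i j. (i, j) \<in> r \<longrightarrow> \<phi> j i \<in> contractive_hom (A i) (A j)) \<and>
     (\<forall>i\<in>I. \<forall>a\<in>carrier (A i). \<phi> i i a = a) \<and>
     (\<forall>i j k. (i, j) \<in> r \<longrightarrow> (j, k) \<in> r \<longrightarrow>
        (\<forall>a\<in>carrier (A i). \<phi> k j (\<phi> j i a) = \<phi> k i a))"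

definition tail_filter :: "'i set \<Rightarrow> 'i rel \<Rightarrow> 'i filter" where
  "tail_filter I r = (INF i\<in>I. principal {j. (i, j) \<in> r})"

definition direct_limit_rel ::
  "'i set \<Rightarrow> 'i rel \<Rightarrow> ('i \<Rightarrow> 'a normed_algebra) \<Rightarrow> ('i \<Rightarrow> 'i \<Rightarrow> 'a \<Rightarrow> 'a) \<Rightarrow> ('i \<times> 'a) rel" where
  "direct_limit_rel I r A \<phi> = {((i, a), (j, b)).
     (i, a) \<in> (SIGMA i:I. carrier (A i)) \<and> (j, b) \<in> (SIGMA i:I. carrier (A i)) \<and>
     (\<exists>k. (i, k) \<in> r \<and> (j, k) \<in> r \<and> \<phi> k i a = \<phi> k j b)}"

text \<open>
  The algebraic direct limit with its seminorm. Sums and products of the classes of \<open>(i, a)\<close> and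
  \<open>(j, b)\<close> are computed in \<open>A\<^sub>k\<close> for any upper bound \<open>k\<close> of \<open>i\<close> and \<open>j\<close>; the unions below are
  unions of copies of a single class.
\<close>

definition algebraic_direct_limit ::
  "'i set \<Rightarrow> 'i rel \<Rightarrow> ('i \<Rightarrow> 'a normed_algebra) \<Rightarrow> ('i \<Rightarrow> 'i \<Rightarrow> 'a \<Rightarrow> 'a) \<Rightarrow>
     ('i \<times> 'a) set normed_algebra" where
  "algebraic_direct_limit I r A \<phi> = (let R = direct_limit_rel I r A \<phi> in \<lparr>
     carrier = (SIGMA i:I. carrier (A i)) // R,
     monoid.mult = (\<lambda>X Y. \<Union>(i, a)\<in>X. \<Union>(j, b)\<in>Y. \<Union>k\<in>{k. (i, k) \<in> r \<and> (j, k) \<in> r}.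
        R `` {(k, \<phi> k i a \<otimes>\<^bsub>A k\<^esub> \<phi> k j b)}),
     one = undefined,
     zero = (\<Union>i\<in>I. R `` {(i, \<zero>\<^bsub>A i\<^esub>)}),
     add = (\<lambda>X Y. \<Union>(i, a)\<in>X. \<Union>(j, b)\<in>Y. \<Union>k\<in>{k. (i, k) \<in> r \<and> (j, k) \<in> r}.
        R `` {(k, \<phi> k i a \<oplus>\<^bsub>A k\<^esub> \<phi> k j b)}),
     smult = (\<lambda>c X. \<Union>(i, a)\<in>X. R `` {(i, c \<odot>\<^bsub>A i\<^esub> a)}),
     vnorm = (\<lambda>X. the_elem
        ((\<lambda>(i, a). Lim (tail_filter I r) (\<lambda>j. vnorm (A j) (\<phi> j i a))) ` X))\<rparr>)"

definition direct_limit ::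
  "'i set \<Rightarrow> 'i rel \<Rightarrow> ('i \<Rightarrow> 'a normed_algebra) \<Rightarrow> ('i \<Rightarrow> 'i \<Rightarrow> 'a \<Rightarrow> 'a) \<Rightarrow>
     (nat \<Rightarrow> ('i \<times> 'a) set set) set normed_algebra" where
  "direct_limit I r A \<phi> = (let L = algebraic_direct_limit I r A \<phi> in
     completion (seminormed_quotient L {X \<in> carrier L. vnorm L X = 0}))"

text \<open>
  A type large enough to hold the points of a measure space on which the direct limit is
  represented, when the algebras of the system are represented on measure spaces with points
  in \<open>'x\<close>. The first component indexes a maximal family of pairwise disjoint elements
  of an ultraproduct of \<open>L\<^sup>p\<close> spaces; the second one consists of the points of the corresponding
  ultraproducts of finite measure spaces.
\<close>

type_synonym ('i, 'x) limit_points = "('i \<times> nat \<Rightarrow> 'x \<Rightarrow> complex) \<times> ('i \<times> nat \<Rightarrow> 'x)"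

end

theory Submission
  imports Defs
begin

text \<open>
  The direct limit acts on an ultraproduct. Represent each \<open>A\<^sub>i\<close> isometrically by \<open>h\<^sub>i\<close> on an
  \<open>L\<^sup>p\<close> space of a measure \<open>M\<^sub>i\<close>, and choose an ultrafilter on \<open>I \<times> \<nat>\<close> whose first coordinate runs
  along the tails of \<open>I\<close> and whose second coordinate tends to infinity. The class of \<open>a \<in> A\<^sub>k\<close>
  acts on a bounded family of functions, indexed by the pairs \<open>(i, n)\<close>, through the operators
  \<open>h\<^sub>i (\<phi>\<^sub>i\<^sub>k a)\<close> for \<open>i \<ge> k\<close>. Modulo families whose norm tends to \<open>0\<close> this is an isometric homomorphism,
  since the operator norm of an ultraproduct of operators is the limit of the operator norms
  (\<open>vnorm_\<Theta>\<close>), and the limit of \<open>\<parallel>\<phi>\<^sub>i\<^sub>k a\<parallel>\<close> along the tails, which exists because the maps are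
  contractive, is the seminorm of the class. An isometric homomorphism into a Banach algebra
  extends to the completed quotient and then has closed range
  (\<open>completed_quotient_representation\<close>). So everything rests on the fact that an ultraproduct of
  \<open>L\<^sup>p\<close> spaces is an \<open>L\<^sup>p\<close> space (\<open>Lp_ultraproduct_exists\<close>).

  That fact is proved with Loeb measures. A bounded family \<open>u\<close> turns the finite measures
  \<open>\<bar>u\<^sub>j\<bar>\<^sup>p M\<^sub>j\<close> into the set function \<open>B \<mapsto> lim \<integral>\<^sub>B \<bar>u\<^sub>j\<bar>\<^sup>p dM\<^sub>j\<close> on the algebra of internal sets, that is,
  of ultraproducts of measurable sets. A countably incomplete ultrafilter is saturated
  (\<open>diagonal\<close>), so a decreasing sequence of internal sets with empty intersection is eventually
  empty, and the set function extends to a measure \<open>\<nu> u\<close>. A bounded family \<open>f\<close> then gives the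
  function \<open>x \<mapsto> lim f\<^sub>j (x\<^sub>j) / u\<^sub>j (x\<^sub>j)\<close>, the component of \<open>f\<close> along \<open>u\<close>; its \<open>p\<close>-th power integral is
  the mass of that part of \<open>f\<close> which is dominated by multiples of \<open>u\<close>.

  No single \<open>u\<close> sees every \<open>f\<close>, because the mass of \<open>f\<close> may sit where \<open>u\<close> is infinitely smaller than
  \<open>f\<close>. Therefore one takes a maximal set \<open>D\<close> of families that are orthogonal in the sense that
  \<open>\<integral> min(\<bar>u\<^sub>j\<bar>, \<bar>v\<^sub>j\<bar>)\<^sup>p dM\<^sub>j\<close> tends to \<open>0\<close>, and the direct sum of the measures \<open>\<nu> u\<close> for \<open>u \<in> D\<close>. The map
  that collects all components is isometric (\<open>nn_integral_J\<close>): if some mass of \<open>f\<close> were lost, a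
  diagonal argument would remove from \<open>f\<close> all that is comparable to members of \<open>D\<close> and leave a
  nonzero family orthogonal to \<open>D\<close> (\<open>upint_le_covers\<close>). It is surjective (\<open>J_surj\<close>), since its
  range is closed, again by saturation, and contains the indicators of internal sets, hence those
  of all measurable sets of finite measure.
\<close>

section \<open>Complex modules, algebras and their homomorphic images\<close>

lemma cring_complex_ring: "cring complex_ring"
proof (rule cringI)
  show "abelian_group complex_ring"
    by (rule abelian_groupI) (auto simp: add_eq_0_iff2 intro: exI[of _ "- x" for x])
  show "comm_monoid complex_ring"
    by (rule comm_monoidI) auto
qed (auto simp: algebra_simps)

text \<open>
  Modules over the complex numbers, with the axioms stated for complex scalars instead of elements
  of the carrier of a ring record.
\<close>

locale cmodule = module complex_ring V for V :: "('a, 'm) normed_algebra_scheme" (structure)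
begin

lemma sm_closed [simp, intro]: "x \<in> carrier V \<Longrightarrow> c \<odot> x \<in> carrier V"
  using smult_closed[of c x] by simp

lemma sm_l_distr: "x \<in> carrier V \<Longrightarrow> (a + b) \<odot> x = a \<odot> x \<oplus> b \<odot> x"
  using smult_l_distr[of a b x] by simp

lemma sm_r_distr: "x \<in> carrier V \<Longrightarrow> y \<in> carrier V \<Longrightarrow> a \<odot> (x \<oplus> y) = a \<odot> x \<oplus> a \<odot> y"
  using smult_r_distr[of a x y] by simp

lemma sm_assoc: "x \<in> carrier V \<Longrightarrow> (a * b) \<odot> x = a \<odot> (b \<odot> x)"
  using smult_assoc1[of a b x] by simp

lemma sm_one: "x \<in> carrier V \<Longrightarrow> 1 \<odot> x = x"
  using smult_one[of x] by simp

lemma sm_zero: "x \<in> carrier V \<Longrightarrow> 0 \<odot> x = \<zero>"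
  using smult_l_null[of x] by simp

lemma sm_zero_r: "a \<odot> \<zero> = \<zero>"
  using smult_r_null[of a] by simp

lemma sm_minus_one: "x \<in> carrier V \<Longrightarrow> (-1) \<odot> x = \<ominus> x"
  by (rule M.minus_equality[symmetric]) (use sm_l_distr[of x "-1" 1] in \<open>auto simp: sm_one sm_zero\<close>)

lemma minus_smult: "x \<in> carrier V \<Longrightarrow> y \<in> carrier V \<Longrightarrow> x \<ominus> y = x \<oplus> (-1) \<odot> y"
  by (simp add: minus_eq sm_minus_one)

lemma diff_cancel: "x \<in> carrier V \<Longrightarrow> y \<in> carrier V \<Longrightarrow> (x \<ominus> y) \<oplus> y = x"
  by (simp add: minus_eq a_assoc l_neg)

lemma diff_self: "x \<in> carrier V \<Longrightarrow> x \<ominus> x = \<zero>"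
  by (simp add: minus_eq r_neg)

lemma diff_zero: "x \<in> carrier V \<Longrightarrow> x \<ominus> \<zero> = x"
  by (simp add: minus_eq)

lemma diff_eq_zero: "x \<in> carrier V \<Longrightarrow> y \<in> carrier V \<Longrightarrow> x \<ominus> y = \<zero> \<longleftrightarrow> x = y"
  by (metis diff_cancel diff_self l_zero)

lemma diff_trans: "x \<in> carrier V \<Longrightarrow> y \<in> carrier V \<Longrightarrow> z \<in> carrier V \<Longrightarrow> x \<ominus> z = (x \<ominus> y) \<oplus> (y \<ominus> z)"
  by (simp add: minus_eq a_assoc[symmetric]) (simp add: a_assoc l_neg)

lemma diff_add: "x \<in> carrier V \<Longrightarrow> y \<in> carrier V \<Longrightarrow> x' \<in> carrier V \<Longrightarrow> y' \<in> carrier V \<Longrightarrow>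
    (x \<oplus> y) \<ominus> (x' \<oplus> y') = (x \<ominus> x') \<oplus> (y \<ominus> y')"
  by (simp add: minus_eq minus_add a_ac)

lemma diff_smult: "x \<in> carrier V \<Longrightarrow> y \<in> carrier V \<Longrightarrow> (c \<odot> x) \<ominus> (c \<odot> y) = c \<odot> (x \<ominus> y)"
  by (simp add: minus_smult sm_r_distr sm_assoc[symmetric] mult.commute)

lemma diff_commute: "x \<in> carrier V \<Longrightarrow> y \<in> carrier V \<Longrightarrow> x \<ominus> y = (-1) \<odot> (y \<ominus> x)"
  by (simp add: minus_smult sm_r_distr sm_assoc[symmetric] sm_one a_comm)

end

lemma cmoduleI_direct:
  fixes V (structure)
  assumes "\<And>x y. x \<in> carrier V \<Longrightarrow> y \<in> carrier V \<Longrightarrow> x \<oplus> y \<in> carrier V"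
    and "\<zero> \<in> carrier V"
    and "\<And>x y z. x \<in> carrier V \<Longrightarrow> y \<in> carrier V \<Longrightarrow> z \<in> carrier V \<Longrightarrow> x \<oplus> y \<oplus> z = x \<oplus> (y \<oplus> z)"
    and "\<And>x y. x \<in> carrier V \<Longrightarrow> y \<in> carrier V \<Longrightarrow> x \<oplus> y = y \<oplus> x"
    and "\<And>x. x \<in> carrier V \<Longrightarrow> \<zero> \<oplus> x = x"
    and "\<And>c x. x \<in> carrier V \<Longrightarrow> c \<odot> x \<in> carrier V"
    and "\<And>a b x. x \<in> carrier V \<Longrightarrow> (a + b) \<odot> x = a \<odot> x \<oplus> b \<odot> x"
    and "\<And>a x y. x \<in> carrier V \<Longrightarrow> y \<in> carrier V \<Longrightarrow> a \<odot> (x \<oplus> y) = a \<odot> x \<oplus> a \<odot> y"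
    and "\<And>a b x. x \<in> carrier V \<Longrightarrow> (a * b) \<odot> x = a \<odot> (b \<odot> x)"
    and "\<And>x. x \<in> carrier V \<Longrightarrow> (1 :: complex) \<odot> x = x"
    and zero: "\<And>x. x \<in> carrier V \<Longrightarrow> 0 \<odot> x = \<zero>"
  shows "cmodule V"
  unfolding cmodule_def
proof (rule moduleI[OF cring_complex_ring])
  show "abelian_group V"
  proof (rule abelian_groupI)
    fix x assume x: "x \<in> carrier V"
    have "(-1) \<odot> x \<oplus> x = (-1 + 1) \<odot> x" using assms x by metis
    then show "\<exists>y\<in>carrier V. y \<oplus> x = \<zero>" using assms(6)[OF x] zero[OF x] by auto
  qed (use assms in auto)
qed (use assms in auto)

definition module_map :: "('a, 'm) normed_algebra_scheme \<Rightarrow> ('b, 'n) normed_algebra_scheme \<Rightarrow> ('a \<Rightarrow> 'b) \<Rightarrow> bool" where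
  "module_map V W h \<longleftrightarrow> h \<in> carrier V \<rightarrow> carrier W \<and>
     (\<forall>x\<in>carrier V. \<forall>y\<in>carrier V. h (x \<oplus>\<^bsub>V\<^esub> y) = h x \<oplus>\<^bsub>W\<^esub> h y) \<and>
     (\<forall>c. \<forall>x\<in>carrier V. h (c \<odot>\<^bsub>V\<^esub> x) = c \<odot>\<^bsub>W\<^esub> h x) \<and> h \<zero>\<^bsub>V\<^esub> = \<zero>\<^bsub>W\<^esub>"

lemma module_mapD:
  assumes "module_map V W h"
  shows "x \<in> carrier V \<Longrightarrow> h x \<in> carrier W"
    "x \<in> carrier V \<Longrightarrow> y \<in> carrier V \<Longrightarrow> h (x \<oplus>\<^bsub>V\<^esub> y) = h x \<oplus>\<^bsub>W\<^esub> h y"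
    "x \<in> carrier V \<Longrightarrow> h (c \<odot>\<^bsub>V\<^esub> x) = c \<odot>\<^bsub>W\<^esub> h x"
    "h \<zero>\<^bsub>V\<^esub> = \<zero>\<^bsub>W\<^esub>"
  using assms by (auto simp: module_map_def)

lemma module_map_diff:
  assumes h: "module_map V W h" and V: "cmodule V" and W: "cmodule W"
    and x: "x \<in> carrier V" "y \<in> carrier V"
  shows "h (x \<ominus>\<^bsub>V\<^esub> y) = h x \<ominus>\<^bsub>W\<^esub> h y"
  using x by (simp add: cmodule.minus_smult[OF V] cmodule.minus_smult[OF W] module_mapD[OF h] cmodule.sm_closed[OF V])

text \<open>
  The module axioms are identities in at most three elements, so they hold in \<open>W\<close> as soon as any
  three elements of \<open>W\<close> lie in the image of one module. For a quotient the module is always the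
  same; in a direct limit it depends on the three elements.
\<close>

lemma cmodule_local:
  fixes W :: "('b, 'n) normed_algebra_scheme" (structure)
  assumes ex: "\<And>x y z. x \<in> carrier W \<Longrightarrow> y \<in> carrier W \<Longrightarrow> z \<in> carrier W \<Longrightarrow>
      \<exists>(V :: ('a, 'm) normed_algebra_scheme) h. cmodule V \<and> module_map V W h \<and> x \<in> h ` carrier V \<and> y \<in> h ` carrier V \<and> z \<in> h ` carrier V"
    and ne: "carrier W \<noteq> {}"
  shows "cmodule W"
proof -
  have *: P if xyz: "x \<in> carrier W" "y \<in> carrier W" "z \<in> carrier W"
    and red: "\<And>(V :: ('a, 'm) normed_algebra_scheme) h a b c. cmodule V \<Longrightarrow> module_map V W h \<Longrightarrow>
      a \<in> carrier V \<Longrightarrow> b \<in> carrier V \<Longrightarrow> c \<in> carrier V \<Longrightarrow> x = h a \<Longrightarrow> y = h b \<Longrightarrow> z = h c \<Longrightarrow> P"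
    for P x y z
    using ex[OF xyz] red by blast
  show ?thesis
  proof (rule cmoduleI_direct)
    fix x y assume xy: "x \<in> carrier W" "y \<in> carrier W"
    show "x \<oplus> y \<in> carrier W"
    proof (rule *[OF xy xy(1)])
      fix V :: "('a, 'm) normed_algebra_scheme" and h a b c
      assume a: "cmodule V" "module_map V W h" "a \<in> carrier V" "b \<in> carrier V" "c \<in> carrier V" "x = h a" "y = h b" "x = h c"
      interpret V: cmodule V by fact
      show ?thesis using a module_mapD[OF a(2)] by (metis V.a_closed)
    qed
    show "x \<oplus> y = y \<oplus> x"
    proof (rule *[OF xy xy(1)])
      fix V :: "('a, 'm) normed_algebra_scheme" and h a b c
      assume a: "cmodule V" "module_map V W h" "a \<in> carrier V" "b \<in> carrier V" "c \<in> carrier V" "x = h a" "y = h b" "x = h c"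
      interpret V: cmodule V by fact
      show ?thesis using a module_mapD[OF a(2)] by (metis V.a_comm)
    qed
    show "c \<odot> (x \<oplus> y) = c \<odot> x \<oplus> c \<odot> y" for c
    proof (rule *[OF xy xy(1)])
      fix V :: "('a, 'm) normed_algebra_scheme" and h a b c'
      assume a: "cmodule V" "module_map V W h" "a \<in> carrier V" "b \<in> carrier V" "c' \<in> carrier V" "x = h a" "y = h b" "x = h c'"
      interpret V: cmodule V by fact
      show ?thesis unfolding a(6,7) using a(3,4) module_mapD[OF a(2)] V.sm_closed V.a_closed V.sm_r_distr[OF a(3,4), of c] by metis
    qed
  next
    fix x y z assume xyz: "x \<in> carrier W" "y \<in> carrier W" "z \<in> carrier W"
    show "x \<oplus> y \<oplus> z = x \<oplus> (y \<oplus> z)"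
    proof (rule *[OF xyz])
      fix V :: "('a, 'm) normed_algebra_scheme" and h a b c
      assume a: "cmodule V" "module_map V W h" "a \<in> carrier V" "b \<in> carrier V" "c \<in> carrier V" "x = h a" "y = h b" "z = h c"
      interpret V: cmodule V by fact
      show ?thesis unfolding a(6-8) using a(3-5) module_mapD[OF a(2)] V.a_closed V.a_assoc[OF a(3-5)] by metis
    qed
  next
    obtain x where x: "x \<in> carrier W" using ne by blast
    show "\<zero> \<in> carrier W"
    proof (rule *[OF x x x])
      fix V :: "('a, 'm) normed_algebra_scheme" and h
      assume a: "cmodule V" "module_map V W h"
      interpret V: cmodule V by fact
      show ?thesis using module_mapD(1,4)[OF a(2)] V.zero_closed by metis
    qed
  next
    fix x assume x: "x \<in> carrier W"
    have 1: "\<zero> \<oplus> x = x \<and> (\<forall>c. c \<odot> x \<in> carrier W) \<and> (\<forall>a b. (a + b) \<odot> x = a \<odot> x \<oplus> b \<odot> x) \<and>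
      (\<forall>a b. (a * b) \<odot> x = a \<odot> (b \<odot> x)) \<and> 1 \<odot> x = x \<and> 0 \<odot> x = \<zero>"
    proof (rule *[OF x x x])
      fix V :: "('a, 'm) normed_algebra_scheme" and h a
      assume a: "cmodule V" "module_map V W h" "a \<in> carrier V" "x = h a"
      interpret V: cmodule V by fact
      note m = module_mapD[OF a(2)]
      have "\<zero> \<oplus> x = h (\<zero>\<^bsub>V\<^esub> \<oplus>\<^bsub>V\<^esub> a)" using a m V.zero_closed by metis
      moreover have "(s + t) \<odot> x = s \<odot> x \<oplus> t \<odot> x" for s t
        unfolding a(4) using a(3) m V.sm_closed V.sm_l_distr by metis
      moreover have "(s * t) \<odot> x = s \<odot> (t \<odot> x)" for s t
        unfolding a(4) using a(3) m V.sm_closed V.sm_assoc by metis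
      moreover have "c \<odot> x \<in> carrier W" for c unfolding a(4) using a(3) m V.sm_closed by metis
      moreover have "1 \<odot> x = x" "0 \<odot> x = \<zero>" unfolding a(4) using a(3) m V.sm_one V.sm_zero by metis+
      ultimately show ?thesis using a by simp
    qed
    then show "\<zero> \<oplus> x = x" "\<And>c. c \<odot> x \<in> carrier W" "\<And>a b. (a + b) \<odot> x = a \<odot> x \<oplus> b \<odot> x"
      "\<And>a b. (a * b) \<odot> x = a \<odot> (b \<odot> x)" "1 \<odot> x = x" "0 \<odot> x = \<zero>" by blast+
  qed
qed

locale complex_algebra = cmodule A for A :: "('a, 'm) normed_algebra_scheme" (structure) +
  assumes mult_closed: "\<lbrakk>x \<in> carrier A; y \<in> carrier A\<rbrakk> \<Longrightarrow> x \<otimes> y \<in> carrier A"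
    and mult_assoc: "\<lbrakk>x \<in> carrier A; y \<in> carrier A; z \<in> carrier A\<rbrakk> \<Longrightarrow>
      (x \<otimes> y) \<otimes> z = x \<otimes> (y \<otimes> z)"
    and mult_l_distr: "\<lbrakk>x \<in> carrier A; y \<in> carrier A; z \<in> carrier A\<rbrakk> \<Longrightarrow>
      (x \<oplus> y) \<otimes> z = (x \<otimes> z) \<oplus> (y \<otimes> z)"
    and mult_r_distr: "\<lbrakk>x \<in> carrier A; y \<in> carrier A; z \<in> carrier A\<rbrakk> \<Longrightarrow>
      z \<otimes> (x \<oplus> y) = (z \<otimes> x) \<oplus> (z \<otimes> y)"
    and smult_mult_l: "\<lbrakk>x \<in> carrier A; y \<in> carrier A\<rbrakk> \<Longrightarrow> (c \<odot> x) \<otimes> y = c \<odot> (x \<otimes> y)"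
    and smult_mult_r: "\<lbrakk>x \<in> carrier A; y \<in> carrier A\<rbrakk> \<Longrightarrow> x \<otimes> (c \<odot> y) = c \<odot> (x \<otimes> y)"

definition alg_map :: "('a, 'm) normed_algebra_scheme \<Rightarrow> ('b, 'n) normed_algebra_scheme \<Rightarrow> ('a \<Rightarrow> 'b) \<Rightarrow> bool" where
  "alg_map V W h \<longleftrightarrow> module_map V W h \<and>
     (\<forall>x\<in>carrier V. \<forall>y\<in>carrier V. h (x \<otimes>\<^bsub>V\<^esub> y) = h x \<otimes>\<^bsub>W\<^esub> h y)"

lemma alg_map_module_map: "alg_map V W h \<Longrightarrow> module_map V W h"
  by (simp add: alg_map_def)

lemma alg_map_mult: "alg_map V W h \<Longrightarrow> x \<in> carrier V \<Longrightarrow> y \<in> carrier V \<Longrightarrow> h (x \<otimes>\<^bsub>V\<^esub> y) = h x \<otimes>\<^bsub>W\<^esub> h y"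
  by (simp add: alg_map_def)

lemmas alg_mapD = module_mapD[OF alg_map_module_map] alg_map_mult

lemma complex_algebra_local:
  fixes W :: "('b, 'n) normed_algebra_scheme" (structure)
  assumes ex: "\<And>x y z. x \<in> carrier W \<Longrightarrow> y \<in> carrier W \<Longrightarrow> z \<in> carrier W \<Longrightarrow>
      \<exists>(V :: ('a, 'm) normed_algebra_scheme) h. complex_algebra V \<and> alg_map V W h \<and> x \<in> h ` carrier V \<and> y \<in> h ` carrier V \<and> z \<in> h ` carrier V"
    and ne: "carrier W \<noteq> {}"
  shows "complex_algebra W"
proof -
  interpret W: cmodule W
  proof (rule cmodule_local[OF _ ne])
    fix x y z assume "x \<in> carrier W" "y \<in> carrier W" "z \<in> carrier W"
    from ex[OF this] obtain V :: "('a, 'm) normed_algebra_scheme" and h where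
      "complex_algebra V" "alg_map V W h" "x \<in> h ` carrier V" "y \<in> h ` carrier V" "z \<in> h ` carrier V" by blast
    then show "\<exists>(V :: ('a, 'm) normed_algebra_scheme) h. cmodule V \<and> module_map V W h \<and>
        x \<in> h ` carrier V \<and> y \<in> h ` carrier V \<and> z \<in> h ` carrier V"
      by (intro exI[of _ V] exI[of _ h] conjI) (auto dest: alg_map_module_map complex_algebra.axioms(1))
  qed
  have 3: "x \<otimes> y \<in> carrier W \<and> (x \<otimes> y) \<otimes> z = x \<otimes> (y \<otimes> z) \<and> (x \<oplus> y) \<otimes> z = (x \<otimes> z) \<oplus> (y \<otimes> z) \<and>
     z \<otimes> (x \<oplus> y) = (z \<otimes> x) \<oplus> (z \<otimes> y) \<and> (\<forall>c. (c \<odot> x) \<otimes> y = c \<odot> (x \<otimes> y)) \<and> (\<forall>c. x \<otimes> (c \<odot> y) = c \<odot> (x \<otimes> y))"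
    if xyz: "x \<in> carrier W" "y \<in> carrier W" "z \<in> carrier W" for x y z
  proof -
    obtain V :: "('a, 'm) normed_algebra_scheme" and h a b c where
      a: "complex_algebra V" "alg_map V W h" "a \<in> carrier V" "b \<in> carrier V" "c \<in> carrier V" "x = h a" "y = h b" "z = h c"
      using ex[OF xyz] by blast
    interpret V: complex_algebra V by fact
    note m = alg_mapD[OF a(2)] and cl = V.mult_closed V.a_closed V.sm_closed
    show ?thesis
      unfolding a(6-8)
    proof (intro conjI allI)
      show "h a \<otimes> h b \<in> carrier W" using a m cl by metis
      show "h a \<otimes> h b \<otimes> h c = h a \<otimes> (h b \<otimes> h c)" using a m cl V.mult_assoc[OF a(3-5)] by metis
      show "(h a \<oplus> h b) \<otimes> h c = (h a \<otimes> h c) \<oplus> (h b \<otimes> h c)" using a m cl V.mult_l_distr[OF a(3-5)] by metis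
      show "h c \<otimes> (h a \<oplus> h b) = (h c \<otimes> h a) \<oplus> (h c \<otimes> h b)" using a m cl V.mult_r_distr[OF a(3-5)] by metis
      show "(t \<odot> h a) \<otimes> h b = t \<odot> (h a \<otimes> h b)" for t using a m cl V.smult_mult_l[OF a(3,4)] by metis
      show "h a \<otimes> (t \<odot> h b) = t \<odot> (h a \<otimes> h b)" for t using a m cl V.smult_mult_r[OF a(3,4)] by metis
    qed
  qed
  show ?thesis
    by unfold_locales (use 3 in blast)+
qed

section \<open>Quotients by null spaces\<close>

text \<open>
  The function \<open>\<kappa>\<close> is a complete invariant of the classes modulo \<open>N\<close>, and replaces calculations with
  cosets. It will be either a homomorphism with kernel \<open>N\<close> or the passage to classes of functions
  that agree almost everywhere.
\<close>

locale null_quotient = cmodule V for V :: "('a, 'm) normed_algebra_scheme" (structure) +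
  fixes N :: "'a set" and \<kappa> :: "'a \<Rightarrow> 'k"
  assumes N_sub: "N \<subseteq> carrier V"
    and N_add: "x \<in> N \<Longrightarrow> y \<in> N \<Longrightarrow> x \<oplus> y \<in> N"
    and N_smult: "x \<in> N \<Longrightarrow> c \<odot> x \<in> N"
    and \<kappa>_iff: "x \<in> carrier V \<Longrightarrow> y \<in> carrier V \<Longrightarrow> \<kappa> x = \<kappa> y \<longleftrightarrow> x \<ominus> y \<in> N"
    and vnorm_\<kappa>: "x \<in> carrier V \<Longrightarrow> y \<in> carrier V \<Longrightarrow> \<kappa> x = \<kappa> y \<Longrightarrow> vnorm V x = vnorm V y"
begin

abbreviation Q :: "'a set normed_algebra" where "Q \<equiv> seminormed_quotient V N"

abbreviation cls :: "'a \<Rightarrow> 'a set" where "cls x \<equiv> N +> x"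

lemma cls_eq: "x \<in> carrier V \<Longrightarrow> cls x = {y \<in> carrier V. \<kappa> y = \<kappa> x}"
proof (intro equalityI subsetI)
  fix y assume x: "x \<in> carrier V" and "y \<in> cls x"
  then obtain h where h: "h \<in> N" "y = h \<oplus> x" by (auto simp: a_r_coset_def')
  then have hc: "h \<in> carrier V" using N_sub by auto
  have "y \<ominus> x = h" using h hc x by (simp add: minus_eq a_assoc r_neg)
  then show "y \<in> {y \<in> carrier V. \<kappa> y = \<kappa> x}" using h hc x \<kappa>_iff[of y x] by simp
next
  fix y assume x: "x \<in> carrier V" and "y \<in> {y \<in> carrier V. \<kappa> y = \<kappa> x}"
  then have y: "y \<in> carrier V" "y \<ominus> x \<in> N" using \<kappa>_iff by auto
  have "y = (y \<ominus> x) \<oplus> x" using x y by (simp add: diff_cancel)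
  then show "y \<in> cls x" using y(2) by (auto simp: a_r_coset_def')
qed

lemma cls_self: "x \<in> carrier V \<Longrightarrow> x \<in> cls x"
  by (simp add: cls_eq)

lemma cls_eq_iff: "x \<in> carrier V \<Longrightarrow> y \<in> carrier V \<Longrightarrow> cls x = cls y \<longleftrightarrow> \<kappa> x = \<kappa> y"
  by (auto simp: cls_eq set_eq_iff)

lemma carrier_Q: "carrier Q = cls ` carrier V"
  by (auto simp: seminormed_quotient_def FactRing_def A_RCOSETS_def RCOSETS_def a_r_coset_def)

lemma cls_in: "x \<in> carrier V \<Longrightarrow> cls x \<in> carrier Q"
  by (simp add: carrier_Q)

lemma zero_Q: "\<zero>\<^bsub>Q\<^esub> = cls \<zero>"
proof -
  have "cls \<zero> = N" using N_sub by (auto simp: cls_eq \<kappa>_iff diff_zero)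
  then show ?thesis by (simp add: seminormed_quotient_def FactRing_def)
qed

lemma \<kappa>_add:
  assumes "x \<in> carrier V" "y \<in> carrier V" "x' \<in> carrier V" "y' \<in> carrier V" "\<kappa> x = \<kappa> x'" "\<kappa> y = \<kappa> y'"
  shows "\<kappa> (x \<oplus> y) = \<kappa> (x' \<oplus> y')"
  using assms N_add by (simp add: \<kappa>_iff diff_add)

lemma \<kappa>_smult:
  assumes "x \<in> carrier V" "x' \<in> carrier V" "\<kappa> x = \<kappa> x'"
  shows "\<kappa> (c \<odot> x) = \<kappa> (c \<odot> x')"
  using assms N_smult by (simp add: \<kappa>_iff diff_smult)

lemma add_Q:
  assumes x: "x \<in> carrier V" and y: "y \<in> carrier V"
  shows "cls x \<oplus>\<^bsub>Q\<^esub> cls y = cls (x \<oplus> y)"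
proof -
  have "cls x \<oplus>\<^bsub>Q\<^esub> cls y = {a \<oplus> b | a b. a \<in> cls x \<and> b \<in> cls y}"
    by (auto simp: seminormed_quotient_def FactRing_def set_add_def set_mult_def)
  also have "\<dots> = cls (x \<oplus> y)"
  proof (intro equalityI subsetI)
    fix c assume "c \<in> {a \<oplus> b | a b. a \<in> cls x \<and> b \<in> cls y}"
    then obtain a b where c: "c = a \<oplus> b" "a \<in> carrier V" "b \<in> carrier V" "\<kappa> a = \<kappa> x" "\<kappa> b = \<kappa> y"
      using x y by (auto simp: cls_eq)
    show "c \<in> cls (x \<oplus> y)" using x y c \<kappa>_add[OF c(2,3) x y c(4,5)] by (simp add: cls_eq)
  next
    fix c assume "c \<in> cls (x \<oplus> y)"
    then have c: "c \<in> carrier V" "c \<ominus> (x \<oplus> y) \<in> N" using x y \<kappa>_iff by (auto simp: cls_eq)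
    have "(c \<ominus> y) \<ominus> x = c \<ominus> (x \<oplus> y)" using c x y by (simp add: minus_eq minus_add a_ac)
    then have "c \<ominus> y \<in> cls x" using c x y \<kappa>_iff[of "c \<ominus> y" x] by (simp add: cls_eq)
    moreover have "y \<in> cls y" "c = (c \<ominus> y) \<oplus> y" using c y by (auto simp: cls_self diff_cancel)
    ultimately show "c \<in> {a \<oplus> b | a b. a \<in> cls x \<and> b \<in> cls y}" by blast
  qed
  finally show ?thesis .
qed

lemma smult_Q:
  assumes x: "x \<in> carrier V"
  shows "c \<odot>\<^bsub>Q\<^esub> cls x = cls (c \<odot> x)"
proof -
  have "cls (c \<odot> y) = cls (c \<odot> x)" if "y \<in> cls x" for y
    using that x \<kappa>_smult[of y x] by (simp add: cls_eq_iff) (simp add: cls_eq)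
  then have "(\<Union>y\<in>cls x. cls (c \<odot> y)) = cls (c \<odot> x)" using cls_self[OF x] by blast
  then show ?thesis by (simp add: seminormed_quotient_def)
qed

lemma vnorm_Q:
  assumes x: "x \<in> carrier V"
  shows "vnorm Q (cls x) = vnorm V x"
proof -
  have "vnorm V ` cls x = {vnorm V x}"
  proof (intro equalityI subsetI)
    fix t assume "t \<in> vnorm V ` cls x"
    then obtain y where y: "t = vnorm V y" "y \<in> carrier V" "\<kappa> y = \<kappa> x" using x by (auto simp: cls_eq)
    show "t \<in> {vnorm V x}" using vnorm_\<kappa>[OF y(2) x y(3)] y(1) by simp
  qed (use cls_self[OF x] in auto)
  then show ?thesis by (simp add: seminormed_quotient_def)
qed

lemma module_map_cls: "module_map V Q cls"
  by (auto simp: module_map_def cls_in add_Q smult_Q zero_Q)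

lemma cmodule_Q: "cmodule Q"
proof (rule cmodule_local)
  show "carrier Q \<noteq> {}" using zero_closed by (auto simp: carrier_Q)
  fix x y z assume "x \<in> carrier Q" "y \<in> carrier Q" "z \<in> carrier Q"
  then show "\<exists>(V :: ('a, 'm) normed_algebra_scheme) h. cmodule V \<and> module_map V Q h \<and> x \<in> h ` carrier V \<and> y \<in> h ` carrier V \<and> z \<in> h ` carrier V"
    unfolding carrier_Q using cmodule_axioms module_map_cls by (intro exI[of _ V] exI[of _ cls] conjI)
qed

end

locale null_quotient_algebra = null_quotient V N \<kappa> + complex_algebra V
  for V :: "('a, 'm) normed_algebra_scheme" (structure) and N and \<kappa> :: "'a \<Rightarrow> 'k" +
  assumes \<kappa>_mult: "x \<in> carrier V \<Longrightarrow> y \<in> carrier V \<Longrightarrow> x' \<in> carrier V \<Longrightarrow> y' \<in> carrier V \<Longrightarrow>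
      \<kappa> x = \<kappa> x' \<Longrightarrow> \<kappa> y = \<kappa> y' \<Longrightarrow> \<kappa> (x \<otimes> y) = \<kappa> (x' \<otimes> y')"
begin

lemma mult_Q:
  assumes x: "x \<in> carrier V" and y: "y \<in> carrier V"
  shows "cls x \<otimes>\<^bsub>Q\<^esub> cls y = cls (x \<otimes> y)"
proof -
  have "cls (a \<otimes> b) = cls (x \<otimes> y)" if "a \<in> cls x" "b \<in> cls y" for a b
    using that x y \<kappa>_mult[of a b x y] by (simp add: cls_eq mult_closed)
  then have "(\<Union>a\<in>cls x. \<Union>b\<in>cls y. cls (a \<otimes> b)) = cls (x \<otimes> y)"
    using cls_self[OF x] cls_self[OF y] by blast
  then show ?thesis by (simp add: seminormed_quotient_def FactRing_def rcoset_mult_def)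
qed

lemma alg_map_cls: "alg_map V Q cls"
  by (simp add: alg_map_def module_map_cls mult_Q)

lemma complex_algebra_Q: "complex_algebra Q"
proof (rule complex_algebra_local)
  show "carrier Q \<noteq> {}" using zero_closed by (auto simp: carrier_Q)
  fix x y z assume "x \<in> carrier Q" "y \<in> carrier Q" "z \<in> carrier Q"
  then show "\<exists>(V :: ('a, 'm) normed_algebra_scheme) h. complex_algebra V \<and> alg_map V Q h \<and> x \<in> h ` carrier V \<and> y \<in> h ` carrier V \<and> z \<in> h ` carrier V"
    unfolding carrier_Q using complex_algebra_axioms alg_map_cls by (intro exI[of _ V] exI[of _ cls] conjI)
qed

end

section \<open>Normed modules\<close>

locale normed_module = cmodule V for V :: "('a, 'm) normed_algebra_scheme" (structure) +
  assumes vnorm_nonneg: "x \<in> carrier V \<Longrightarrow> 0 \<le> vnorm V x"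
    and vnorm_eq_0_iff: "x \<in> carrier V \<Longrightarrow> vnorm V x = 0 \<longleftrightarrow> x = \<zero>"
    and vnorm_triangle: "\<lbrakk>x \<in> carrier V; y \<in> carrier V\<rbrakk> \<Longrightarrow> vnorm V (x \<oplus> y) \<le> vnorm V x + vnorm V y"
    and vnorm_smult: "x \<in> carrier V \<Longrightarrow> vnorm V (c \<odot> x) = cmod c * vnorm V x"
begin

lemma vnorm_zero: "vnorm V \<zero> = 0"
  by (simp add: vnorm_eq_0_iff)

lemma vnorm_diff_commute: "x \<in> carrier V \<Longrightarrow> y \<in> carrier V \<Longrightarrow> vnorm V (x \<ominus> y) = vnorm V (y \<ominus> x)"
  by (subst diff_commute) (simp_all add: vnorm_smult)

lemma vnorm_diff_trans: "x \<in> carrier V \<Longrightarrow> y \<in> carrier V \<Longrightarrow> z \<in> carrier V \<Longrightarrow>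
    vnorm V (x \<ominus> z) \<le> vnorm V (x \<ominus> y) + vnorm V (y \<ominus> z)"
  by (subst diff_trans[of x y z]) (simp_all add: vnorm_triangle)

lemma vnorm_diff_eq_0: "x \<in> carrier V \<Longrightarrow> y \<in> carrier V \<Longrightarrow> vnorm V (x \<ominus> y) = 0 \<longleftrightarrow> x = y"
  by (simp add: vnorm_eq_0_iff diff_eq_zero)

lemma vnorm_le_add_diff: "x \<in> carrier V \<Longrightarrow> y \<in> carrier V \<Longrightarrow> vnorm V x \<le> vnorm V y + vnorm V (x \<ominus> y)"
  using vnorm_diff_trans[of x y \<zero>] by (simp add: diff_zero add.commute)

lemma vnorm_diff_ineq: "x \<in> carrier V \<Longrightarrow> y \<in> carrier V \<Longrightarrow> \<bar>vnorm V x - vnorm V y\<bar> \<le> vnorm V (x \<ominus> y)"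
  using vnorm_le_add_diff[of x y] vnorm_le_add_diff[of y x] by (simp add: vnorm_diff_commute[of x y])

lemma converges_in_unique:
  assumes s: "\<And>n. s n \<in> carrier V" and l: "l \<in> carrier V" "l' \<in> carrier V"
    and c: "converges_in V s l" "converges_in V s l'"
  shows "l = l'"
proof -
  have "(\<lambda>n. vnorm V (s n \<ominus> l) + vnorm V (s n \<ominus> l')) \<longlonglongrightarrow> 0 + 0"
    using c unfolding converges_in_def by (rule tendsto_add)
  moreover have "vnorm V (l \<ominus> l') \<le> vnorm V (s n \<ominus> l) + vnorm V (s n \<ominus> l')" for n
    using vnorm_diff_trans[OF l(1) s l(2), of n] by (simp add: vnorm_diff_commute[OF l(1) s])
  ultimately have "vnorm V (l \<ominus> l') \<le> 0 + 0" by (intro LIMSEQ_le_const) auto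
  then have "vnorm V (l \<ominus> l') = 0" using vnorm_nonneg[of "l \<ominus> l'"] l by simp
  then show ?thesis using l by (simp add: vnorm_diff_eq_0)
qed

lemma converges_in_add:
  assumes "\<And>n. s n \<in> carrier V" "\<And>n. t n \<in> carrier V" "l \<in> carrier V" "m \<in> carrier V"
    and c: "converges_in V s l" "converges_in V t m"
  shows "converges_in V (\<lambda>n. s n \<oplus> t n) (l \<oplus> m)"
  unfolding converges_in_def
proof (rule tendsto_sandwich[OF _ _ tendsto_const])
  show "(\<lambda>n. vnorm V (s n \<ominus> l) + vnorm V (t n \<ominus> m)) \<longlonglongrightarrow> 0"
    using tendsto_add[OF c[unfolded converges_in_def]] by simp
qed (use assms in \<open>auto simp: diff_add vnorm_nonneg vnorm_triangle\<close>)

lemma converges_in_smult: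
  assumes "\<And>n. s n \<in> carrier V" "l \<in> carrier V" "converges_in V s l"
  shows "converges_in V (\<lambda>n. c \<odot> s n) (c \<odot> l)"
  using tendsto_mult_left[OF assms(3)[unfolded converges_in_def], of "cmod c"] assms(1,2)
  by (simp add: converges_in_def diff_smult vnorm_smult)

lemma converges_in_const: "l \<in> carrier V \<Longrightarrow> converges_in V (\<lambda>n. l) l"
  by (simp add: converges_in_def diff_self vnorm_zero)

lemma converges_in_vnorm:
  assumes "\<And>n. s n \<in> carrier V" "l \<in> carrier V" "converges_in V s l"
  shows "(\<lambda>n. vnorm V (s n)) \<longlonglongrightarrow> vnorm V l"
proof (rule LIM_zero_cancel, rule tendsto_rabs_zero_cancel, rule tendsto_sandwich[OF _ _ tendsto_const])
  show "(\<lambda>n. vnorm V (s n \<ominus> l)) \<longlonglongrightarrow> 0" using assms(3) by (simp add: converges_in_def)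
qed (use assms vnorm_diff_ineq in auto)

lemma converges_in_Cauchy:
  assumes s: "\<And>n. s n \<in> carrier V" and l: "l \<in> carrier V" "converges_in V s l"
  shows "Cauchy_in V s"
  unfolding Cauchy_in_def
proof (intro conjI allI impI s)
  fix e :: real assume "0 < e"
  then obtain N where N: "\<And>n. n \<ge> N \<Longrightarrow> vnorm V (s n \<ominus> l) < e / 2"
    using order_tendstoD(2)[OF l(2)[unfolded converges_in_def], of "e / 2"] by (auto simp: eventually_sequentially)
  have "vnorm V (s m \<ominus> s n) < e" if "m \<ge> N" "n \<ge> N" for m n
    using vnorm_diff_trans[OF s l(1) s, of m n] N[OF that(1)] N[OF that(2)] by (simp add: vnorm_diff_commute[OF l(1) s])
  then show "\<exists>N. \<forall>m\<ge>N. \<forall>n\<ge>N. vnorm V (s m \<ominus> s n) < e" by blast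
qed

lemma Cauchy_in_vnorm:
  assumes "Cauchy_in V s"
  shows "convergent (\<lambda>n. vnorm V (s n))"
proof (rule Cauchy_convergent, rule metric_CauchyI)
  fix e :: real assume "0 < e"
  then obtain N where N: "\<forall>m\<ge>N. \<forall>n\<ge>N. vnorm V (s m \<ominus> s n) < e" using assms by (auto simp: Cauchy_in_def)
  have "s n \<in> carrier V" for n using assms by (auto simp: Cauchy_in_def)
  then have "dist (vnorm V (s m)) (vnorm V (s n)) \<le> vnorm V (s m \<ominus> s n)" for m n
    using vnorm_diff_ineq by (simp add: dist_real_def)
  then show "\<exists>M. \<forall>m\<ge>M. \<forall>n\<ge>M. dist (vnorm V (s m)) (vnorm V (s n)) < e"
    using N by (meson le_less_trans)
qed

lemma Cauchy_in_bounded: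
  assumes "Cauchy_in V s"
  obtains K where "0 < K" "\<And>n. vnorm V (s n) \<le> K"
proof -
  have "Bseq (\<lambda>n. vnorm V (s n))" using Cauchy_in_vnorm[OF assms] by (rule convergent_imp_Bseq)
  then obtain K where "0 < K" "\<And>n. norm (vnorm V (s n)) \<le> K" by (auto simp: Bseq_def)
  then show thesis using that[of K] by (auto simp: abs_le_iff)
qed

end

locale normed_complex_algebra = normed_module A + complex_algebra A for A :: "('a, 'm) normed_algebra_scheme" (structure) +
  assumes vnorm_mult: "\<lbrakk>x \<in> carrier A; y \<in> carrier A\<rbrakk> \<Longrightarrow> vnorm A (x \<otimes> y) \<le> vnorm A x * vnorm A y"
begin

lemma diff_mult:
  assumes "x \<in> carrier A" "y \<in> carrier A" "x' \<in> carrier A" "y' \<in> carrier A"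
  shows "(x \<otimes> y) \<ominus> (x' \<otimes> y') = (x \<ominus> x') \<otimes> y \<oplus> x' \<otimes> (y \<ominus> y')"
proof -
  have "(x \<ominus> x') \<otimes> y \<oplus> x' \<otimes> (y \<ominus> y') = (x \<otimes> y \<ominus> x' \<otimes> y) \<oplus> (x' \<otimes> y \<ominus> x' \<otimes> y')"
    using assms by (simp add: minus_smult mult_l_distr mult_r_distr smult_mult_l smult_mult_r mult_closed)
  also have "\<dots> = (x \<otimes> y) \<ominus> (x' \<otimes> y')"
    using assms by (intro diff_trans[symmetric]) (simp_all add: mult_closed)
  finally show ?thesis ..
qed

lemma vnorm_diff_mult:
  assumes "x \<in> carrier A" "y \<in> carrier A" "x' \<in> carrier A" "y' \<in> carrier A"
  shows "vnorm A ((x \<otimes> y) \<ominus> (x' \<otimes> y')) \<le> vnorm A (x \<ominus> x') * vnorm A y + vnorm A x' * vnorm A (y \<ominus> y')"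
proof -
  have "vnorm A ((x \<otimes> y) \<ominus> (x' \<otimes> y')) \<le> vnorm A ((x \<ominus> x') \<otimes> y) + vnorm A (x' \<otimes> (y \<ominus> y'))"
    unfolding diff_mult[OF assms] using assms by (intro vnorm_triangle) (auto simp: mult_closed)
  also have "\<dots> \<le> vnorm A (x \<ominus> x') * vnorm A y + vnorm A x' * vnorm A (y \<ominus> y')"
    using assms by (intro add_mono vnorm_mult) auto
  finally show ?thesis .
qed

lemma converges_in_mult:
  assumes s: "\<And>n. s n \<in> carrier A" and t: "\<And>n. t n \<in> carrier A" and l: "l \<in> carrier A" "m \<in> carrier A"
    and c: "converges_in A s l" "converges_in A t m"
  shows "converges_in A (\<lambda>n. s n \<otimes> t n) (l \<otimes> m)"
  unfolding converges_in_def
proof (rule tendsto_sandwich[OF _ _ tendsto_const])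
  have "(\<lambda>n. vnorm A (s n \<ominus> l) * vnorm A (t n) + vnorm A l * vnorm A (t n \<ominus> m)) \<longlonglongrightarrow> 0 * vnorm A m + vnorm A l * 0"
    using c by (intro tendsto_add tendsto_mult tendsto_const converges_in_vnorm t l) (auto simp: converges_in_def)
  then show "(\<lambda>n. vnorm A (s n \<ominus> l) * vnorm A (t n) + vnorm A l * vnorm A (t n \<ominus> m)) \<longlonglongrightarrow> 0" by simp
  show "eventually (\<lambda>n. vnorm A (s n \<otimes> t n \<ominus> l \<otimes> m) \<le> vnorm A (s n \<ominus> l) * vnorm A (t n) + vnorm A l * vnorm A (t n \<ominus> m)) sequentially"
    using s t l by (intro always_eventually allI vnorm_diff_mult)
qed (use s t l in \<open>auto simp: vnorm_nonneg mult_closed\<close>)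

end

text \<open>
  Completeness is split off, because it is the last property to be established for a quotient or a
  completion.
\<close>

lemma complex_banach_algebraD:
  assumes "complex_banach_algebra A"
  shows "normed_complex_algebra A"
proof -
  interpret complex_banach_algebra A by fact
  show ?thesis
    by unfold_locales
      (auto simp: mult_closed mult_assoc mult_l_distr mult_r_distr smult_mult_l smult_mult_r vnorm_nonneg vnorm_eq_0_iff
        intro: vnorm_triangle vnorm_smult vnorm_mult)
qed

lemma complex_banach_algebraI:
  assumes "normed_complex_algebra A"
    and "\<And>s. Cauchy_in A s \<Longrightarrow> \<exists>l\<in>carrier A. converges_in A s l"
  shows "complex_banach_algebra A"
proof -
  interpret normed_complex_algebra A by fact
  show ?thesis
    by unfold_locales
      (auto simp: mult_closed mult_assoc mult_l_distr mult_r_distr smult_mult_l smult_mult_r vnorm_nonneg vnorm_eq_0_iff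
        intro: vnorm_triangle vnorm_smult vnorm_mult assms(2))
qed

section \<open>Bounded operators\<close>

locale operators_on = normed_module V for V :: "('v, 'm) normed_algebra_scheme" (structure)
begin

abbreviation B :: "('v \<Rightarrow> 'v) normed_algebra" where "B \<equiv> bounded_operators V"

lemma op_iff: "T \<in> carrier B \<longleftrightarrow> T \<in> carrier V \<rightarrow>\<^sub>E carrier V \<and>
   (\<forall>x\<in>carrier V. \<forall>y\<in>carrier V. T (x \<oplus> y) = T x \<oplus> T y) \<and>
   (\<forall>c. \<forall>x\<in>carrier V. T (c \<odot> x) = c \<odot> T x) \<and>
   (\<exists>C. \<forall>x\<in>carrier V. vnorm V (T x) \<le> C * vnorm V x)"
  by (simp add: bounded_operators_def)

lemma opD:
  assumes "T \<in> carrier B"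
  shows "x \<in> carrier V \<Longrightarrow> T x \<in> carrier V"
    "x \<in> carrier V \<Longrightarrow> y \<in> carrier V \<Longrightarrow> T (x \<oplus> y) = T x \<oplus> T y"
    "x \<in> carrier V \<Longrightarrow> T (c \<odot> x) = c \<odot> T x"
  using assms by (auto simp: op_iff)

lemma op_eqI:
  assumes "S \<in> carrier B" "T \<in> carrier B" "\<And>x. x \<in> carrier V \<Longrightarrow> S x = T x"
  shows "S = T"
  using assms by (auto simp: op_iff intro: PiE_ext)

lemma op_vnorm_def: "vnorm B T = (SUP x\<in>{x \<in> carrier V. vnorm V x \<le> 1}. vnorm V (T x))"
  by (simp add: bounded_operators_def)

lemma unit_ball_ne: "{x \<in> carrier V. vnorm V x \<le> 1} \<noteq> {}"
  using vnorm_zero by (auto intro!: exI[of _ \<zero>])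

lemma op_bdd:
  assumes "T \<in> carrier B"
  shows "bdd_above ((\<lambda>x. vnorm V (T x)) ` {x \<in> carrier V. vnorm V x \<le> 1})"
proof -
  obtain C where C: "\<And>x. x \<in> carrier V \<Longrightarrow> vnorm V (T x) \<le> C * vnorm V x"
    using assms unfolding op_iff by blast
  show ?thesis
  proof (rule bdd_aboveI2[where M="\<bar>C\<bar>"])
    fix x assume x: "x \<in> {x \<in> carrier V. vnorm V x \<le> 1}"
    have "C * vnorm V x \<le> \<bar>C\<bar> * 1" using x by (intro mult_mono) (auto simp: vnorm_nonneg)
    then show "vnorm V (T x) \<le> \<bar>C\<bar>" using C[of x] x by auto
  qed
qed

lemma op_vnorm_nonneg: "T \<in> carrier B \<Longrightarrow> 0 \<le> vnorm B T"
  unfolding op_vnorm_def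
  by (rule cSUP_upper2[OF op_bdd, of T \<zero>]) (auto simp: vnorm_zero opD vnorm_nonneg)

lemma op_zero: "T \<in> carrier B \<Longrightarrow> T \<zero> = \<zero>"
  using opD(3)[of T \<zero> 0] opD(1)[of T \<zero>] by (simp add: sm_zero)

lemma op_bound:
  assumes T: "T \<in> carrier B" and x: "x \<in> carrier V"
  shows "vnorm V (T x) \<le> vnorm B T * vnorm V x"
proof (cases "vnorm V x = 0")
  case True
  then show ?thesis using x T by (simp add: vnorm_eq_0_iff op_zero vnorm_zero)
next
  case False
  then have pos: "0 < vnorm V x" using vnorm_nonneg[OF x] by simp
  let ?y = "complex_of_real (1 / vnorm V x) \<odot> x"
  have "vnorm V (T ?y) \<le> vnorm B T"
    unfolding op_vnorm_def using pos x by (intro cSUP_upper op_bdd T) (auto simp: vnorm_smult norm_divide)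
  moreover have "vnorm V (T ?y) = vnorm V (T x) / vnorm V x"
    using pos x T by (simp add: opD vnorm_smult norm_divide)
  ultimately have "vnorm V (T x) / vnorm V x \<le> vnorm B T" by simp
  then show ?thesis using pos by (simp add: pos_divide_le_eq)
qed

lemma op_vnorm_leI:
  assumes T: "T \<in> carrier B" and C: "\<And>x. x \<in> carrier V \<Longrightarrow> vnorm V (T x) \<le> C * vnorm V x" "0 \<le> C"
  shows "vnorm B T \<le> C"
  unfolding op_vnorm_def
proof (rule cSUP_least[OF unit_ball_ne])
  fix x assume "x \<in> {x \<in> carrier V. vnorm V x \<le> 1}"
  then show "vnorm V (T x) \<le> C"
    using C(1)[of x] C(2) mult_left_le[of "vnorm V x" C] by simp
qed

lemma op_near:
  assumes T: "T \<in> carrier B" and e: "0 < e"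
  obtains x where "x \<in> carrier V" "vnorm V x \<le> 1" "vnorm B T - e < vnorm V (T x)"
  using less_cSUP_iff[OF unit_ball_ne op_bdd[OF T], of "vnorm B T - e"] e
  unfolding op_vnorm_def by auto

lemma opI:
  assumes "\<And>x. x \<in> carrier V \<Longrightarrow> f x \<in> carrier V"
    "\<And>x y. x \<in> carrier V \<Longrightarrow> y \<in> carrier V \<Longrightarrow> f (x \<oplus> y) = f x \<oplus> f y"
    "\<And>c x. x \<in> carrier V \<Longrightarrow> f (c \<odot> x) = c \<odot> f x"
    "\<And>x. x \<in> carrier V \<Longrightarrow> vnorm V (f x) \<le> C * vnorm V x"
  shows "(\<lambda>x\<in>carrier V. f x) \<in> carrier B"
  unfolding op_iff using assms by (auto intro!: exI[of _ C])

lemma B_ops: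
  "S \<oplus>\<^bsub>B\<^esub> T = (\<lambda>x\<in>carrier V. S x \<oplus> T x)" "c \<odot>\<^bsub>B\<^esub> T = (\<lambda>x\<in>carrier V. c \<odot> T x)"
  "\<zero>\<^bsub>B\<^esub> = (\<lambda>x\<in>carrier V. \<zero>)" "S \<otimes>\<^bsub>B\<^esub> T = compose (carrier V) S T"
  by (simp_all add: bounded_operators_def)

lemma op_add:
  assumes "S \<in> carrier B" "T \<in> carrier B" shows "S \<oplus>\<^bsub>B\<^esub> T \<in> carrier B"
  unfolding B_ops
proof (rule opI[where C="vnorm B S + vnorm B T"])
  fix x assume x: "x \<in> carrier V"
  have "vnorm V (S x \<oplus> T x) \<le> vnorm V (S x) + vnorm V (T x)" using assms x by (simp add: vnorm_triangle opD)
  also have "\<dots> \<le> vnorm B S * vnorm V x + vnorm B T * vnorm V x" by (intro add_mono op_bound assms x)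
  finally show "vnorm V (S x \<oplus> T x) \<le> (vnorm B S + vnorm B T) * vnorm V x" by (simp add: algebra_simps)
qed (use assms in \<open>auto simp: opD a_ac sm_r_distr\<close>)

lemma op_smult:
  assumes "T \<in> carrier B" shows "c \<odot>\<^bsub>B\<^esub> T \<in> carrier B"
  unfolding B_ops
proof (rule opI[where C="cmod c * vnorm B T"])
  fix x assume x: "x \<in> carrier V"
  show "vnorm V (c \<odot> T x) \<le> cmod c * vnorm B T * vnorm V x"
    using op_bound[OF assms x] assms x by (simp add: vnorm_smult opD mult.assoc mult_left_mono)
qed (use assms in \<open>auto simp: opD sm_r_distr sm_assoc[symmetric] mult.commute\<close>)

lemma op_zero_in: "\<zero>\<^bsub>B\<^esub> \<in> carrier B"
  unfolding B_ops by (rule opI[where C=0]) (auto simp: sm_zero_r vnorm_zero)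

lemma op_mult:
  assumes "S \<in> carrier B" "T \<in> carrier B"
  shows "S \<otimes>\<^bsub>B\<^esub> T \<in> carrier B" "vnorm B (S \<otimes>\<^bsub>B\<^esub> T) \<le> vnorm B S * vnorm B T"
proof -
  have *: "vnorm V (S (T x)) \<le> (vnorm B S * vnorm B T) * vnorm V x" if x: "x \<in> carrier V" for x
  proof -
    have "vnorm V (S (T x)) \<le> vnorm B S * vnorm V (T x)" using assms x by (simp add: op_bound opD)
    also have "\<dots> \<le> vnorm B S * (vnorm B T * vnorm V x)"
      by (intro mult_left_mono op_bound assms x op_vnorm_nonneg)
    finally show ?thesis by simp
  qed
  show m: "S \<otimes>\<^bsub>B\<^esub> T \<in> carrier B"
    unfolding B_ops compose_def by (rule opI[OF _ _ _ *]) (use assms in \<open>auto simp: opD\<close>)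
  show "vnorm B (S \<otimes>\<^bsub>B\<^esub> T) \<le> vnorm B S * vnorm B T"
    by (rule op_vnorm_leI[OF m]) (use * assms in \<open>auto simp: B_ops compose_def op_vnorm_nonneg\<close>)
qed

lemma cmodule_B: "cmodule B"
proof (rule cmoduleI_direct)
  show "\<zero>\<^bsub>B\<^esub> \<oplus>\<^bsub>B\<^esub> T = T" if "T \<in> carrier B" for T
    by (rule op_eqI[OF op_add[OF op_zero_in that] that]) (simp add: B_ops(1-3) opD[OF that])
  show "1 \<odot>\<^bsub>B\<^esub> T = T" if "T \<in> carrier B" for T
    by (rule op_eqI[OF op_smult[OF that] that]) (simp add: B_ops(1-3) opD[OF that] sm_one)
  show "0 \<odot>\<^bsub>B\<^esub> T = \<zero>\<^bsub>B\<^esub>" if "T \<in> carrier B" for T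
    by (rule op_eqI[OF op_smult[OF that] op_zero_in]) (simp add: B_ops(1-3) opD[OF that] sm_zero)
  show "(a + b) \<odot>\<^bsub>B\<^esub> T = a \<odot>\<^bsub>B\<^esub> T \<oplus>\<^bsub>B\<^esub> b \<odot>\<^bsub>B\<^esub> T" "(a * b) \<odot>\<^bsub>B\<^esub> T = a \<odot>\<^bsub>B\<^esub> (b \<odot>\<^bsub>B\<^esub> T)"
    if "T \<in> carrier B" for a b T
    using that by (auto simp: B_ops(1-3) opD sm_l_distr sm_assoc intro!: restrict_ext)
  show "S \<oplus>\<^bsub>B\<^esub> T = T \<oplus>\<^bsub>B\<^esub> S" "a \<odot>\<^bsub>B\<^esub> (S \<oplus>\<^bsub>B\<^esub> T) = a \<odot>\<^bsub>B\<^esub> S \<oplus>\<^bsub>B\<^esub> a \<odot>\<^bsub>B\<^esub> T"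
    if "S \<in> carrier B" "T \<in> carrier B" for a S T
    using that by (auto simp: B_ops(1-3) opD sm_r_distr a_comm intro!: restrict_ext)
  show "R \<oplus>\<^bsub>B\<^esub> S \<oplus>\<^bsub>B\<^esub> T = R \<oplus>\<^bsub>B\<^esub> (S \<oplus>\<^bsub>B\<^esub> T)" if "R \<in> carrier B" "S \<in> carrier B" "T \<in> carrier B" for R S T
    using that by (auto simp: B_ops(1-3) opD a_assoc intro!: restrict_ext)
qed (auto intro: op_add op_smult op_zero_in)

lemma op_diff: "S \<in> carrier B \<Longrightarrow> T \<in> carrier B \<Longrightarrow> x \<in> carrier V \<Longrightarrow> (S \<ominus>\<^bsub>B\<^esub> T) x = S x \<ominus> T x"
  by (simp add: cmodule.minus_smult[OF cmodule_B]) (simp add: B_ops minus_smult opD)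

lemma normed_complex_algebra_B: "normed_complex_algebra B"
proof -
  interpret B: cmodule B by (rule cmodule_B)
  have nm: "vnorm B T = 0 \<longleftrightarrow> T = \<zero>\<^bsub>B\<^esub>" if T: "T \<in> carrier B" for T
  proof
    assume "vnorm B T = 0"
    then have "vnorm V (T x) = 0" if "x \<in> carrier V" for x
      using op_bound[OF T that] vnorm_nonneg[OF opD(1)[OF T that]] by simp
    then show "T = \<zero>\<^bsub>B\<^esub>"
      by (intro op_eqI[OF T op_zero_in]) (simp add: vnorm_eq_0_iff opD[OF T] B_ops)
  next
    assume "T = \<zero>\<^bsub>B\<^esub>"
    then have "vnorm B T \<le> 0" by (intro op_vnorm_leI T) (auto simp: B_ops vnorm_zero)
    then show "vnorm B T = 0" using op_vnorm_nonneg[OF T] by simp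
  qed
  have tri: "vnorm B (S \<oplus>\<^bsub>B\<^esub> T) \<le> vnorm B S + vnorm B T" if "S \<in> carrier B" "T \<in> carrier B" for S T
  proof (rule op_vnorm_leI[OF op_add[OF that]])
    fix x assume x: "x \<in> carrier V"
    have "vnorm V (S x \<oplus> T x) \<le> vnorm V (S x) + vnorm V (T x)" using that x by (simp add: vnorm_triangle opD)
    also have "\<dots> \<le> vnorm B S * vnorm V x + vnorm B T * vnorm V x" by (intro add_mono op_bound that x)
    finally show "vnorm V ((S \<oplus>\<^bsub>B\<^esub> T) x) \<le> (vnorm B S + vnorm B T) * vnorm V x"
      using x by (simp add: B_ops algebra_simps)
  qed (use that in \<open>simp add: op_vnorm_nonneg\<close>)
  have sm_le: "vnorm B (c \<odot>\<^bsub>B\<^esub> T) \<le> cmod c * vnorm B T" if T: "T \<in> carrier B" for c T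
  proof (rule op_vnorm_leI[OF op_smult[OF T]])
    fix x assume x: "x \<in> carrier V"
    show "vnorm V ((c \<odot>\<^bsub>B\<^esub> T) x) \<le> cmod c * vnorm B T * vnorm V x"
      using op_bound[OF T x] T x by (simp add: B_ops vnorm_smult opD mult.assoc mult_left_mono)
  qed (use T in \<open>simp add: op_vnorm_nonneg\<close>)
  have sm: "vnorm B (c \<odot>\<^bsub>B\<^esub> T) = cmod c * vnorm B T" if T: "T \<in> carrier B" for c T
  proof (cases "c = 0")
    case True
    then show ?thesis using T nm[OF op_zero_in] by (simp add: B.sm_zero)
  next
    case False
    have "vnorm B T = vnorm B (inverse c \<odot>\<^bsub>B\<^esub> (c \<odot>\<^bsub>B\<^esub> T))"
      using T False by (simp add: B.sm_assoc[symmetric] B.sm_one)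
    also have "\<dots> \<le> cmod (inverse c) * vnorm B (c \<odot>\<^bsub>B\<^esub> T)" by (rule sm_le[OF op_smult[OF T]])
    finally have "cmod c * vnorm B T \<le> vnorm B (c \<odot>\<^bsub>B\<^esub> T)"
      using False by (simp add: norm_divide inverse_eq_divide pos_le_divide_eq mult.commute)
    then show ?thesis using sm_le[OF T, of c] by simp
  qed
  show ?thesis
  proof unfold_locales
    show "R \<otimes>\<^bsub>B\<^esub> S \<otimes>\<^bsub>B\<^esub> T = R \<otimes>\<^bsub>B\<^esub> (S \<otimes>\<^bsub>B\<^esub> T)" if "R \<in> carrier B" "S \<in> carrier B" "T \<in> carrier B" for R S T
      using that by (auto simp: B_ops(4) compose_def opD intro!: restrict_ext)
    show "(R \<oplus>\<^bsub>B\<^esub> S) \<otimes>\<^bsub>B\<^esub> T = (R \<otimes>\<^bsub>B\<^esub> T) \<oplus>\<^bsub>B\<^esub> (S \<otimes>\<^bsub>B\<^esub> T)"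
      "T \<otimes>\<^bsub>B\<^esub> (R \<oplus>\<^bsub>B\<^esub> S) = (T \<otimes>\<^bsub>B\<^esub> R) \<oplus>\<^bsub>B\<^esub> (T \<otimes>\<^bsub>B\<^esub> S)"
      if "R \<in> carrier B" "S \<in> carrier B" "T \<in> carrier B" for R S T
      using that by (auto simp: B_ops compose_def opD intro!: restrict_ext)
    show "(c \<odot>\<^bsub>B\<^esub> S) \<otimes>\<^bsub>B\<^esub> T = c \<odot>\<^bsub>B\<^esub> (S \<otimes>\<^bsub>B\<^esub> T)" "S \<otimes>\<^bsub>B\<^esub> (c \<odot>\<^bsub>B\<^esub> T) = c \<odot>\<^bsub>B\<^esub> (S \<otimes>\<^bsub>B\<^esub> T)"
      if "S \<in> carrier B" "T \<in> carrier B" for c S T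
      using that by (auto simp: B_ops compose_def opD intro!: restrict_ext)
  qed (use nm tri sm op_vnorm_nonneg op_mult in auto)
qed

text \<open>
  A Cauchy sequence of operators converges pointwise; the pointwise limit is bounded because the
  operator norms of the sequence are, and it is the limit in norm because the Cauchy estimate
  survives the pointwise limit of one of its two indices.
\<close>

theorem complex_banach_algebra_B:
  assumes complete: "\<And>s. Cauchy_in V s \<Longrightarrow> \<exists>l\<in>carrier V. converges_in V s l"
  shows "complex_banach_algebra B"
proof (rule complex_banach_algebraI[OF normed_complex_algebra_B])
  interpret B: normed_complex_algebra B by (rule normed_complex_algebra_B)
  fix s assume s: "Cauchy_in B s"
  then have sB: "s n \<in> carrier B" for n by (auto simp: Cauchy_in_def)
  have dle: "vnorm V (s m x \<ominus> s n x) \<le> vnorm B (s m \<ominus>\<^bsub>B\<^esub> s n) * vnorm V x" if "x \<in> carrier V" for m n x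
    using op_bound[OF B.minus_closed[OF sB sB], OF that, of m n] by (simp add: op_diff sB that)
  have "Cauchy_in V (\<lambda>n. s n x)" if x: "x \<in> carrier V" for x
    unfolding Cauchy_in_def
  proof (intro conjI allI impI)
    show "s n x \<in> carrier V" for n using opD(1)[OF sB x] .
    fix e :: real assume e: "0 < e"
    have pos: "0 < vnorm V x + 1" using vnorm_nonneg[OF x] by simp
    then obtain N where N: "\<forall>m\<ge>N. \<forall>n\<ge>N. vnorm B (s m \<ominus>\<^bsub>B\<^esub> s n) < e / (vnorm V x + 1)"
      using s e unfolding Cauchy_in_def by (meson divide_pos_pos)
    have "vnorm V (s m x \<ominus> s n x) < e" if "m \<ge> N" "n \<ge> N" for m n
    proof -
      have "vnorm V (s m x \<ominus> s n x) \<le> vnorm B (s m \<ominus>\<^bsub>B\<^esub> s n) * (vnorm V x + 1)"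
        using dle[OF x, of m n] op_vnorm_nonneg[OF B.minus_closed[OF sB sB], of m n] by (simp add: algebra_simps)
      also have "\<dots> < e" using N that pos by (simp add: pos_less_divide_eq)
      finally show ?thesis .
    qed
    then show "\<exists>N. \<forall>m\<ge>N. \<forall>n\<ge>N. vnorm V (s m x \<ominus> s n x) < e" by blast
  qed
  then have "\<forall>x\<in>carrier V. \<exists>l\<in>carrier V. converges_in V (\<lambda>n. s n x) l" using complete by blast
  then obtain f where f: "\<And>x. x \<in> carrier V \<Longrightarrow> f x \<in> carrier V" "\<And>x. x \<in> carrier V \<Longrightarrow> converges_in V (\<lambda>n. s n x) (f x)"
    by metis
  obtain K where K: "0 < K" "\<And>n. vnorm B (s n) \<le> K" using B.Cauchy_in_bounded[OF s] by blast
  define T where "T = (\<lambda>x\<in>carrier V. f x)"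
  have T: "T \<in> carrier B"
    unfolding T_def
  proof (rule opI[where C=K])
    fix x y assume xy: "x \<in> carrier V" "y \<in> carrier V"
    have "converges_in V (\<lambda>n. s n x \<oplus> s n y) (f x \<oplus> f y)"
      by (intro converges_in_add opD(1)[OF sB] f xy)
    then have "converges_in V (\<lambda>n. s n (x \<oplus> y)) (f x \<oplus> f y)" using xy by (simp add: opD[OF sB])
    from converges_in_unique[OF _ _ _ f(2) this] show "f (x \<oplus> y) = f x \<oplus> f y"
      using xy f by (auto intro: opD(1)[OF sB])
  next
    fix c x assume x: "x \<in> carrier V"
    have "converges_in V (\<lambda>n. c \<odot> s n x) (c \<odot> f x)"
      by (intro converges_in_smult opD(1)[OF sB] f x)
    then have "converges_in V (\<lambda>n. s n (c \<odot> x)) (c \<odot> f x)" using x by (simp add: opD[OF sB])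
    from converges_in_unique[OF _ _ _ f(2) this] show "f (c \<odot> x) = c \<odot> f x"
      using x f by (auto intro: opD(1)[OF sB])
  next
    fix x assume x: "x \<in> carrier V"
    have "vnorm V (s n x) \<le> K * vnorm V x" for n
      using op_bound[OF sB x, of n] mult_right_mono[OF K(2) vnorm_nonneg[OF x], of n] by simp
    then show "vnorm V (f x) \<le> K * vnorm V x"
      by (intro LIMSEQ_le_const2[OF converges_in_vnorm[OF opD(1)[OF sB x] f(1)[OF x] f(2)[OF x]]]) auto
  qed (rule f)
  have "converges_in B s T"
    unfolding converges_in_def
  proof (rule LIMSEQ_I)
    fix e :: real assume "0 < e"
    then obtain N where N: "\<forall>m\<ge>N. \<forall>n\<ge>N. vnorm B (s m \<ominus>\<^bsub>B\<^esub> s n) < e / 2"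
      using s unfolding Cauchy_in_def by (meson half_gt_zero)
    have "vnorm B (s n \<ominus>\<^bsub>B\<^esub> T) \<le> e / 2" if n: "n \<ge> N" for n
    proof (rule op_vnorm_leI[OF B.minus_closed[OF sB T]])
      fix x assume x: "x \<in> carrier V"
      have c: "s m x \<in> carrier V" for m by (rule opD(1)[OF sB x])
      have "converges_in V (\<lambda>m. s n x \<oplus> (-1) \<odot> s m x) (s n x \<oplus> (-1) \<odot> f x)"
        by (intro converges_in_add converges_in_smult converges_in_const c f x sm_closed)
      then have "converges_in V (\<lambda>m. s n x \<ominus> s m x) (s n x \<ominus> f x)"
        using c f(1)[OF x] by (simp add: minus_smult)
      then have "(\<lambda>m. vnorm V (s n x \<ominus> s m x)) \<longlonglongrightarrow> vnorm V (s n x \<ominus> f x)"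
        by (rule converges_in_vnorm[rotated 2]) (use c f(1)[OF x] in auto)
      moreover have "vnorm V (s n x \<ominus> s m x) \<le> e / 2 * vnorm V x" if "m \<ge> N" for m
        using dle[OF x, of n m] mult_right_mono[OF less_imp_le vnorm_nonneg[OF x], of "vnorm B (s n \<ominus>\<^bsub>B\<^esub> s m)" "e / 2"] N n that
        by fastforce
      ultimately have "vnorm V (s n x \<ominus> f x) \<le> e / 2 * vnorm V x" by (intro LIMSEQ_le_const2) auto
      then show "vnorm V ((s n \<ominus>\<^bsub>B\<^esub> T) x) \<le> e / 2 * vnorm V x"
        using x by (simp add: op_diff sB T) (simp add: T_def)
    qed (use \<open>0 < e\<close> in simp)
    then show "\<exists>n0. \<forall>n\<ge>n0. norm (vnorm B (s n \<ominus>\<^bsub>B\<^esub> T) - 0) < e"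
      using \<open>0 < e\<close> op_vnorm_nonneg[OF B.minus_closed[OF sB T]] by (intro exI[of _ N]) fastforce
  qed
  then show "\<exists>l\<in>carrier B. converges_in B s l" using T by blast
qed

end

section \<open>Representations of quotients and completions\<close>

text \<open>
  The map \<open>\<theta>\<close> preserves a seminorm of \<open>L\<close>, so its kernel is the null space of \<open>L\<close>, and \<open>\<theta>\<close> itself
  serves as the invariant of the classes modulo the null space.
\<close>

locale isometric_rep = complex_algebra L + B: normed_complex_algebra B
  for L :: "('a, 'm) normed_algebra_scheme" and B :: "('b, 'n) normed_algebra_scheme" +
  fixes \<theta> :: "'a \<Rightarrow> 'b"
  assumes hom: "alg_map L B \<theta>"
    and iso: "x \<in> carrier L \<Longrightarrow> vnorm B (\<theta> x) = vnorm L x"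
begin

lemmas \<theta> = alg_mapD[OF hom]

lemma \<theta>_diff: "x \<in> carrier L \<Longrightarrow> y \<in> carrier L \<Longrightarrow> \<theta> (x \<ominus>\<^bsub>L\<^esub> y) = \<theta> x \<ominus>\<^bsub>B\<^esub> \<theta> y"
  by (rule module_map_diff[OF alg_map_module_map[OF hom] cmodule_axioms B.cmodule_axioms])

definition null :: "'a set" where
  "null = {x \<in> carrier L. vnorm L x = 0}"

lemma null_iff: "x \<in> null \<longleftrightarrow> x \<in> carrier L \<and> \<theta> x = \<zero>\<^bsub>B\<^esub>"
  by (auto simp: null_def iso[symmetric] B.vnorm_eq_0_iff \<theta>)

sublocale null_quotient_algebra L null \<theta>
proof
  show "null \<subseteq> carrier L" by (auto simp: null_def)
  show "x \<oplus>\<^bsub>L\<^esub> y \<in> null" if "x \<in> null" "y \<in> null" for x y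
    using that by (auto simp: null_iff \<theta>)
  show "c \<odot>\<^bsub>L\<^esub> x \<in> null" if "x \<in> null" for x c
    using that by (auto simp: null_iff \<theta> B.sm_zero_r)
  show "\<theta> x = \<theta> y \<longleftrightarrow> x \<ominus>\<^bsub>L\<^esub> y \<in> null" if "x \<in> carrier L" "y \<in> carrier L" for x y
    using that by (simp add: null_iff \<theta>_diff B.diff_eq_zero \<theta>)
  show "vnorm L x = vnorm L y" if "x \<in> carrier L" "y \<in> carrier L" "\<theta> x = \<theta> y" for x y
    using that by (simp flip: iso)
qed (simp add: \<theta>)

definition \<theta>Q :: "'a set \<Rightarrow> 'b" where
  "\<theta>Q X = \<theta> (SOME x. x \<in> X)"

lemma \<theta>Q_cls: "x \<in> carrier L \<Longrightarrow> \<theta>Q (cls x) = \<theta> x"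
proof -
  assume x: "x \<in> carrier L"
  have "(SOME y. y \<in> cls x) \<in> cls x" using cls_self[OF x] by (rule someI)
  then show ?thesis unfolding \<theta>Q_def using x by (simp add: cls_eq)
qed

lemma \<theta>Q_alg_map: "alg_map Q B \<theta>Q"
  unfolding alg_map_def module_map_def
  by (auto simp: carrier_Q add_Q smult_Q mult_Q zero_Q \<theta>Q_cls \<theta> mult_closed)

lemma \<theta>Q_iso: "X \<in> carrier Q \<Longrightarrow> vnorm B (\<theta>Q X) = vnorm Q X"
  by (auto simp: carrier_Q \<theta>Q_cls vnorm_Q iso)

lemma \<theta>Q_inj: "inj_on \<theta>Q (carrier Q)"
  by (auto simp: inj_on_def carrier_Q \<theta>Q_cls cls_eq_iff)

lemma \<theta>Q_image: "\<theta>Q ` carrier Q = \<theta> ` carrier L"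
  by (auto simp: carrier_Q \<theta>Q_cls image_image cong: image_cong)

end

text \<open>
  Now \<open>K\<close> has no null elements and its completion is represented. A sequence in \<open>K\<close> is a Cauchy
  sequence iff its image converges in the complete algebra \<open>B\<close>; thus the algebra of Cauchy sequences
  is again isometrically represented in \<open>B\<close>, by the limit, and the completion is its quotient by the
  null space.
\<close>

locale injective_rep = complex_algebra K + B: complex_banach_algebra B
  for K :: "('a, 'm) normed_algebra_scheme" and B :: "('b, 'n) normed_algebra_scheme" +
  fixes \<theta> :: "'a \<Rightarrow> 'b"
  assumes hom: "alg_map K B \<theta>"
    and iso: "x \<in> carrier K \<Longrightarrow> vnorm B (\<theta> x) = vnorm K x"
    and inj: "inj_on \<theta> (carrier K)"
begin

interpretation BN: normed_complex_algebra B by (rule complex_banach_algebraD) (rule B.complex_banach_algebra_axioms)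

lemmas \<theta> = alg_mapD[OF hom]

lemma \<theta>_diff: "x \<in> carrier K \<Longrightarrow> y \<in> carrier K \<Longrightarrow> \<theta> (x \<ominus>\<^bsub>K\<^esub> y) = \<theta> x \<ominus>\<^bsub>B\<^esub> \<theta> y"
  by (rule module_map_diff[OF alg_map_module_map[OF hom] cmodule_axioms BN.cmodule_axioms])

lemma normed_K: "normed_complex_algebra K"
proof unfold_locales
  show "vnorm K x = 0 \<longleftrightarrow> x = \<zero>\<^bsub>K\<^esub>" if "x \<in> carrier K" for x
  proof -
    have "vnorm K x = 0 \<longleftrightarrow> \<theta> x = \<theta> \<zero>\<^bsub>K\<^esub>"
      using that by (simp flip: iso add: BN.vnorm_eq_0_iff \<theta>)
    also have "\<dots> \<longleftrightarrow> x = \<zero>\<^bsub>K\<^esub>" by (rule inj_on_eq_iff[OF inj that zero_closed])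
    finally show ?thesis .
  qed
  show "vnorm K (x \<oplus>\<^bsub>K\<^esub> y) \<le> vnorm K x + vnorm K y" if "x \<in> carrier K" "y \<in> carrier K" for x y
    using that by (simp flip: iso add: \<theta> BN.vnorm_triangle)
  show "vnorm K (c \<odot>\<^bsub>K\<^esub> x) = cmod c * vnorm K x" if "x \<in> carrier K" for x c
    using that by (simp flip: iso add: \<theta> BN.vnorm_smult)
  show "vnorm K (x \<otimes>\<^bsub>K\<^esub> y) \<le> vnorm K x * vnorm K y" if "x \<in> carrier K" "y \<in> carrier K" for x y
    using that by (simp flip: iso add: \<theta> BN.vnorm_mult mult_closed)
  show "0 \<le> vnorm K x" if "x \<in> carrier K" for x
    using that by (simp flip: iso add: \<theta> BN.vnorm_nonneg)
qed

lemma Cauchy_iff_\<theta>: "Cauchy_in K s \<longleftrightarrow> (\<forall>n. s n \<in> carrier K) \<and> Cauchy_in B (\<lambda>n. \<theta> (s n))"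
proof (cases "\<forall>n. s n \<in> carrier K")
  case True
  then have "vnorm B (\<theta> (s m) \<ominus>\<^bsub>B\<^esub> \<theta> (s n)) = vnorm K (s m \<ominus>\<^bsub>K\<^esub> s n)" for m n
    by (simp flip: iso add: \<theta>_diff)
  then show ?thesis using True by (simp add: Cauchy_in_def \<theta>)
qed (auto simp: Cauchy_in_def)

lemma Cauchy_iff: "Cauchy_in K s \<longleftrightarrow> (\<forall>n. s n \<in> carrier K) \<and> (\<exists>l\<in>carrier B. converges_in B (\<lambda>n. \<theta> (s n)) l)"
  using B.complete[of "\<lambda>n. \<theta> (s n)"] BN.converges_in_Cauchy[of "\<lambda>n. \<theta> (s n)"]
  unfolding Cauchy_iff_\<theta> by (auto simp: \<theta>)

abbreviation S :: "(nat \<Rightarrow> 'a) normed_algebra" where "S \<equiv> Cauchy_sequence_algebra K"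

definition \<theta>S :: "(nat \<Rightarrow> 'a) \<Rightarrow> 'b" where
  "\<theta>S s = (SOME l. l \<in> carrier B \<and> converges_in B (\<lambda>n. \<theta> (s n)) l)"

lemma S_iff: "s \<in> carrier S \<longleftrightarrow> Cauchy_in K s"
  by (simp add: Cauchy_sequence_algebra_def)

lemma S_in: "s \<in> carrier S \<Longrightarrow> s n \<in> carrier K"
  by (simp add: S_iff Cauchy_in_def)

lemma \<theta>S:
  assumes "s \<in> carrier S"
  shows "\<theta>S s \<in> carrier B" "converges_in B (\<lambda>n. \<theta> (s n)) (\<theta>S s)"
proof -
  have "\<exists>l. l \<in> carrier B \<and> converges_in B (\<lambda>n. \<theta> (s n)) l" using assms by (auto simp: S_iff Cauchy_iff)
  from someI_ex[OF this] show "\<theta>S s \<in> carrier B" "converges_in B (\<lambda>n. \<theta> (s n)) (\<theta>S s)"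
    by (auto simp: \<theta>S_def)
qed

lemma SI:
  assumes "\<And>n. s n \<in> carrier K" "l \<in> carrier B" "converges_in B (\<lambda>n. \<theta> (s n)) l"
  shows "s \<in> carrier S" "\<theta>S s = l"
proof -
  show s: "s \<in> carrier S" using assms by (auto simp: S_iff Cauchy_iff)
  show "\<theta>S s = l"
    by (rule BN.converges_in_unique[OF _ \<theta>S(1)[OF s] assms(2) \<theta>S(2)[OF s] assms(3)]) (simp add: \<theta> assms)
qed

lemma S_ops: "s \<otimes>\<^bsub>S\<^esub> t = (\<lambda>n. s n \<otimes>\<^bsub>K\<^esub> t n)" "s \<oplus>\<^bsub>S\<^esub> t = (\<lambda>n. s n \<oplus>\<^bsub>K\<^esub> t n)"
  "c \<odot>\<^bsub>S\<^esub> s = (\<lambda>n. c \<odot>\<^bsub>K\<^esub> s n)" "\<zero>\<^bsub>S\<^esub> = (\<lambda>n. \<zero>\<^bsub>K\<^esub>)" "vnorm S s = lim (\<lambda>n. vnorm K (s n))"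
  by (simp_all add: Cauchy_sequence_algebra_def)

lemma S_add:
  assumes "s \<in> carrier S" "t \<in> carrier S"
  shows "s \<oplus>\<^bsub>S\<^esub> t \<in> carrier S" "\<theta>S (s \<oplus>\<^bsub>S\<^esub> t) = \<theta>S s \<oplus>\<^bsub>B\<^esub> \<theta>S t"
proof -
  have "converges_in B (\<lambda>n. \<theta> (s n) \<oplus>\<^bsub>B\<^esub> \<theta> (t n)) (\<theta>S s \<oplus>\<^bsub>B\<^esub> \<theta>S t)"
    using assms by (intro BN.converges_in_add \<theta>S \<theta> S_in)
  then have "converges_in B (\<lambda>n. \<theta> ((s \<oplus>\<^bsub>S\<^esub> t) n)) (\<theta>S s \<oplus>\<^bsub>B\<^esub> \<theta>S t)"
    using assms by (simp add: S_ops \<theta> S_in)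
  note * = SI[OF _ _ this]
  show "s \<oplus>\<^bsub>S\<^esub> t \<in> carrier S" "\<theta>S (s \<oplus>\<^bsub>S\<^esub> t) = \<theta>S s \<oplus>\<^bsub>B\<^esub> \<theta>S t"
    by (rule *; use assms in \<open>simp add: S_ops \<theta>S S_in\<close>)+
qed

lemma S_smult:
  assumes "s \<in> carrier S"
  shows "c \<odot>\<^bsub>S\<^esub> s \<in> carrier S" "\<theta>S (c \<odot>\<^bsub>S\<^esub> s) = c \<odot>\<^bsub>B\<^esub> \<theta>S s"
proof -
  have "converges_in B (\<lambda>n. c \<odot>\<^bsub>B\<^esub> \<theta> (s n)) (c \<odot>\<^bsub>B\<^esub> \<theta>S s)"
    using assms by (intro BN.converges_in_smult \<theta>S \<theta> S_in)
  then have "converges_in B (\<lambda>n. \<theta> ((c \<odot>\<^bsub>S\<^esub> s) n)) (c \<odot>\<^bsub>B\<^esub> \<theta>S s)"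
    using assms by (simp add: S_ops \<theta> S_in)
  note * = SI[OF _ _ this]
  show "c \<odot>\<^bsub>S\<^esub> s \<in> carrier S" "\<theta>S (c \<odot>\<^bsub>S\<^esub> s) = c \<odot>\<^bsub>B\<^esub> \<theta>S s"
    by (rule *; use assms in \<open>simp add: S_ops \<theta>S S_in\<close>)+
qed

lemma S_mult:
  assumes "s \<in> carrier S" "t \<in> carrier S"
  shows "s \<otimes>\<^bsub>S\<^esub> t \<in> carrier S" "\<theta>S (s \<otimes>\<^bsub>S\<^esub> t) = \<theta>S s \<otimes>\<^bsub>B\<^esub> \<theta>S t"
proof -
  have "converges_in B (\<lambda>n. \<theta> (s n) \<otimes>\<^bsub>B\<^esub> \<theta> (t n)) (\<theta>S s \<otimes>\<^bsub>B\<^esub> \<theta>S t)"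
    using assms by (intro BN.converges_in_mult \<theta>S \<theta> S_in)
  then have "converges_in B (\<lambda>n. \<theta> ((s \<otimes>\<^bsub>S\<^esub> t) n)) (\<theta>S s \<otimes>\<^bsub>B\<^esub> \<theta>S t)"
    using assms by (simp add: S_ops \<theta> S_in)
  note * = SI[OF _ _ this]
  show "s \<otimes>\<^bsub>S\<^esub> t \<in> carrier S" "\<theta>S (s \<otimes>\<^bsub>S\<^esub> t) = \<theta>S s \<otimes>\<^bsub>B\<^esub> \<theta>S t"
    by (rule *; use assms in \<open>simp add: S_ops \<theta>S S_in mult_closed BN.mult_closed\<close>)+
qed

lemma S_zero: "\<zero>\<^bsub>S\<^esub> \<in> carrier S" "\<theta>S \<zero>\<^bsub>S\<^esub> = \<zero>\<^bsub>B\<^esub>"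
proof -
  have "converges_in B (\<lambda>n. \<theta> (\<zero>\<^bsub>S\<^esub> n)) \<zero>\<^bsub>B\<^esub>"
    by (simp add: S_ops \<theta> BN.converges_in_const)
  note * = SI[OF _ _ this]
  show "\<zero>\<^bsub>S\<^esub> \<in> carrier S" "\<theta>S \<zero>\<^bsub>S\<^esub> = \<zero>\<^bsub>B\<^esub>" by (rule *; simp add: S_ops)+
qed

lemma complex_algebra_S: "complex_algebra S"
proof -
  interpret S: cmodule S
  proof (rule cmoduleI_direct)
    show "s \<oplus>\<^bsub>S\<^esub> t \<oplus>\<^bsub>S\<^esub> u = s \<oplus>\<^bsub>S\<^esub> (t \<oplus>\<^bsub>S\<^esub> u)" if "s \<in> carrier S" "t \<in> carrier S" "u \<in> carrier S" for s t u
      using that by (simp add: S_ops S_in a_assoc)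
    show "s \<oplus>\<^bsub>S\<^esub> t = t \<oplus>\<^bsub>S\<^esub> s" "c \<odot>\<^bsub>S\<^esub> (s \<oplus>\<^bsub>S\<^esub> t) = c \<odot>\<^bsub>S\<^esub> s \<oplus>\<^bsub>S\<^esub> c \<odot>\<^bsub>S\<^esub> t"
      if "s \<in> carrier S" "t \<in> carrier S" for s t c
      using that by (simp_all add: S_ops S_in a_comm sm_r_distr)
    show "\<zero>\<^bsub>S\<^esub> \<oplus>\<^bsub>S\<^esub> s = s" "(a + b) \<odot>\<^bsub>S\<^esub> s = a \<odot>\<^bsub>S\<^esub> s \<oplus>\<^bsub>S\<^esub> b \<odot>\<^bsub>S\<^esub> s" "(a * b) \<odot>\<^bsub>S\<^esub> s = a \<odot>\<^bsub>S\<^esub> (b \<odot>\<^bsub>S\<^esub> s)"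
      "1 \<odot>\<^bsub>S\<^esub> s = s" "0 \<odot>\<^bsub>S\<^esub> s = \<zero>\<^bsub>S\<^esub>" if "s \<in> carrier S" for s a b
      using that by (simp_all add: S_ops S_in sm_l_distr sm_assoc sm_one sm_zero)
  qed (auto intro: S_add S_smult S_zero)
  show ?thesis
  proof
    show "s \<otimes>\<^bsub>S\<^esub> t \<otimes>\<^bsub>S\<^esub> u = s \<otimes>\<^bsub>S\<^esub> (t \<otimes>\<^bsub>S\<^esub> u)" "(s \<oplus>\<^bsub>S\<^esub> t) \<otimes>\<^bsub>S\<^esub> u = s \<otimes>\<^bsub>S\<^esub> u \<oplus>\<^bsub>S\<^esub> t \<otimes>\<^bsub>S\<^esub> u"
      "u \<otimes>\<^bsub>S\<^esub> (s \<oplus>\<^bsub>S\<^esub> t) = u \<otimes>\<^bsub>S\<^esub> s \<oplus>\<^bsub>S\<^esub> u \<otimes>\<^bsub>S\<^esub> t"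
      if "s \<in> carrier S" "t \<in> carrier S" "u \<in> carrier S" for s t u
      using that by (simp_all add: S_ops S_in mult_assoc mult_l_distr mult_r_distr)
    show "(c \<odot>\<^bsub>S\<^esub> s) \<otimes>\<^bsub>S\<^esub> t = c \<odot>\<^bsub>S\<^esub> (s \<otimes>\<^bsub>S\<^esub> t)" "s \<otimes>\<^bsub>S\<^esub> (c \<odot>\<^bsub>S\<^esub> t) = c \<odot>\<^bsub>S\<^esub> (s \<otimes>\<^bsub>S\<^esub> t)"
      if "s \<in> carrier S" "t \<in> carrier S" for s t c
      using that by (simp_all add: S_ops S_in smult_mult_l smult_mult_r)
  qed (rule S_mult)
qed

lemma isometric_rep_S: "isometric_rep S B \<theta>S"
proof -
  interpret S: complex_algebra S by (rule complex_algebra_S)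
  show ?thesis
  proof
    show "alg_map S B \<theta>S"
      by (auto simp: alg_map_def module_map_def S_add S_smult S_mult S_zero \<theta>S)
    show "vnorm B (\<theta>S s) = vnorm S s" if s: "s \<in> carrier S" for s
    proof -
      have "(\<lambda>n. vnorm B (\<theta> (s n))) \<longlonglongrightarrow> vnorm B (\<theta>S s)"
        using s by (intro BN.converges_in_vnorm \<theta>S \<theta> S_in)
      then have "(\<lambda>n. vnorm K (s n)) \<longlonglongrightarrow> vnorm B (\<theta>S s)" using s by (simp add: iso S_in)
      then show ?thesis by (simp add: S_ops limI)
    qed
  qed
qed

lemma null_S: "{s. Cauchy_in K s \<and> converges_in K s \<zero>\<^bsub>K\<^esub>} = isometric_rep.null S"
proof -
  interpret S: isometric_rep S B \<theta>S by (rule isometric_rep_S)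
  have "converges_in K s \<zero>\<^bsub>K\<^esub> \<longleftrightarrow> \<theta>S s = \<zero>\<^bsub>B\<^esub>" if s: "s \<in> carrier S" for s
  proof -
    have "vnorm B (\<theta> (s n) \<ominus>\<^bsub>B\<^esub> \<zero>\<^bsub>B\<^esub>) = vnorm K (s n \<ominus>\<^bsub>K\<^esub> \<zero>\<^bsub>K\<^esub>)" for n
      using S_in[OF s] \<theta>_diff[of "s n" "\<zero>\<^bsub>K\<^esub>"] by (simp flip: iso add: \<theta>)
    then have "converges_in K s \<zero>\<^bsub>K\<^esub> \<longleftrightarrow> converges_in B (\<lambda>n. \<theta> (s n)) \<zero>\<^bsub>B\<^esub>"
      by (simp add: converges_in_def)
    also have "\<dots> \<longleftrightarrow> \<theta>S s = \<zero>\<^bsub>B\<^esub>"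
      using SI(2)[OF S_in[OF s] B.zero_closed] \<theta>S(2)[OF s] by auto
    finally show ?thesis .
  qed
  then show ?thesis by (auto simp: S.null_iff S_iff)
qed

text \<open>
  If \<open>l\<close> is the limit of limits \<open>s n\<close> of Cauchy sequences, pick from the \<open>n\<close>-th sequence a term
  whose image is closer than \<open>1 / (n + 1)\<close> to \<open>s n\<close>. These terms form a Cauchy sequence with limit
  \<open>l\<close>.
\<close>

lemma image_S_closed:
  assumes s: "\<And>n. s n \<in> \<theta>S ` carrier S" and l: "l \<in> carrier B" "converges_in B s l"
  shows "l \<in> \<theta>S ` carrier S"
proof -
  have sB: "s n \<in> carrier B" for n using s[of n] \<theta>S by auto
  have "\<exists>x\<in>carrier K. vnorm B (\<theta> x \<ominus>\<^bsub>B\<^esub> s n) < 1 / real (Suc n)" for n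
  proof -
    obtain t where t: "t \<in> carrier S" "s n = \<theta>S t" using s by blast
    have "eventually (\<lambda>k. vnorm B (\<theta> (t k) \<ominus>\<^bsub>B\<^esub> s n) < 1 / real (Suc n)) sequentially"
      using order_tendstoD(2)[OF \<theta>S(2)[OF t(1), unfolded converges_in_def], of "1 / real (Suc n)"] t(2) by simp
    then show ?thesis using S_in[OF t(1)] by (auto simp: eventually_sequentially)
  qed
  then obtain x where x: "\<And>n. x n \<in> carrier K" "\<And>n. vnorm B (\<theta> (x n) \<ominus>\<^bsub>B\<^esub> s n) < 1 / real (Suc n)" by metis
  have "converges_in B (\<lambda>n. \<theta> (x n)) l"
    unfolding converges_in_def
  proof (rule tendsto_sandwich[OF _ _ tendsto_const])
    show "(\<lambda>n. 1 / real (Suc n) + vnorm B (s n \<ominus>\<^bsub>B\<^esub> l)) \<longlonglongrightarrow> 0"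
      using tendsto_add[OF LIMSEQ_Suc[OF lim_1_over_n] l(2)[unfolded converges_in_def]] by simp
    have "vnorm B (\<theta> (x n) \<ominus>\<^bsub>B\<^esub> l) \<le> 1 / real (Suc n) + vnorm B (s n \<ominus>\<^bsub>B\<^esub> l)" for n
      using BN.vnorm_diff_trans[OF \<theta>(1)[OF x(1)] sB l(1), of n n] x(2)[of n] by linarith
    then show "eventually (\<lambda>n. vnorm B (\<theta> (x n) \<ominus>\<^bsub>B\<^esub> l) \<le> 1 / real (Suc n) + vnorm B (s n \<ominus>\<^bsub>B\<^esub> l)) sequentially"
      by simp
  qed (use x l \<theta> in \<open>auto simp: BN.vnorm_nonneg\<close>)
  from SI[OF x(1) l(1) this] show ?thesis by blast
qed

text \<open>
  Once the image of \<open>\<theta>\<close> is closed in \<open>B\<close>, completeness of \<open>K\<close> is inherited from \<open>B\<close>.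
\<close>

lemma closed_image_representation:
  assumes closed: "\<And>s l. (\<And>n. s n \<in> \<theta> ` carrier K) \<Longrightarrow> l \<in> carrier B \<Longrightarrow> converges_in B s l \<Longrightarrow> l \<in> \<theta> ` carrier K"
  shows "complex_banach_algebra K" "closed_subalgebra (\<theta> ` carrier K) B"
    "isometrically_isomorphic K (B\<lparr>carrier := \<theta> ` carrier K\<rparr>)"
proof -
  show "complex_banach_algebra K"
  proof (rule complex_banach_algebraI[OF normed_K])
    fix s assume "Cauchy_in K s"
    then obtain l where s: "\<And>n. s n \<in> carrier K" and l: "l \<in> carrier B" "converges_in B (\<lambda>n. \<theta> (s n)) l"
      by (auto simp: Cauchy_iff)
    then obtain x where x: "x \<in> carrier K" "l = \<theta> x" using closed[of "\<lambda>n. \<theta> (s n)" l] by auto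
    have "vnorm B (\<theta> (s n) \<ominus>\<^bsub>B\<^esub> \<theta> x) = vnorm K (s n \<ominus>\<^bsub>K\<^esub> x)" for n
      using s x by (simp flip: iso add: \<theta>_diff)
    then show "\<exists>l\<in>carrier K. converges_in K s l" using l(2) x by (auto simp: converges_in_def)
  qed
  have neg: "\<theta> (\<ominus>\<^bsub>K\<^esub> x) = \<ominus>\<^bsub>B\<^esub> \<theta> x" if "x \<in> carrier K" for x
    using that by (simp add: \<theta> flip: sm_minus_one BN.sm_minus_one)
  show "closed_subalgebra (\<theta> ` carrier K) B"
    unfolding closed_subalgebra_def
  proof (intro conjI ballI allI impI)
    show "submodule (\<theta> ` carrier K) complex_ring B"
    proof (rule B.submoduleI)
      show "\<theta> ` carrier K \<subseteq> carrier B" using \<theta> by auto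
      show "\<zero>\<^bsub>B\<^esub> \<in> \<theta> ` carrier K" using \<theta>(4) zero_closed by (metis imageI)
      show "\<ominus>\<^bsub>B\<^esub> a \<in> \<theta> ` carrier K" if "a \<in> \<theta> ` carrier K" for a
      proof -
        obtain x where "x \<in> carrier K" "a = \<theta> x" using \<open>a \<in> _\<close> by blast
        then show ?thesis by (intro image_eqI[of _ _ "\<ominus>\<^bsub>K\<^esub> x"]) (auto simp: neg)
      qed
      show "a \<oplus>\<^bsub>B\<^esub> b \<in> \<theta> ` carrier K" if "a \<in> \<theta> ` carrier K" "b \<in> \<theta> ` carrier K" for a b
      proof -
        obtain x y where "x \<in> carrier K" "y \<in> carrier K" "a = \<theta> x" "b = \<theta> y" using \<open>a \<in> _\<close> \<open>b \<in> _\<close> by blast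
        then show ?thesis by (intro image_eqI[of _ _ "x \<oplus>\<^bsub>K\<^esub> y"]) (auto simp: \<theta>)
      qed
      show "a \<odot>\<^bsub>B\<^esub> b \<in> \<theta> ` carrier K" if "a \<in> carrier complex_ring" "b \<in> \<theta> ` carrier K" for a b
      proof -
        obtain x where "x \<in> carrier K" "b = \<theta> x" using \<open>b \<in> _\<close> by blast
        then show ?thesis by (intro image_eqI[of _ _ "a \<odot>\<^bsub>K\<^esub> x"]) (auto simp: \<theta>)
      qed
    qed
    show "x \<otimes>\<^bsub>B\<^esub> y \<in> \<theta> ` carrier K" if "x \<in> \<theta> ` carrier K" "y \<in> \<theta> ` carrier K" for x y
    proof -
      from that(1) obtain a where a: "x = \<theta> a" "a \<in> carrier K" by (rule imageE)
      from that(2) obtain b where b: "y = \<theta> b" "b \<in> carrier K" by (rule imageE)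
      from a b
      show ?thesis by (intro image_eqI[of _ _ "a \<otimes>\<^bsub>K\<^esub> b"]) (auto simp: \<theta> mult_closed)
    qed
  qed (use closed in blast)
  have "\<theta> \<in> algebra_hom K (B\<lparr>carrier := \<theta> ` carrier K\<rparr>)"
    by (auto simp: algebra_hom_def hom_def \<theta>)
  then show "isometrically_isomorphic K (B\<lparr>carrier := \<theta> ` carrier K\<rparr>)"
    unfolding isometrically_isomorphic_def using inj iso by (auto simp: bij_betw_def intro!: bexI[of _ \<theta>])
qed

lemma completion_representation:
  "complex_banach_algebra (completion K) \<and>
   (\<exists>X. closed_subalgebra X B \<and> isometrically_isomorphic (completion K) (B\<lparr>carrier := X\<rparr>))"
proof -
  interpret S: isometric_rep S B \<theta>S by (rule isometric_rep_S)
  have eq: "completion K = S.Q" by (simp add: completion_def null_S)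
  interpret D: complex_algebra S.Q by (rule S.complex_algebra_Q)
  interpret D: injective_rep S.Q B S.\<theta>Q
    by unfold_locales (auto simp: S.\<theta>Q_iso intro: S.\<theta>Q_alg_map S.\<theta>Q_inj)
  have cl: "\<And>s l. (\<And>n. s n \<in> S.\<theta>Q ` carrier S.Q) \<Longrightarrow> l \<in> carrier B \<Longrightarrow> converges_in B s l \<Longrightarrow>
      l \<in> S.\<theta>Q ` carrier S.Q"
    unfolding S.\<theta>Q_image by (rule image_S_closed)
  show ?thesis
    unfolding eq
    by (intro conjI exI[of _ "S.\<theta>Q ` carrier S.Q"] D.closed_image_representation) (erule cl; assumption)+
qed

end

text \<open>
  This reduces the theorem to the construction of a homomorphism on the algebraic direct limit that
  transports its seminorm.
\<close>

theorem completed_quotient_representation: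
  assumes L: "complex_algebra L" and B: "complex_banach_algebra B"
    and \<theta>: "alg_map L B \<theta>" "\<And>x. x \<in> carrier L \<Longrightarrow> vnorm B (\<theta> x) = vnorm L x"
  defines "D \<equiv> completion (seminormed_quotient L {x \<in> carrier L. vnorm L x = 0})"
  shows "complex_banach_algebra D \<and> (\<exists>X. closed_subalgebra X B \<and> isometrically_isomorphic D (B\<lparr>carrier := X\<rparr>))"
proof -
  interpret L: complex_algebra L by fact
  interpret BB: complex_banach_algebra B by fact
  interpret B: normed_complex_algebra B by (rule complex_banach_algebraD[OF B])
  interpret L: isometric_rep L B \<theta>
    by unfold_locales (use \<theta> in auto)
  have eq: "D = completion L.Q" by (simp add: D_def L.null_def)
  interpret K: complex_algebra L.Q by (rule L.complex_algebra_Q)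
  interpret K: injective_rep L.Q B L.\<theta>Q
    by unfold_locales (auto simp: L.\<theta>Q_iso intro: L.\<theta>Q_alg_map L.\<theta>Q_inj)
  show ?thesis unfolding eq by (rule K.completion_representation)
qed

section \<open>The algebraic direct limit\<close>

lemma tendsto_imp_Lim_eq:
  assumes "eventually (\<lambda>x. f x = g x) F"
  shows "Lim F f = Lim F g"
  unfolding t2_space_class.Lim_def using tendsto_cong[OF assms] by simp

locale direct_system =
  fixes I :: "'i set" and r :: "'i rel" and A :: "'i \<Rightarrow> 'a normed_algebra" and \<phi> :: "'i \<Rightarrow> 'i \<Rightarrow> 'a \<Rightarrow> 'a"
  assumes system: "contractive_direct_system I r A \<phi>"
begin

lemma r_in: "(i, j) \<in> r \<Longrightarrow> i \<in> I \<and> j \<in> I"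
  using system by (auto simp: contractive_direct_system_def directed_set_def preorder_on_def)

lemma r_refl: "i \<in> I \<Longrightarrow> (i, i) \<in> r"
  using system by (auto simp: contractive_direct_system_def directed_set_def preorder_on_def refl_on_def)

lemma r_trans: "(i, j) \<in> r \<Longrightarrow> (j, k) \<in> r \<Longrightarrow> (i, k) \<in> r"
  using system by (auto simp: contractive_direct_system_def directed_set_def preorder_on_def dest: transD)

lemma directed: "i \<in> I \<Longrightarrow> j \<in> I \<Longrightarrow> \<exists>k. (i, k) \<in> r \<and> (j, k) \<in> r"
  using system unfolding contractive_direct_system_def directed_set_def by blast

lemma I_ne: "I \<noteq> {}"
  using system by (auto simp: contractive_direct_system_def directed_set_def)

lemma banach_A: "i \<in> I \<Longrightarrow> complex_banach_algebra (A i)"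
  using system by (auto simp: contractive_direct_system_def)

lemma normed_A: "i \<in> I \<Longrightarrow> normed_complex_algebra (A i)"
  using banach_A by (rule complex_banach_algebraD)

lemma \<phi>_id: "i \<in> I \<Longrightarrow> a \<in> carrier (A i) \<Longrightarrow> \<phi> i i a = a"
  using system by (auto simp: contractive_direct_system_def)

lemma \<phi>_comp: "(i, j) \<in> r \<Longrightarrow> (j, k) \<in> r \<Longrightarrow> a \<in> carrier (A i) \<Longrightarrow> \<phi> k j (\<phi> j i a) = \<phi> k i a"
  using system by (auto simp: contractive_direct_system_def)

lemma \<phi>_hom:
  assumes "(i, j) \<in> r"
  shows "alg_map (A i) (A j) (\<phi> j i)" "a \<in> carrier (A i) \<Longrightarrow> vnorm (A j) (\<phi> j i a) \<le> vnorm (A i) a"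
proof -
  have h: "\<phi> j i \<in> contractive_hom (A i) (A j)"
    using system assms by (auto simp: contractive_direct_system_def)
  then show "a \<in> carrier (A i) \<Longrightarrow> vnorm (A j) (\<phi> j i a) \<le> vnorm (A i) a"
    by (auto simp: contractive_hom_def)
  interpret i: normed_complex_algebra "A i" using normed_A r_in[OF assms] by blast
  interpret j: normed_complex_algebra "A j" using normed_A r_in[OF assms] by blast
  have h': "\<phi> j i a \<in> carrier (A j)" "\<phi> j i (c \<odot>\<^bsub>A i\<^esub> a) = c \<odot>\<^bsub>A j\<^esub> \<phi> j i a" if "a \<in> carrier (A i)" for a c
    using h that by (auto simp: contractive_hom_def algebra_hom_def hom_def)
  have "\<phi> j i \<zero>\<^bsub>A i\<^esub> = \<phi> j i (0 \<odot>\<^bsub>A i\<^esub> \<zero>\<^bsub>A i\<^esub>)" by (simp add: i.sm_zero_r)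
  also have "\<dots> = 0 \<odot>\<^bsub>A j\<^esub> \<phi> j i \<zero>\<^bsub>A i\<^esub>" by (rule h'(2)[OF i.zero_closed])
  also have "\<dots> = \<zero>\<^bsub>A j\<^esub>" by (rule j.sm_zero[OF h'(1)[OF i.zero_closed]])
  finally show "alg_map (A i) (A j) (\<phi> j i)"
    using h h' by (auto simp: alg_map_def module_map_def contractive_hom_def algebra_hom_def hom_def)
qed

lemmas \<phi>_in = alg_mapD(1)[OF \<phi>_hom(1)]
  and \<phi>_add = alg_mapD(2)[OF \<phi>_hom(1)]
  and \<phi>_smult = alg_mapD(3)[OF \<phi>_hom(1)]
  and \<phi>_zero = alg_mapD(4)[OF \<phi>_hom(1)]
  and \<phi>_mult = alg_mapD(5)[OF \<phi>_hom(1)]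

abbreviation R :: "('i \<times> 'a) rel" where "R \<equiv> direct_limit_rel I r A \<phi>"
abbreviation L :: "('i \<times> 'a) set normed_algebra" where "L \<equiv> algebraic_direct_limit I r A \<phi>"

text \<open>
  The canonical map of \<open>A k\<close> into the algebraic direct limit.
\<close>

definition \<iota> :: "'i \<Rightarrow> 'a \<Rightarrow> ('i \<times> 'a) set" where
  "\<iota> k a = R `` {(k, a)}"

lemma mem_\<iota>: "k \<in> I \<Longrightarrow> a \<in> carrier (A k) \<Longrightarrow> (i, b) \<in> \<iota> k a \<longleftrightarrow>
   i \<in> I \<and> b \<in> carrier (A i) \<and> (\<exists>l. (k, l) \<in> r \<and> (i, l) \<in> r \<and> \<phi> l k a = \<phi> l i b)"
  by (auto simp: \<iota>_def direct_limit_rel_def)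

lemma \<iota>_self: "k \<in> I \<Longrightarrow> a \<in> carrier (A k) \<Longrightarrow> (k, a) \<in> \<iota> k a"
  using r_refl by (auto simp: mem_\<iota>)

lemma agree_later:
  assumes "(k, l) \<in> r" "(i, l) \<in> r" "\<phi> l k a = \<phi> l i b" "(l, m) \<in> r" "a \<in> carrier (A k)" "b \<in> carrier (A i)"
  shows "\<phi> m k a = \<phi> m i b"
  using \<phi>_comp[OF assms(1,4,5)] \<phi>_comp[OF assms(2,4,6)] assms(3) by simp

lemma \<iota>_eqI:
  assumes b: "(i, b) \<in> \<iota> k a" and k: "k \<in> I" "a \<in> carrier (A k)"
  shows "\<iota> i b = \<iota> k a"
proof -
  obtain l where i: "i \<in> I" "b \<in> carrier (A i)" and l: "(k, l) \<in> r" "(i, l) \<in> r" "\<phi> l k a = \<phi> l i b"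
    using b k by (auto simp: mem_\<iota>)
  have "(\<exists>n. (i, n) \<in> r \<and> (j, n) \<in> r \<and> \<phi> n i b = \<phi> n j c) \<longleftrightarrow> (\<exists>n. (k, n) \<in> r \<and> (j, n) \<in> r \<and> \<phi> n k a = \<phi> n j c)"
    if j: "j \<in> I" "c \<in> carrier (A j)" for j c
  proof
    assume "\<exists>n. (i, n) \<in> r \<and> (j, n) \<in> r \<and> \<phi> n i b = \<phi> n j c"
    then obtain n where n: "(i, n) \<in> r" "(j, n) \<in> r" "\<phi> n i b = \<phi> n j c" by blast
    obtain q where q: "(l, q) \<in> r" "(n, q) \<in> r" using directed r_in l(1) n(1) by blast
    have "\<phi> q k a = \<phi> q j c" using agree_later[OF l q(1) k(2) i(2)] agree_later[OF n q(2) i(2) j(2)] by simp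
    then show "\<exists>n. (k, n) \<in> r \<and> (j, n) \<in> r \<and> \<phi> n k a = \<phi> n j c" using l n q r_trans by blast
  next
    assume "\<exists>n. (k, n) \<in> r \<and> (j, n) \<in> r \<and> \<phi> n k a = \<phi> n j c"
    then obtain n where n: "(k, n) \<in> r" "(j, n) \<in> r" "\<phi> n k a = \<phi> n j c" by blast
    obtain q where q: "(l, q) \<in> r" "(n, q) \<in> r" using directed r_in l(1) n(1) by blast
    have "\<phi> q i b = \<phi> q j c" using agree_later[OF l q(1) k(2) i(2)] agree_later[OF n q(2) k(2) j(2)] by simp
    then show "\<exists>n. (i, n) \<in> r \<and> (j, n) \<in> r \<and> \<phi> n i b = \<phi> n j c" using l n q r_trans by blast
  qed
  then show ?thesis by (auto simp: set_eq_iff mem_\<iota> k i)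
qed

lemma \<iota>_shift: "(k, l) \<in> r \<Longrightarrow> a \<in> carrier (A k) \<Longrightarrow> \<iota> l (\<phi> l k a) = \<iota> k a"
  using r_in[of k l] r_refl \<phi>_in[of k l a] by (intro \<iota>_eqI) (auto simp: mem_\<iota> \<phi>_id intro!: exI[of _ l])

lemma carrier_L: "carrier L = {\<iota> k a | k a. k \<in> I \<and> a \<in> carrier (A k)}"
  by (auto simp: algebraic_direct_limit_def Let_def quotient_def \<iota>_def)

lemma \<iota>_in: "k \<in> I \<Longrightarrow> a \<in> carrier (A k) \<Longrightarrow> \<iota> k a \<in> carrier L"
  by (auto simp: carrier_L)

lemma common_index:
  assumes "X \<in> carrier L" "Y \<in> carrier L" "Z \<in> carrier L"
  obtains k a b c where "k \<in> I" "a \<in> carrier (A k)" "b \<in> carrier (A k)" "c \<in> carrier (A k)"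
    "X = \<iota> k a" "Y = \<iota> k b" "Z = \<iota> k c"
proof -
  obtain k1 a1 k2 a2 k3 a3 where *: "k1 \<in> I" "a1 \<in> carrier (A k1)" "X = \<iota> k1 a1"
    "k2 \<in> I" "a2 \<in> carrier (A k2)" "Y = \<iota> k2 a2" "k3 \<in> I" "a3 \<in> carrier (A k3)" "Z = \<iota> k3 a3"
    using assms by (auto simp: carrier_L)
  obtain l where l: "(k1, l) \<in> r" "(k2, l) \<in> r" using directed * by blast
  obtain k where k: "(l, k) \<in> r" "(k3, k) \<in> r" using directed * r_in l by blast
  have kr: "(k1, k) \<in> r" "(k2, k) \<in> r" using r_trans l k by blast+
  show thesis
    by (rule that[of k "\<phi> k k1 a1" "\<phi> k k2 a2" "\<phi> k k3 a3"])
      (use * k kr r_in \<phi>_in in \<open>auto simp: \<iota>_shift\<close>)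
qed

text \<open>
  Addition and multiplication of the direct limit are defined by the union on the left-hand side. All
  members of the union agree: any two choices of representatives and of an upper bound can be
  compared at an index beyond all that are involved, where compatible operations give equal results.
\<close>

lemma binary_op:
  assumes k: "k \<in> I" "a \<in> carrier (A k)" "b \<in> carrier (A k)"
    and cl: "\<And>m x y. m \<in> I \<Longrightarrow> x \<in> carrier (A m) \<Longrightarrow> y \<in> carrier (A m) \<Longrightarrow> f m x y \<in> carrier (A m)"
    and hom: "\<And>m n x y. (m, n) \<in> r \<Longrightarrow> x \<in> carrier (A m) \<Longrightarrow> y \<in> carrier (A m) \<Longrightarrow>
      \<phi> n m (f m x y) = f n (\<phi> n m x) (\<phi> n m y)"
  shows "(\<Union>(i, a')\<in>\<iota> k a. \<Union>(j, b')\<in>\<iota> k b. \<Union>m\<in>{m. (i, m) \<in> r \<and> (j, m) \<in> r}. \<iota> m (f m (\<phi> m i a') (\<phi> m j b'))) = \<iota> k (f k a b)"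
proof -
  have one: "\<iota> m (f m (\<phi> m i a') (\<phi> m j b')) = \<iota> k (f k a b)"
    if a: "(i, a') \<in> \<iota> k a" and b: "(j, b') \<in> \<iota> k b" and m: "(i, m) \<in> r" "(j, m) \<in> r" for i a' j b' m
  proof -
    obtain l where i: "i \<in> I" "a' \<in> carrier (A i)" and l: "(k, l) \<in> r" "(i, l) \<in> r" "\<phi> l k a = \<phi> l i a'"
      using a k by (auto simp: mem_\<iota>)
    obtain n where j: "j \<in> I" "b' \<in> carrier (A j)" and n: "(k, n) \<in> r" "(j, n) \<in> r" "\<phi> n k b = \<phi> n j b'"
      using b k by (auto simp: mem_\<iota>)
    obtain q0 where q0: "(l, q0) \<in> r" "(n, q0) \<in> r" using directed r_in l(1) n(1) by blast
    obtain q where q: "(q0, q) \<in> r" "(m, q) \<in> r" using directed r_in q0 m by blast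
    have lq: "(l, q) \<in> r" "(n, q) \<in> r" using q0 q r_trans by blast+
    then have kq: "(k, q) \<in> r" using l r_trans by blast
    have mI: "m \<in> I" using r_in m by blast
    have "\<phi> q m (f m (\<phi> m i a') (\<phi> m j b')) = f q (\<phi> q i a') (\<phi> q j b')"
      using hom[OF q(2) \<phi>_in[OF m(1) i(2)] \<phi>_in[OF m(2) j(2)]] \<phi>_comp[OF m(1) q(2) i(2)] \<phi>_comp[OF m(2) q(2) j(2)] by simp
    also have "\<dots> = f q (\<phi> q k a) (\<phi> q k b)"
      using agree_later[OF l lq(1) k(2) i(2)] agree_later[OF n lq(2) k(3) j(2)] by simp
    also have "\<dots> = \<phi> q k (f k a b)" using hom[OF kq k(2,3)] by simp
    finally have "\<phi> q m (f m (\<phi> m i a') (\<phi> m j b')) = \<phi> q k (f k a b)" .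
    then show ?thesis
      using \<iota>_shift[OF q(2) cl[OF mI \<phi>_in[OF m(1) i(2)] \<phi>_in[OF m(2) j(2)]]] \<iota>_shift[OF kq cl[OF k]] by simp
  qed
  show ?thesis
  proof (intro equalityI subsetI)
    fix z assume "z \<in> (\<Union>(i, a')\<in>\<iota> k a. \<Union>(j, b')\<in>\<iota> k b. \<Union>m\<in>{m. (i, m) \<in> r \<and> (j, m) \<in> r}. \<iota> m (f m (\<phi> m i a') (\<phi> m j b')))"
    then obtain i a' j b' m where "(i, a') \<in> \<iota> k a" "(j, b') \<in> \<iota> k b" "(i, m) \<in> r" "(j, m) \<in> r"
      "z \<in> \<iota> m (f m (\<phi> m i a') (\<phi> m j b'))" by blast
    then show "z \<in> \<iota> k (f k a b)" using one by simp
  next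
    fix z assume "z \<in> \<iota> k (f k a b)"
    then have "z \<in> \<iota> k (f k (\<phi> k k a) (\<phi> k k b))" using k by (simp add: \<phi>_id)
    then show "z \<in> (\<Union>(i, a')\<in>\<iota> k a. \<Union>(j, b')\<in>\<iota> k b. \<Union>m\<in>{m. (i, m) \<in> r \<and> (j, m) \<in> r}. \<iota> m (f m (\<phi> m i a') (\<phi> m j b')))"
      using \<iota>_self[OF k(1,2)] \<iota>_self[OF k(1,3)] r_refl[OF k(1)] by blast
  qed
qed

lemma add_L:
  assumes k: "k \<in> I" "a \<in> carrier (A k)" "b \<in> carrier (A k)"
  shows "\<iota> k a \<oplus>\<^bsub>L\<^esub> \<iota> k b = \<iota> k (a \<oplus>\<^bsub>A k\<^esub> b)"
proof -
  have cl: "x \<oplus>\<^bsub>A m\<^esub> y \<in> carrier (A m)" if "m \<in> I" "x \<in> carrier (A m)" "y \<in> carrier (A m)" for m x y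
  proof -
    interpret normed_complex_algebra "A m" using normed_A that(1) .
    show ?thesis using that by simp
  qed
  from binary_op[OF k, of "\<lambda>m. (\<oplus>\<^bsub>A m\<^esub>)", OF cl \<phi>_add] show ?thesis
    by (simp add: algebraic_direct_limit_def Let_def \<iota>_def)
qed

lemma mult_L:
  assumes k: "k \<in> I" "a \<in> carrier (A k)" "b \<in> carrier (A k)"
  shows "\<iota> k a \<otimes>\<^bsub>L\<^esub> \<iota> k b = \<iota> k (a \<otimes>\<^bsub>A k\<^esub> b)"
proof -
  have cl: "x \<otimes>\<^bsub>A m\<^esub> y \<in> carrier (A m)" if "m \<in> I" "x \<in> carrier (A m)" "y \<in> carrier (A m)" for m x y
  proof -
    interpret normed_complex_algebra "A m" using normed_A that(1) .
    show ?thesis using that by (simp add: mult_closed)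
  qed
  from binary_op[OF k, of "\<lambda>m. (\<otimes>\<^bsub>A m\<^esub>)", OF cl \<phi>_mult] show ?thesis
    by (simp add: algebraic_direct_limit_def Let_def \<iota>_def)
qed

lemma sm_A: "k \<in> I \<Longrightarrow> a \<in> carrier (A k) \<Longrightarrow> c \<odot>\<^bsub>A k\<^esub> a \<in> carrier (A k)"
  using cmodule.sm_closed[of "A k"] normed_A[of k] by (simp add: normed_complex_algebra_def normed_module_def)

lemma smult_L:
  assumes k: "k \<in> I" "a \<in> carrier (A k)"
  shows "c \<odot>\<^bsub>L\<^esub> \<iota> k a = \<iota> k (c \<odot>\<^bsub>A k\<^esub> a)"
proof -
  have "\<iota> i (c \<odot>\<^bsub>A i\<^esub> b) = \<iota> k (c \<odot>\<^bsub>A k\<^esub> a)" if ib: "(i, b) \<in> \<iota> k a" for i b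
  proof -
    obtain l where i: "i \<in> I" "b \<in> carrier (A i)" and l: "(k, l) \<in> r" "(i, l) \<in> r" "\<phi> l k a = \<phi> l i b"
      using ib k by (auto simp: mem_\<iota>)
    have "\<phi> l k (c \<odot>\<^bsub>A k\<^esub> a) = \<phi> l i (c \<odot>\<^bsub>A i\<^esub> b)" using l i k by (simp add: \<phi>_smult)
    then show ?thesis using \<iota>_shift[OF l(1) sm_A[OF k]] \<iota>_shift[OF l(2) sm_A[OF i]] by metis
  qed
  note one = this
  have "(\<Union>(i, b)\<in>\<iota> k a. \<iota> i (c \<odot>\<^bsub>A i\<^esub> b)) = \<iota> k (c \<odot>\<^bsub>A k\<^esub> a)"
  proof (intro equalityI subsetI)
    fix z assume "z \<in> (\<Union>(i, b)\<in>\<iota> k a. \<iota> i (c \<odot>\<^bsub>A i\<^esub> b))"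
    then obtain i b where "(i, b) \<in> \<iota> k a" "z \<in> \<iota> i (c \<odot>\<^bsub>A i\<^esub> b)" by blast
    then show "z \<in> \<iota> k (c \<odot>\<^bsub>A k\<^esub> a)" using one by simp
  next
    fix z assume "z \<in> \<iota> k (c \<odot>\<^bsub>A k\<^esub> a)"
    then show "z \<in> (\<Union>(i, b)\<in>\<iota> k a. \<iota> i (c \<odot>\<^bsub>A i\<^esub> b))" using \<iota>_self[OF k] by blast
  qed
  then show ?thesis by (simp add: algebraic_direct_limit_def Let_def \<iota>_def)
qed

lemma zero_A: "i \<in> I \<Longrightarrow> \<zero>\<^bsub>A i\<^esub> \<in> carrier (A i)"
proof -
  assume "i \<in> I"
  then interpret normed_complex_algebra "A i" by (rule normed_A)
  show ?thesis by simp
qed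

lemma zero_L:
  assumes k: "k \<in> I"
  shows "\<zero>\<^bsub>L\<^esub> = \<iota> k \<zero>\<^bsub>A k\<^esub>"
proof -
  have "\<iota> i \<zero>\<^bsub>A i\<^esub> = \<iota> k \<zero>\<^bsub>A k\<^esub>" if i: "i \<in> I" for i
  proof -
    obtain l where l: "(k, l) \<in> r" "(i, l) \<in> r" using directed k i by blast
    show ?thesis using \<iota>_shift[OF l(1) zero_A[OF k]] \<iota>_shift[OF l(2) zero_A[OF i]] l by (simp add: \<phi>_zero)
  qed
  then have "(\<Union>i\<in>I. \<iota> i \<zero>\<^bsub>A i\<^esub>) = (\<Union>i\<in>I. \<iota> k \<zero>\<^bsub>A k\<^esub>)" by (rule SUP_cong[OF refl])
  also have "\<dots> = \<iota> k \<zero>\<^bsub>A k\<^esub>" using k by blast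
  finally show ?thesis by (simp add: algebraic_direct_limit_def Let_def \<iota>_def)
qed

lemma alg_map_\<iota>: "k \<in> I \<Longrightarrow> alg_map (A k) L (\<iota> k)"
  by (auto simp: alg_map_def module_map_def \<iota>_in add_L mult_L smult_L zero_L)

lemma complex_algebra_L: "complex_algebra L"
proof (rule complex_algebra_local)
  show "carrier L \<noteq> {}" using I_ne zero_A \<iota>_in by blast
  fix X Y Z assume "X \<in> carrier L" "Y \<in> carrier L" "Z \<in> carrier L"
  then obtain k a b c where k: "k \<in> I" "a \<in> carrier (A k)" "b \<in> carrier (A k)" "c \<in> carrier (A k)"
    "X = \<iota> k a" "Y = \<iota> k b" "Z = \<iota> k c" by (rule common_index)
  show "\<exists>(V :: 'a normed_algebra) h. complex_algebra V \<and> alg_map V L h \<and> X \<in> h ` carrier V \<and> Y \<in> h ` carrier V \<and> Z \<in> h ` carrier V"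
    by (intro exI[of _ "A k"] exI[of _ "\<iota> k"] conjI alg_map_\<iota> normed_complex_algebra.axioms(2) normed_A)
      (use k in auto)
qed

abbreviation F :: "'i filter" where "F \<equiv> tail_filter I r"

lemma eventually_F: "eventually P F \<longleftrightarrow> (\<exists>i\<in>I. \<forall>j. (i, j) \<in> r \<longrightarrow> P j)"
  unfolding tail_filter_def
proof (subst eventually_INF_base)
  fix a b assume "a \<in> I" "b \<in> I"
  then obtain k where "(a, k) \<in> r" "(b, k) \<in> r" using directed by blast
  then show "\<exists>x\<in>I. principal {j. (x, j) \<in> r} \<le> inf (principal {j. (a, j) \<in> r}) (principal {j. (b, j) \<in> r})"
    using r_in r_trans by (intro bexI[of _ k]) auto
qed (use I_ne in \<open>auto simp: eventually_principal\<close>)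

lemma F_ne: "F \<noteq> bot"
  using r_refl by (auto simp: trivial_limit_def eventually_F)

text \<open>
  The norms \<open>\<parallel>\<phi> j k a\<parallel>\<close> decrease with \<open>j\<close>, since the connecting maps are contractive, and so they
  converge to their infimum.
\<close>

lemma tendsto_vnorm_L:
  assumes k: "k \<in> I" "a \<in> carrier (A k)"
  shows "((\<lambda>j. vnorm (A j) (\<phi> j k a)) \<longlongrightarrow> vnorm L (\<iota> k a)) F"
proof -
  let ?f = "\<lambda>j. vnorm (A j) (\<phi> j k a)"
  define l where "l = (INF j\<in>{j. (k, j) \<in> r}. ?f j)"
  have ne: "{j. (k, j) \<in> r} \<noteq> {}" using r_refl k by auto
  have nn: "0 \<le> ?f j" if "(k, j) \<in> r" for j
    using normed_module.vnorm_nonneg[OF normed_complex_algebra.axioms(1)[OF normed_A], of j "\<phi> j k a"] \<phi>_in[OF that k(2)] r_in[OF that] by simp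
  have bdd: "bdd_below (?f ` {j. (k, j) \<in> r})" using nn by (auto intro!: bdd_belowI2[where m=0])
  have "(?f \<longlongrightarrow> l) F"
  proof (rule tendstoI)
    fix e :: real assume "0 < e"
    then have "l < l + e" by simp
    then obtain j where j: "(k, j) \<in> r" "?f j < l + e"
      unfolding l_def cINF_less_iff[OF ne bdd] by auto
    have "dist (?f m) l < e" if m: "(j, m) \<in> r" for m
    proof -
      have km: "(k, m) \<in> r" using j m r_trans by blast
      have "l \<le> ?f m" unfolding l_def using bdd km by (intro cINF_lower) auto
      moreover have "?f m \<le> ?f j" using \<phi>_hom(2)[OF m \<phi>_in[OF j(1) k(2)]] \<phi>_comp[OF j(1) m k(2)] by simp
      ultimately show ?thesis using j(2) by (simp add: dist_real_def)
    qed
    then show "eventually (\<lambda>m. dist (?f m) l < e) F" using j r_in unfolding eventually_F by blast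
  qed
  then have "Lim F ?f = l" by (rule tendsto_Lim[OF F_ne])
  with \<open>(?f \<longlongrightarrow> l) F\<close> have tl: "(?f \<longlongrightarrow> Lim F ?f) F" by simp
  have "Lim F (\<lambda>j. vnorm (A j) (\<phi> j i b)) = Lim F ?f" if ib: "(i, b) \<in> \<iota> k a" for i b
  proof (rule tendsto_imp_Lim_eq)
    obtain l where i: "i \<in> I" "b \<in> carrier (A i)" and l: "(k, l) \<in> r" "(i, l) \<in> r" "\<phi> l k a = \<phi> l i b"
      using ib k by (auto simp: mem_\<iota>)
    show "eventually (\<lambda>j. vnorm (A j) (\<phi> j i b) = vnorm (A j) (\<phi> j k a)) F"
      unfolding eventually_F using agree_later[OF l _ k(2) i(2)] l(1) r_in by (intro bexI[of _ l]) auto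
  qed
  note same = this
  have "(\<lambda>(i, a). Lim F (\<lambda>j. vnorm (A j) (\<phi> j i a))) ` \<iota> k a = {Lim F ?f}"
  proof (intro equalityI subsetI)
    fix t assume "t \<in> (\<lambda>(i, a). Lim F (\<lambda>j. vnorm (A j) (\<phi> j i a))) ` \<iota> k a"
    then obtain i b where ib: "(i, b) \<in> \<iota> k a" "t = Lim F (\<lambda>j. vnorm (A j) (\<phi> j i b))" by auto
    show "t \<in> {Lim F ?f}" unfolding ib(2) same[OF ib(1)] by simp
  next
    fix t assume "t \<in> {Lim F ?f}"
    then show "t \<in> (\<lambda>(i, a). Lim F (\<lambda>j. vnorm (A j) (\<phi> j i a))) ` \<iota> k a"
      by (intro image_eqI[OF _ \<iota>_self[OF k]]) simp
  qed
  then have "vnorm L (\<iota> k a) = Lim F ?f"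
    by (simp add: algebraic_direct_limit_def Let_def)
  with tl show ?thesis by simp
qed

end

section \<open>Integrable powers and the Minkowski inequality\<close>

text \<open>
  Convexity of the \<open>p\<close>-th power on the closed half-line; at the endpoint \<open>0\<close> it reduces to
  \<open>s\<^sup>p \<le> s\<close> for \<open>0 \<le> s \<le> 1\<close>.
\<close>

lemma powr_convex_combination:
  fixes a b p t :: real
  assumes p: "1 \<le> p" and a: "0 \<le> a" and b: "0 \<le> b" and t: "0 \<le> t" "t \<le> 1"
  shows "(t * a + (1 - t) * b) powr p \<le> t * a powr p + (1 - t) * b powr p"
proof -
  have *: "(s * c) powr p \<le> s * c powr p" if "0 \<le> s" "s \<le> 1" "0 \<le> c" for s c :: real
  proof -
    have "s powr p \<le> s"
    proof (cases "s = 0")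
      case False
      then have "s powr p \<le> s powr 1" using that p by (intro powr_mono') auto
      then show ?thesis using that by simp
    qed simp
    then show ?thesis using that by (simp add: powr_mult mult_right_mono)
  qed
  consider "a = 0" | "b = 0" | "0 < a" "0 < b" using a b by linarith
  then show ?thesis
  proof cases
    case 1 then show ?thesis using *[of "1 - t" b] t b by simp
  next
    case 2 then show ?thesis using *[of t a] t a by simp
  next
    case 3
    then show ?thesis
      using convex_onD[OF powr_convex[OF p], of "1 - t" a b] t by (simp add: algebra_simps)
  qed
qed

abbreviation Lp :: "real \<Rightarrow> 'x measure \<Rightarrow> ('x \<Rightarrow> complex) set" where
  "Lp p M \<equiv> carrier (pre_Lp_space p M)"

abbreviation pnorm :: "real \<Rightarrow> 'x measure \<Rightarrow> ('x \<Rightarrow> complex) \<Rightarrow> real" where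
  "pnorm p M \<equiv> vnorm (pre_Lp_space p M)"

abbreviation pint :: "real \<Rightarrow> 'x measure \<Rightarrow> ('x \<Rightarrow> complex) \<Rightarrow> real" where
  "pint p M f \<equiv> (LINT x|M. cmod (f x) powr p)"

lemma Lp_iff: "f \<in> Lp p M \<longleftrightarrow> f \<in> borel_measurable M \<and> integrable M (\<lambda>x. cmod (f x) powr p)"
  by (simp add: pre_Lp_space_def)

lemma Lp_measurable [measurable_dest]: "f \<in> Lp p M \<Longrightarrow> f \<in> borel_measurable M"
  by (simp add: Lp_iff)

lemma Lp_integrable: "f \<in> Lp p M \<Longrightarrow> integrable M (\<lambda>x. cmod (f x) powr p)"
  by (simp add: Lp_iff)

lemma pnorm_def: "pnorm p M f = pint p M f powr (1 / p)"
  by (simp add: pre_Lp_space_def)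

lemma pint_nonneg: "0 \<le> pint p M f"
  by (rule Bochner_Integration.integral_nonneg) simp

lemma pnorm_nonneg: "0 \<le> pnorm p M f"
  by (simp add: pnorm_def)

lemma pnorm_powr: "1 \<le> p \<Longrightarrow> pnorm p M f powr p = pint p M f"
  using pint_nonneg[of M f p] by (simp add: pnorm_def powr_powr)

lemma pnorm_le_iff:
  assumes "1 \<le> p" "0 \<le> c"
  shows "pnorm p M f \<le> c \<longleftrightarrow> pint p M f \<le> c powr p"
proof
  assume "pnorm p M f \<le> c"
  then have "pnorm p M f powr p \<le> c powr p" using assms by (intro powr_mono2 pnorm_nonneg) auto
  then show "pint p M f \<le> c powr p" using assms by (simp add: pnorm_powr)
next
  assume "pint p M f \<le> c powr p"
  then have "pint p M f powr (1 / p) \<le> (c powr p) powr (1 / p)"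
    using assms pint_nonneg[of M f p] by (intro powr_mono2) auto
  then show "pnorm p M f \<le> c" using assms by (simp add: pnorm_def powr_powr)
qed

lemma Lp_dominated:
  assumes p: "1 \<le> p" and f: "f \<in> Lp p M" and g: "g \<in> borel_measurable M"
    and le: "\<And>x. x \<in> space M \<Longrightarrow> cmod (g x) \<le> cmod (f x)"
  shows "g \<in> Lp p M" "pint p M g \<le> pint p M f" "pnorm p M g \<le> pnorm p M f"
proof -
  have b: "cmod (g x) powr p \<le> cmod (f x) powr p" if "x \<in> space M" for x
    using le[OF that] p by (intro powr_mono2) auto
  show gL: "g \<in> Lp p M"
    unfolding Lp_iff using g b
    by (auto intro!: Bochner_Integration.integrable_bound[OF Lp_integrable[OF f]])
  show le: "pint p M g \<le> pint p M f"
    by (intro integral_mono Lp_integrable gL f b)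
  show "pnorm p M g \<le> pnorm p M f"
    unfolding pnorm_def using le p pint_nonneg[of M g p] by (intro powr_mono2) auto
qed

lemma Lp_zero: "(\<lambda>x. 0) \<in> Lp p M"
  by (simp add: Lp_iff)

lemma pnorm_zero: "1 \<le> p \<Longrightarrow> pnorm p M (\<lambda>x. 0) = 0"
  by (simp add: pnorm_def)

lemma Lp_cmult: "f \<in> Lp p M \<Longrightarrow> (\<lambda>x. c * f x) \<in> Lp p M"
  by (auto simp: Lp_iff norm_mult powr_mult)

lemma pint_cmult: "pint p M (\<lambda>x. c * f x) = cmod c powr p * pint p M f"
  by (simp add: norm_mult powr_mult)

lemma pnorm_cmult: "1 \<le> p \<Longrightarrow> pnorm p M (\<lambda>x. c * f x) = cmod c * pnorm p M f"
  unfolding pnorm_def pint_cmult using pint_nonneg[of M f p] by (simp add: powr_mult powr_powr)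

lemma Lp_add:
  assumes p: "1 \<le> p" and f: "f \<in> Lp p M" and g: "g \<in> Lp p M"
  shows "(\<lambda>x. f x + g x) \<in> Lp p M"
  unfolding Lp_iff
proof
  show "(\<lambda>x. f x + g x) \<in> borel_measurable M" using f g by measurable
  have "integrable M (\<lambda>x. 2 powr p * (cmod (f x) powr p + cmod (g x) powr p))"
    using Lp_integrable[OF f] Lp_integrable[OF g] by auto
  then show "integrable M (\<lambda>x. cmod (f x + g x) powr p)"
  proof (rule Bochner_Integration.integrable_bound)
    show "(\<lambda>x. cmod (f x + g x) powr p) \<in> borel_measurable M" using f g by measurable
    have "cmod (f x + g x) powr p \<le> 2 powr p * (cmod (f x) powr p + cmod (g x) powr p)" for x
    proof -
      have "cmod (f x + g x) powr p \<le> (2 * max (cmod (f x)) (cmod (g x))) powr p"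
        using p norm_triangle_ineq[of "f x" "g x"] by (intro powr_mono2) auto
      also have "\<dots> = 2 powr p * (max (cmod (f x)) (cmod (g x))) powr p"
        by (simp add: powr_mult)
      also have "\<dots> \<le> 2 powr p * (cmod (f x) powr p + cmod (g x) powr p)"
        by (intro mult_left_mono) (auto simp: max_def)
      finally show ?thesis .
    qed
    then show "AE x in M. norm (cmod (f x + g x) powr p) \<le> norm (2 powr p * (cmod (f x) powr p + cmod (g x) powr p))"
      by simp
  qed
qed

lemma Lp_diff:
  assumes "1 \<le> p" "f \<in> Lp p M" "g \<in> Lp p M"
  shows "(\<lambda>x. f x - g x) \<in> Lp p M"
  using Lp_add[OF assms(1,2) Lp_cmult[OF assms(3), of "-1"]] by simp

text \<open>
  Up to the common factor \<open>A + B\<close>, the sum \<open>\<bar>f\<bar> + \<bar>g\<bar>\<close> is a convex combination of \<open>\<bar>f\<bar> / A\<close> and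
  \<open>\<bar>g\<bar> / B\<close>, two functions of norm at most one. The numbers \<open>A\<close> and \<open>B\<close> exceed the norms by a
  positive amount in order to allow norm zero.
\<close>

lemma minkowski:
  assumes p: "1 \<le> p" and f: "f \<in> Lp p M" and g: "g \<in> Lp p M"
  shows "pnorm p M (\<lambda>x. f x + g x) \<le> pnorm p M f + pnorm p M g"
proof (rule field_le_epsilon)
  fix e :: real assume e: "0 < e"
  define A where "A = pnorm p M f + e / 2"
  define B where "B = pnorm p M g + e / 2"
  have A: "0 < A" "pint p M f \<le> A powr p" and B: "0 < B" "pint p M g \<le> B powr p"
    using e pnorm_nonneg[of p M f] pnorm_nonneg[of p M g]
      pnorm_le_iff[OF p, of A M f] pnorm_le_iff[OF p, of B M g] by (auto simp: A_def B_def)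
  define t where "t = A / (A + B)"
  have t: "0 \<le> t" "t \<le> 1" "(A + B) * t = A" "(A + B) * (1 - t) = B"
    using A(1) B(1) by (auto simp: t_def field_simps)
  have pw: "cmod (f x + g x) powr p \<le>
      (A + B) powr p * (t * (cmod (f x) powr p / A powr p) + (1 - t) * (cmod (g x) powr p / B powr p))" for x
  proof -
    have "cmod (f x + g x) \<le> (A + B) * t * (cmod (f x) / A) + (A + B) * (1 - t) * (cmod (g x) / B)"
      unfolding t using A B norm_triangle_ineq[of "f x" "g x"] by simp
    also have "\<dots> = (A + B) * (t * (cmod (f x) / A) + (1 - t) * (cmod (g x) / B))"
      by (simp only: distrib_left mult.assoc)
    finally have "cmod (f x + g x) powr p \<le> ((A + B) * (t * (cmod (f x) / A) + (1 - t) * (cmod (g x) / B))) powr p"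
      using p by (intro powr_mono2) auto
    also have "\<dots> = (A + B) powr p * (t * (cmod (f x) / A) + (1 - t) * (cmod (g x) / B)) powr p"
      by (rule powr_mult)
    also have "\<dots> \<le> (A + B) powr p * (t * (cmod (f x) / A) powr p + (1 - t) * (cmod (g x) / B) powr p)"
      using A B by (intro mult_left_mono powr_convex_combination p t) auto
    finally show ?thesis using A B by (simp add: powr_divide)
  qed
  have iF: "integrable M (\<lambda>x. cmod (f x) powr p)" and iG: "integrable M (\<lambda>x. cmod (g x) powr p)"
    using f g by (auto intro: Lp_integrable)
  have "pint p M (\<lambda>x. f x + g x) \<le>
      (LINT x|M. (A + B) powr p * (t * (cmod (f x) powr p / A powr p) + (1 - t) * (cmod (g x) powr p / B powr p)))"
    by (intro integral_mono pw Lp_integrable Lp_add p f g) (use iF iG in simp)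
  also have "\<dots> = (A + B) powr p * (t * (pint p M f / A powr p) + (1 - t) * (pint p M g / B powr p))"
    using iF iG by simp
  also have "\<dots> \<le> (A + B) powr p * (t * 1 + (1 - t) * 1)"
    using A B t by (intro mult_left_mono add_mono) auto
  finally have "pnorm p M (\<lambda>x. f x + g x) \<le> A + B"
    using A B by (simp add: pnorm_le_iff[OF p])
  then show "pnorm p M (\<lambda>x. f x + g x) \<le> pnorm p M f + pnorm p M g + e"
    by (simp add: A_def B_def)
qed

lemma pnorm_eq_0_iff:
  assumes p: "1 \<le> p" and f: "f \<in> Lp p M"
  shows "pnorm p M f = 0 \<longleftrightarrow> (AE x in M. f x = 0)"
proof -
  have "pnorm p M f = 0 \<longleftrightarrow> pint p M f = 0" by (simp add: pnorm_def)
  also have "\<dots> \<longleftrightarrow> (AE x in M. cmod (f x) powr p = 0)"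
    by (intro integral_nonneg_eq_0_iff_AE Lp_integrable f) simp
  finally show ?thesis by simp
qed

lemma pnorm_cong_AE:
  assumes "f \<in> borel_measurable M" "g \<in> borel_measurable M" "AE x in M. f x = g x"
  shows "pnorm p M f = pnorm p M g"
proof -
  have "pint p M f = pint p M g"
    using assms by (intro integral_cong_AE) auto
  then show ?thesis by (simp add: pnorm_def)
qed

lemma pnorm_dominated_convergence:
  assumes p: "1 \<le> p" and f: "f \<in> Lp p M" and s: "\<And>i. s i \<in> borel_measurable M"
    and lim: "\<And>x. x \<in> space M \<Longrightarrow> (\<lambda>i. s i x) \<longlonglongrightarrow> f x"
    and bd: "\<And>i x. x \<in> space M \<Longrightarrow> cmod (s i x) \<le> 2 * cmod (f x)"
  shows "(\<lambda>i. pnorm p M (\<lambda>x. s i x - f x)) \<longlonglongrightarrow> 0" "\<And>i. s i \<in> Lp p M"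
proof -
  show "s i \<in> Lp p M" for i
    by (rule Lp_dominated[OF p Lp_cmult[OF f, of 2] s]) (use bd in \<open>auto simp: norm_mult\<close>)
  have "(\<lambda>i. pint p M (\<lambda>x. s i x - f x)) \<longlonglongrightarrow> (LINT x|M. 0)"
  proof (rule integral_dominated_convergence)
    show "integrable M (\<lambda>x. cmod (3 * f x) powr p)"
      by (rule Lp_integrable[OF Lp_cmult[OF f]])
    show "(\<lambda>x. cmod (s i x - f x) powr p) \<in> borel_measurable M" for i using s f by measurable
    show "AE x in M. (\<lambda>i. cmod (s i x - f x) powr p) \<longlonglongrightarrow> 0"
    proof (rule AE_I2)
      fix x assume "x \<in> space M"
      then have "(\<lambda>i. cmod (s i x - f x)) \<longlonglongrightarrow> 0" using lim by (simp add: LIM_zero_iff tendsto_norm_zero)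
      then have "(\<lambda>i. cmod (s i x - f x) powr p) \<longlonglongrightarrow> 0 powr p"
        using p by (intro tendsto_powr') auto
      then show "(\<lambda>i. cmod (s i x - f x) powr p) \<longlonglongrightarrow> 0" by simp
    qed
    show "AE x in M. norm (cmod (s i x - f x) powr p) \<le> cmod (3 * f x) powr p" for i
    proof (rule AE_I2)
      fix x assume x: "x \<in> space M"
      have "cmod (s i x - f x) \<le> cmod (s i x) + cmod (f x)" by (rule norm_triangle_ineq4)
      also have "\<dots> \<le> cmod (3 * f x)" using bd[OF x, of i] by (simp add: norm_mult)
      finally show "norm (cmod (s i x - f x) powr p) \<le> cmod (3 * f x) powr p"
        using p by (auto intro: powr_mono2)
    qed
  qed simp
  then have "(\<lambda>i. pint p M (\<lambda>x. s i x - f x) powr (1 / p)) \<longlonglongrightarrow> 0 powr (1 / p)"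
    using p by (intro tendsto_powr') (auto simp: pint_nonneg)
  then show "(\<lambda>i. pnorm p M (\<lambda>x. s i x - f x)) \<longlonglongrightarrow> 0" using p by (simp add: pnorm_def)
qed

section \<open>Direct sums of measures\<close>

text \<open>
  A sum over an arbitrary index set is the supremum of its finite partial sums: a simple function
  below \<open>b\<close> has finite support, unless it takes a positive value infinitely often, and then the
  partial sums of \<open>b\<close> are unbounded.
\<close>

lemma nn_integral_count_space_le:
  fixes b :: "'d \<Rightarrow> ennreal"
  assumes "\<And>S. finite S \<Longrightarrow> S \<subseteq> D \<Longrightarrow> (\<Sum>u\<in>S. b u) \<le> c"
  shows "(\<integral>\<^sup>+u. b u \<partial>count_space D) \<le> c"
  unfolding nn_integral_def
proof (rule SUP_least)
  fix g assume "g \<in> {g. simple_function (count_space D) g \<and> g \<le> b}"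
  then have fin: "finite (g ` D)" and gb: "\<And>u. g u \<le> b u" by (auto simp: le_fun_def)
  show "integral\<^sup>S (count_space D) g \<le> c"
  proof (cases "finite {u\<in>D. g u \<noteq> 0}")
    case True
    have "integral\<^sup>S (count_space D) g = (\<integral>\<^sup>+u. g u \<partial>count_space D)"
      using fin by (intro nn_integral_eq_simple_integral[symmetric]) simp
    also have "\<dots> = (\<Sum>u\<in>{u\<in>D. g u \<noteq> 0}. g u)"
      by (rule nn_integral_count_space'[OF True]) auto
    also have "\<dots> \<le> (\<Sum>u\<in>{u\<in>D. g u \<noteq> 0}. b u)" by (intro sum_mono gb)
    also have "\<dots> \<le> c" using True by (intro assms) auto
    finally show ?thesis .
  next
    case False
    have "{u\<in>D. g u \<noteq> 0} = (\<Union>y\<in>g ` D - {0}. {u\<in>D. g u = y})" by auto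
    with False fin obtain y where y: "y \<noteq> 0" "infinite {u\<in>D. g u = y}" by auto
    have "c = \<infinity>"
    proof (rule ccontr)
      assume "c \<noteq> \<infinity>"
      obtain n :: nat where n: "c < of_nat n * y"
      proof -
        have "\<exists>n. c < of_nat n * y"
        proof (cases "y = \<infinity>")
          case True
          then show ?thesis using \<open>c \<noteq> \<infinity>\<close> by (intro exI[of _ 1]) (auto simp: less_top)
        next
          case False
          then obtain y' where y': "y = ennreal y'" "0 < y'" using y(1) by (cases y) auto
          obtain c' where c': "c = ennreal c'" "0 \<le> c'" using \<open>c \<noteq> \<infinity>\<close> by (cases c) auto
          obtain n :: nat where "c' < real n * y'" using reals_Archimedean3[OF y'(2)] by blast
          then have "c < of_nat n * y"
            unfolding y' c' using y'(2) c'(2)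
            by (simp add: ennreal_of_nat_eq_real_of_nat ennreal_mult[symmetric] ennreal_lessI)
          then show ?thesis ..
        qed
        then show thesis using that by blast
      qed
      obtain S where S: "S \<subseteq> {u\<in>D. g u = y}" "finite S" "card S = n"
        using infinite_arbitrarily_large[OF y(2)] by blast
      have "of_nat n * y = (\<Sum>u\<in>S. g u)" using S by (subst sum.cong[OF refl, of S g "\<lambda>_. y"]) auto
      also have "\<dots> \<le> (\<Sum>u\<in>S. b u)" by (intro sum_mono gb)
      also have "\<dots> \<le> c" using S by (intro assms) auto
      finally show False using n by simp
    qed
    then show ?thesis by simp
  qed
qed

lemma sum_le_nn_integral_count_space:
  fixes b :: "'d \<Rightarrow> ennreal"
  assumes "finite S" "S \<subseteq> D"
  shows "(\<Sum>u\<in>S. b u) \<le> (\<integral>\<^sup>+u. b u \<partial>count_space D)"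
proof -
  have "(\<Sum>u\<in>S. b u) = (\<integral>\<^sup>+u. b u * indicator S u \<partial>count_space D)"
    using assms by (subst nn_integral_count_space'[of S]) (auto simp: indicator_def)
  also have "\<dots> \<le> (\<integral>\<^sup>+u. b u \<partial>count_space D)"
    by (intro nn_integral_mono) (auto simp: indicator_def)
  finally show ?thesis .
qed

text \<open>
  The direct sum of an arbitrary, possibly uncountable family of measures. A set is measurable iff all
  of its sections are; this large \<open>\<sigma>\<close>-algebra makes measurability of functions a property of each
  summand separately.
\<close>

definition dsum :: "'d set \<Rightarrow> ('d \<Rightarrow> 'b measure) \<Rightarrow> ('d \<times> 'b) measure" where
  "dsum D N = measure_of (SIGMA u:D. space (N u))
     {A. A \<subseteq> (SIGMA u:D. space (N u)) \<and> (\<forall>u\<in>D. Pair u -` A \<in> sets (N u))}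
     (\<lambda>A. \<integral>\<^sup>+u. emeasure (N u) (Pair u -` A) \<partial>count_space D)"

lemma sigma_algebra_dsum:
  "sigma_algebra (SIGMA u:D. space (N u))
     {A. A \<subseteq> (SIGMA u:D. space (N u)) \<and> (\<forall>u\<in>D. Pair u -` A \<in> sets (N u))}"
  unfolding sigma_algebra_iff2
proof (intro conjI ballI allI impI)
  fix A assume "A \<in> {A. A \<subseteq> (SIGMA u:D. space (N u)) \<and> (\<forall>u\<in>D. Pair u -` A \<in> sets (N u))}"
  then have A: "\<forall>u\<in>D. Pair u -` A \<in> sets (N u)" by auto
  have "Pair u -` ((SIGMA u:D. space (N u)) - A) = space (N u) - Pair u -` A" if "u \<in> D" for u
    using that by auto
  then show "(SIGMA u:D. space (N u)) - A \<in>
      {A. A \<subseteq> (SIGMA u:D. space (N u)) \<and> (\<forall>u\<in>D. Pair u -` A \<in> sets (N u))}"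
    using A by auto
next
  fix A :: "nat \<Rightarrow> _"
  assume "range A \<subseteq> {A. A \<subseteq> (SIGMA u:D. space (N u)) \<and> (\<forall>u\<in>D. Pair u -` A \<in> sets (N u))}"
  then show "\<Union> (range A) \<in> {A. A \<subseteq> (SIGMA u:D. space (N u)) \<and> (\<forall>u\<in>D. Pair u -` A \<in> sets (N u))}"
    by (auto simp: vimage_UN subset_iff intro!: sets.countable_UN)
qed auto

lemma space_dsum: "space (dsum D N) = (SIGMA u:D. space (N u))"
  unfolding dsum_def by (rule space_measure_of) auto

lemma sets_dsum:
  "sets (dsum D N) = {A. A \<subseteq> (SIGMA u:D. space (N u)) \<and> (\<forall>u\<in>D. Pair u -` A \<in> sets (N u))}"
  unfolding dsum_def by (rule sigma_algebra.sets_measure_of_eq[OF sigma_algebra_dsum])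

lemma emeasure_dsum:
  assumes "A \<in> sets (dsum D N)"
  shows "emeasure (dsum D N) A = (\<integral>\<^sup>+u. emeasure (N u) (Pair u -` A) \<partial>count_space D)"
proof (rule emeasure_measure_of[OF dsum_def _ _ _ assms])
  show "positive (sets (dsum D N)) (\<lambda>A. \<integral>\<^sup>+u. emeasure (N u) (Pair u -` A) \<partial>count_space D)"
    by (simp add: positive_def)
  show "countably_additive (sets (dsum D N)) (\<lambda>A. \<integral>\<^sup>+u. emeasure (N u) (Pair u -` A) \<partial>count_space D)"
    unfolding sets_dsum
  proof (rule countably_additiveI)
    fix A :: "nat \<Rightarrow> _"
    assume A: "range A \<subseteq> {A. A \<subseteq> (SIGMA u:D. space (N u)) \<and> (\<forall>u\<in>D. Pair u -` A \<in> sets (N u))}"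
      and disj: "disjoint_family A"
    have "(\<Sum>i. \<integral>\<^sup>+u. emeasure (N u) (Pair u -` A i) \<partial>count_space D) =
        (\<integral>\<^sup>+u. (\<Sum>i. emeasure (N u) (Pair u -` A i)) \<partial>count_space D)"
      by (rule nn_integral_suminf[symmetric]) simp
    also have "\<dots> = (\<integral>\<^sup>+u. emeasure (N u) (Pair u -` \<Union> (range A)) \<partial>count_space D)"
    proof (rule nn_integral_cong)
      fix u assume "u \<in> space (count_space D)"
      then have "range (\<lambda>i. Pair u -` A i) \<subseteq> sets (N u)" using A by auto
      moreover have "disjoint_family (\<lambda>i. Pair u -` A i)"
        using disj by (auto simp: disjoint_family_on_def)
      ultimately show "(\<Sum>i. emeasure (N u) (Pair u -` A i)) = emeasure (N u) (Pair u -` \<Union> (range A))"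
        by (subst suminf_emeasure) (auto simp: vimage_UN)
    qed
    finally show "(\<Sum>i. \<integral>\<^sup>+u. emeasure (N u) (Pair u -` A i) \<partial>count_space D) =
        (\<integral>\<^sup>+u. emeasure (N u) (Pair u -` \<Union> (range A)) \<partial>count_space D)" .
  qed
qed auto
lemma measurable_Pair_dsum: "u \<in> D \<Longrightarrow> Pair u \<in> measurable (N u) (dsum D N)"
  by (rule measurableI) (auto simp: space_dsum sets_dsum sets.Int_space_eq2)

lemma measurable_dsum_iff:
  "f \<in> measurable (dsum D N) L \<longleftrightarrow> (\<forall>u\<in>D. (\<lambda>x. f (u, x)) \<in> measurable (N u) L)"
proof
  assume f: "f \<in> measurable (dsum D N) L"
  show "\<forall>u\<in>D. (\<lambda>x. f (u, x)) \<in> measurable (N u) L"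
    using measurable_compose[OF measurable_Pair_dsum f] by blast
next
  assume f: "\<forall>u\<in>D. (\<lambda>x. f (u, x)) \<in> measurable (N u) L"
  show "f \<in> measurable (dsum D N) L"
  proof (rule measurableI)
    fix z assume "z \<in> space (dsum D N)"
    then show "f z \<in> space L" using f by (auto simp: space_dsum dest: measurable_space)
  next
    fix A assume A: "A \<in> sets L"
    have "Pair u -` (f -` A \<inter> (SIGMA u:D. space (N u))) = (\<lambda>x. f (u, x)) -` A \<inter> space (N u)" if "u \<in> D" for u
      using that by auto
    then show "f -` A \<inter> space (dsum D N) \<in> sets (dsum D N)"
      using f A by (auto simp: space_dsum sets_dsum measurable_sets)
  qed
qed

lemma nn_integral_dsum:
  assumes "f \<in> borel_measurable (dsum D N)"
  shows "(\<integral>\<^sup>+z. f z \<partial>dsum D N) = (\<integral>\<^sup>+u. \<integral>\<^sup>+x. f (u, x) \<partial>N u \<partial>count_space D)"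
  using assms
proof (induction rule: borel_measurable_induct)
  case (cong f g)
  have "(\<integral>\<^sup>+z. f z \<partial>dsum D N) = (\<integral>\<^sup>+z. g z \<partial>dsum D N)" by (intro nn_integral_cong cong)
  moreover have "(\<integral>\<^sup>+u. \<integral>\<^sup>+x. f (u, x) \<partial>N u \<partial>count_space D) = (\<integral>\<^sup>+u. \<integral>\<^sup>+x. g (u, x) \<partial>N u \<partial>count_space D)"
    by (intro nn_integral_cong cong) (auto simp: space_dsum)
  ultimately show ?case using cong by simp
next
  case (set A)
  have "(\<integral>\<^sup>+x. indicator A (u, x) \<partial>N u) = emeasure (N u) (Pair u -` A)" if "u \<in> D" for u
  proof -
    have "(\<integral>\<^sup>+x. indicator A (u, x) \<partial>N u) = (\<integral>\<^sup>+x. indicator (Pair u -` A) x \<partial>N u)"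
      by (intro nn_integral_cong) (auto simp: indicator_def)
    also have "\<dots> = emeasure (N u) (Pair u -` A)"
      using set that by (intro nn_integral_indicator) (auto simp: sets_dsum)
    finally show ?thesis .
  qed
  then have "(\<integral>\<^sup>+u. \<integral>\<^sup>+x. indicator A (u, x) \<partial>N u \<partial>count_space D) =
      (\<integral>\<^sup>+u. emeasure (N u) (Pair u -` A) \<partial>count_space D)"
    by (intro nn_integral_cong) auto
  then show ?case using set by (simp add: emeasure_dsum)
next
  case (mult f c)
  have "(\<integral>\<^sup>+x. c * f (u, x) \<partial>N u) = c * (\<integral>\<^sup>+x. f (u, x) \<partial>N u)" if "u \<in> D" for u
    using mult that by (intro nn_integral_cmult) (auto simp: measurable_dsum_iff)
  then have "(\<integral>\<^sup>+u. \<integral>\<^sup>+x. c * f (u, x) \<partial>N u \<partial>count_space D) =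
      (\<integral>\<^sup>+u. c * (\<integral>\<^sup>+x. f (u, x) \<partial>N u) \<partial>count_space D)"
    by (intro nn_integral_cong) auto
  then show ?case using mult by (simp add: nn_integral_cmult)
next
  case (add f g)
  have "(\<integral>\<^sup>+x. g (u, x) + f (u, x) \<partial>N u) = (\<integral>\<^sup>+x. g (u, x) \<partial>N u) + (\<integral>\<^sup>+x. f (u, x) \<partial>N u)" if "u \<in> D" for u
    using add that by (intro nn_integral_add) (auto simp: measurable_dsum_iff)
  then have "(\<integral>\<^sup>+u. \<integral>\<^sup>+x. g (u, x) + f (u, x) \<partial>N u \<partial>count_space D) =
      (\<integral>\<^sup>+u. (\<integral>\<^sup>+x. g (u, x) \<partial>N u) + (\<integral>\<^sup>+x. f (u, x) \<partial>N u) \<partial>count_space D)"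
    by (intro nn_integral_cong) auto
  then show ?case using add by (simp add: nn_integral_add)
next
  case (seq F)
  have inc: "incseq (\<lambda>i x. F i (u, x))" for u using seq(3) by (auto simp: incseq_def le_fun_def)
  have "(\<integral>\<^sup>+x. (SUP i. F i) (u, x) \<partial>N u) = (SUP i. \<integral>\<^sup>+x. F i (u, x) \<partial>N u)" if "u \<in> D" for u
    using seq(1) that inc nn_integral_monotone_convergence_SUP[of "\<lambda>i x. F i (u, x)" "N u"]
    by (auto simp: measurable_dsum_iff image_comp)
  then have "(\<integral>\<^sup>+u. \<integral>\<^sup>+x. (SUP i. F i) (u, x) \<partial>N u \<partial>count_space D) =
      (\<integral>\<^sup>+u. (SUP i. \<integral>\<^sup>+x. F i (u, x) \<partial>N u) \<partial>count_space D)"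
    by (intro nn_integral_cong) auto
  also have "\<dots> = (SUP i. \<integral>\<^sup>+u. \<integral>\<^sup>+x. F i (u, x) \<partial>N u \<partial>count_space D)"
    using seq(3) by (intro nn_integral_monotone_convergence_SUP) (auto simp: incseq_def le_fun_def intro!: nn_integral_mono)
  also have "\<dots> = (SUP i. \<integral>\<^sup>+z. F i z \<partial>dsum D N)" using seq.IH by simp
  also have "\<dots> = (\<integral>\<^sup>+z. (SUP i. F i) z \<partial>dsum D N)"
    using seq(1,3) nn_integral_monotone_convergence_SUP[of F "dsum D N"] by (simp add: image_comp)
  finally show ?case ..
qed

lemma AE_dsum:
  assumes P: "{z \<in> space (dsum D N). \<not> P z} \<in> sets (dsum D N)"
    and ae: "\<And>u. u \<in> D \<Longrightarrow> AE x in N u. P (u, x)"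
  shows "AE z in dsum D N. P z"
proof (rule AE_I[OF subset_refl _ P])
  have "emeasure (N u) (Pair u -` {z \<in> space (dsum D N). \<not> P z}) = 0" if u: "u \<in> D" for u
  proof -
    have "Pair u -` {z \<in> space (dsum D N). \<not> P z} = {x \<in> space (N u). \<not> P (u, x)}"
      using u by (auto simp: space_dsum)
    moreover have "Pair u -` {z \<in> space (dsum D N). \<not> P z} \<in> sets (N u)"
      using P u by (auto simp: sets_dsum)
    ultimately show ?thesis using ae[OF u] by (simp add: AE_iff_measurable)
  qed
  then have "(\<integral>\<^sup>+u. emeasure (N u) (Pair u -` {z \<in> space (dsum D N). \<not> P z}) \<partial>count_space D) =
      (\<integral>\<^sup>+u. 0 \<partial>count_space D)"
    by (intro nn_integral_cong) auto
  then show "emeasure (dsum D N) {z \<in> space (dsum D N). \<not> P z} = 0"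
    unfolding emeasure_dsum[OF P] by simp
qed

section \<open>Ultrafilters and saturation\<close>

text \<open>
  Zorn's lemma for the sets of eventually true predicates, which grow as the filter gets finer.
\<close>

lemma ultrafilter_exists:
  fixes F :: "'a filter"
  assumes "F \<noteq> bot"
  obtains U where "U \<le> F" "U \<noteq> bot" "\<And>P. eventually P U \<or> eventually (\<lambda>x. \<not> P x) U"
proof -
  define X where "X = {S. \<exists>G. S = {P. eventually P G} \<and> G \<noteq> bot \<and> G \<le> F}"
  have "\<exists>S\<in>X. \<forall>T\<in>X. S \<subseteq> T \<longrightarrow> T = S"
  proof (rule subset_Zorn_nonempty)
    show "X \<noteq> {}" using assms by (auto simp: X_def)
  next
    fix C assume "C \<noteq> {}" and ch: "subset.chain X C"
    define Gs where "Gs = {G. {P. eventually P G} \<in> C}"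
    have mem: "\<exists>G\<in>Gs. S = {P. eventually P G}" if "S \<in> C" for S
      using that ch unfolding subset_chain_def X_def Gs_def by blast
    have Gs: "G \<noteq> bot" "G \<le> F" if "G \<in> Gs" for G
    proof -
      have "{P. eventually P G} \<in> X" using that ch by (auto simp: Gs_def subset_chain_def)
      then obtain G' where G': "{P. eventually P G} = {P. eventually P G'}" "G' \<noteq> bot" "G' \<le> F"
        by (auto simp: X_def)
      have "G = G'" using G'(1) by (auto simp: filter_eq_iff set_eq_iff)
      then show "G \<noteq> bot" "G \<le> F" using G' by auto
    qed
    have ne: "Gs \<noteq> {}" using mem \<open>C \<noteq> {}\<close> by blast
    have dir: "\<exists>x\<in>Gs. x \<le> inf a b" if "a \<in> Gs" "b \<in> Gs" for a b
    proof -
      have "{P. eventually P a} \<in> C" "{P. eventually P b} \<in> C" using that by (auto simp: Gs_def)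
      then have "{P. eventually P a} \<subseteq> {P. eventually P b} \<or> {P. eventually P b} \<subseteq> {P. eventually P a}"
        using ch by (meson subset_chain_def)
      then have "b \<le> a \<or> a \<le> b" by (auto simp: le_filter_def)
      with that show ?thesis by auto
    qed
    have ev: "eventually P (Inf Gs) \<longleftrightarrow> (\<exists>G\<in>Gs. eventually P G)" for P
      using eventually_Inf_base[OF ne dir] by auto
    have "\<Union>C = {P. eventually P (Inf Gs)}"
      using mem by (auto simp: ev) (auto simp: Gs_def)
    moreover have "Inf Gs \<noteq> bot" using Gs by (auto simp: trivial_limit_def ev)
    moreover have "Inf Gs \<le> F" using ne Gs by (meson Inf_lower2 equals0I)
    ultimately show "\<Union>C \<in> X" by (auto simp: X_def)
  qed
  then obtain U where U: "U \<noteq> bot" "U \<le> F"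
    and mx: "\<And>G. G \<noteq> bot \<Longrightarrow> G \<le> F \<Longrightarrow> G \<le> U \<Longrightarrow> {P. eventually P G} = {P. eventually P U}"
    by (auto simp: X_def le_filter_def) blast
  have "eventually P U \<or> eventually (\<lambda>x. \<not> P x) U" for P
  proof (rule disjCI)
    assume n: "\<not> eventually (\<lambda>x. \<not> P x) U"
    let ?G = "inf U (principal {x. P x})"
    have "?G \<noteq> bot" using n by (auto simp: trivial_limit_def eventually_inf_principal)
    moreover have "?G \<le> U" by simp
    moreover have "?G \<le> F" using U(2) by (meson inf.coboundedI1)
    moreover have "eventually P ?G" by (simp add: eventually_inf_principal)
    ultimately show "eventually P U" using mx by blast
  qed
  with U that show thesis by blast
qed

text \<open>
  The function \<open>lev\<close> witnesses countable incompleteness: the sets \<open>{j. n \<le> lev j}\<close> belong to the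
  ultrafilter for all \<open>n\<close> and have empty intersection.
\<close>

locale incomplete_ultrafilter =
  fixes U :: "'j filter" and lev :: "'j \<Rightarrow> nat"
  assumes proper: "U \<noteq> bot"
    and ultra: "eventually P U \<or> eventually (\<lambda>j. \<not> P j) U"
    and lev: "filterlim lev at_top U"
begin

lemma eventually_not_iff: "eventually (\<lambda>j. \<not> P j) U \<longleftrightarrow> \<not> eventually P U"
proof
  assume "eventually (\<lambda>j. \<not> P j) U"
  show "\<not> eventually P U"
  proof
    assume "eventually P U"
    with \<open>eventually (\<lambda>j. \<not> P j) U\<close> have "eventually (\<lambda>j. False) U" by eventually_elim auto
    then show False using proper by (simp add: trivial_limit_def)
  qed
qed (use ultra in blast)

lemma eventually_disj: "eventually (\<lambda>j. P j \<or> Q j) U \<longleftrightarrow> eventually P U \<or> eventually Q U"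
proof -
  have "eventually (\<lambda>j. \<not> (P j \<or> Q j)) U \<longleftrightarrow> eventually (\<lambda>j. \<not> P j) U \<and> eventually (\<lambda>j. \<not> Q j) U"
    by (simp add: eventually_conj_iff)
  then show ?thesis unfolding eventually_not_iff by blast
qed

lemma eventually_finite_Bex:
  "finite S \<Longrightarrow> eventually (\<lambda>j. \<exists>k\<in>S. P k j) U \<longleftrightarrow> (\<exists>k\<in>S. eventually (P k) U)"
  by (induction S rule: finite_induct) (auto simp: eventually_disj eventually_False proper)

text \<open>
  An ultrafilter that contains a compact set converges to a point of it.
\<close>

lemma tendsto_Lim_bounded:
  fixes f :: "'j \<Rightarrow> 'b::{heine_borel,real_normed_vector}"
  assumes "eventually (\<lambda>j. norm (f j) \<le> C) U"
  shows "(f \<longlongrightarrow> Lim U f) U"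
proof -
  let ?F = "filtermap f U"
  have "?F \<noteq> bot" using proper by (simp add: filtermap_bot_iff)
  moreover have "eventually (\<lambda>y. y \<in> cball 0 C) ?F" using assms by (simp add: eventually_filtermap)
  ultimately obtain l where l: "inf (nhds l) ?F \<noteq> bot"
    using compact_cball[of "0::'b" C] unfolding compact_filter by blast
  have "(f \<longlongrightarrow> l) U"
    unfolding tendsto_def
  proof (intro allI impI)
    fix S assume S: "open S" "l \<in> S"
    show "eventually (\<lambda>j. f j \<in> S) U"
    proof (rule ccontr)
      assume "\<not> ?thesis"
      then have "eventually (\<lambda>j. f j \<notin> S) U" using ultra by blast
      then have "eventually (\<lambda>y. y \<notin> S) ?F" by (simp add: eventually_filtermap)
      moreover have "eventually (\<lambda>y. y \<in> S) (nhds l)" using S eventually_nhds by blast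
      ultimately have "eventually (\<lambda>y. False) (inf (nhds l) ?F)" by (auto simp: eventually_inf)
      then show False using l by (simp add: trivial_limit_def)
    qed
  qed
  moreover from this have "Lim U f = l" by (rule tendsto_Lim[OF proper])
  ultimately show ?thesis by simp
qed

lemma tendsto_Lim_0_le:
  fixes f :: "'j \<Rightarrow> real"
  assumes "eventually (\<lambda>j. 0 \<le> f j \<and> f j \<le> C) U"
  shows "(f \<longlongrightarrow> Lim U f) U"
  by (rule tendsto_Lim_bounded[where C=C]) (use assms in \<open>auto elim: eventually_mono\<close>)

text \<open>
  Saturation. The witness \<open>m j\<close> is the largest \<open>n \<le> lev j\<close> such that \<open>P n j\<close>. It tends to infinity
  since, for each \<open>n\<close>, both \<open>P n j\<close> and \<open>n \<le> lev j\<close> hold eventually.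
\<close>

lemma diagonal:
  assumes "\<And>n. eventually (P n) U"
  obtains m :: "'j \<Rightarrow> nat" where "filterlim m at_top U" "eventually (\<lambda>j. P (m j) j) U"
proof -
  define S where "S j = {n. n \<le> lev j \<and> (n = 0 \<or> P n j)}" for j
  define m where "m j = Max (S j)" for j
  have S: "finite (S j)" "S j \<noteq> {}" for j
    by (auto simp: S_def intro: finite_subset[of _ "{..lev j}"])
  have mS: "m j \<in> S j" for j unfolding m_def using S by (rule Max_in)
  have "eventually (\<lambda>j. n \<le> m j) U" for n
  proof -
    have "eventually (\<lambda>j. n \<le> lev j) U" using lev by (simp add: filterlim_at_top)
    with assms[of n] show ?thesis
    proof eventually_elim
      case (elim j)
      then have "n \<in> S j" by (auto simp: S_def)
      then show ?case unfolding m_def using S by simp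
    qed
  qed
  then have "filterlim m at_top U" by (simp add: filterlim_at_top)
  moreover have "eventually (\<lambda>j. P (m j) j) U"
    using assms[of 0] by eventually_elim (use mS in \<open>auto simp: S_def\<close>, metis)
  ultimately show thesis using that by blast
qed

end

section \<open>Loeb measures\<close>

text \<open>
  A partition of the space into sets on which \<open>g\<close> varies by at most \<open>d\<close> determines the integral of
  \<open>g\<close> up to \<open>d\<close> times the total mass. This is used both for the members of a family of measures and
  for the Loeb measure, with corresponding partitions.
\<close>

lemma finite_measure_step_bounds:
  fixes g :: "'b \<Rightarrow> real"
  assumes "finite_measure Q" and g: "g \<in> borel_measurable Q"
    and B: "\<And>k. k \<le> m \<Longrightarrow> B k \<in> sets Q" "disjoint_family_on B {..m}" "(\<Union>k\<le>m. B k) = space Q"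
    and bd: "\<And>k x. k \<le> m \<Longrightarrow> x \<in> B k \<Longrightarrow> d * real k \<le> g x \<and> g x \<le> d * real (Suc k)"
    and d: "0 < d"
  shows "(\<Sum>k\<le>m. d * real k * measure Q (B k)) \<le> integral\<^sup>L Q g"
    "integral\<^sup>L Q g \<le> (\<Sum>k\<le>m. d * real k * measure Q (B k)) + d * measure Q (space Q)"
    "integrable Q g"
proof -
  interpret finite_measure Q by fact
  have ind: "g x * indicator (B k) x = g x * indicat_real (B k) x" for x k by simp
  have sp: "\<exists>k\<le>m. x \<in> B k" if "x \<in> space Q" for x using that B(3) by blast
  have int: "integrable Q g"
  proof (rule integrable_const_bound[where B="d * real (Suc m)"])
    show "AE x in Q. norm (g x) \<le> d * real (Suc m)"
    proof (rule AE_I2)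
      fix x assume "x \<in> space Q"
      then obtain k where k: "k \<le> m" "x \<in> B k" using sp by blast
      have "0 \<le> d * real k" "d * real (Suc k) \<le> d * real (Suc m)" using d k(1) by auto
      with bd[OF k] show "norm (g x) \<le> d * real (Suc m)" by simp
    qed
  qed fact
  then show "integrable Q g" .
  have split: "(\<Sum>k\<le>m. c k * indicat_real (B k) x) = c k" if "k \<le> m" "x \<in> B k" for c k x
  proof -
    have "(\<Sum>i\<le>m. c i * indicat_real (B i) x) = (\<Sum>i\<le>m. if i = k then c k else 0)"
      using B(2) that by (intro sum.cong) (auto simp: disjoint_family_on_def indicator_def)
    then show ?thesis using that by simp
  qed
  have i0: "integrable Q (indicat_real (B k))" if "k \<le> m" for k
    using B(1)[OF that] by (simp add: less_top[symmetric])
  have i1: "integrable Q (\<lambda>x. \<Sum>k\<le>m. c k * indicat_real (B k) x)" for c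
    by (intro Bochner_Integration.integrable_sum integrable_mult_right i0) (simp only: atMost_iff)
  have v: "integral\<^sup>L Q (\<lambda>x. \<Sum>k\<le>m. c k * indicat_real (B k) x) = (\<Sum>k\<le>m. c k * measure Q (B k))" for c
  proof -
    have "integral\<^sup>L Q (\<lambda>x. \<Sum>k\<le>m. c k * indicat_real (B k) x)
       = (\<Sum>k\<le>m. integral\<^sup>L Q (\<lambda>x. c k * indicat_real (B k) x))"
      by (intro Bochner_Integration.integral_sum integrable_mult_right i0) (simp only: atMost_iff)
    also have "\<dots> = (\<Sum>k\<le>m. c k * measure Q (B k))"
    proof (intro sum.cong refl)
      fix k assume "k \<in> {..m}"
      then have "B k \<in> sets Q" using B(1) by simp
      then have "integral\<^sup>L Q (indicat_real (B k)) = measure Q (B k)"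
        by (simp add: Int_absorb2 sets.sets_into_space)
      then show "integral\<^sup>L Q (\<lambda>x. c k * indicat_real (B k) x) = c k * measure Q (B k)"
        by (simp only: integral_mult_right_zero)
    qed
    finally show ?thesis .
  qed
  have tot: "measure Q (space Q) = (\<Sum>k\<le>m. measure Q (B k))"
    using B by (subst B(3)[symmetric], subst finite_measure_finite_Union) auto
  have "integral\<^sup>L Q (\<lambda>x. \<Sum>k\<le>m. (d * real k) * indicat_real (B k) x) \<le> integral\<^sup>L Q g"
    by (intro integral_mono i1 int) (use sp split bd in fastforce)
  then show "(\<Sum>k\<le>m. d * real k * measure Q (B k)) \<le> integral\<^sup>L Q g" by (simp only: v)
  have "integral\<^sup>L Q g \<le> integral\<^sup>L Q (\<lambda>x. \<Sum>k\<le>m. (d * real (Suc k)) * indicat_real (B k) x)"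
  proof (intro integral_mono i1 int)
    fix x assume "x \<in> space Q"
    then obtain k where k: "k \<le> m" "x \<in> B k" using sp by blast
    show "g x \<le> (\<Sum>k\<le>m. (d * real (Suc k)) * indicat_real (B k) x)"
      unfolding split[OF k, of "\<lambda>k. d * real (Suc k)"] using bd[OF k] by simp
  qed
  also have "\<dots> = (\<Sum>k\<le>m. d * real k * measure Q (B k)) + d * measure Q (space Q)"
    unfolding v tot by (simp add: sum_distrib_left flip: sum.distrib) (simp add: algebra_simps)
  finally show "integral\<^sup>L Q g \<le> (\<Sum>k\<le>m. d * real k * measure Q (B k)) + d * measure Q (space Q)" .
qed

locale loeb_space = incomplete_ultrafilter U lev for U :: "'j filter" and lev :: "'j \<Rightarrow> nat" +
  fixes M :: "'j \<Rightarrow> 'x measure"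
begin

text \<open>
  The internal set with components \<open>B j\<close>. The points are families and not classes of families modulo
  the ultrafilter; internal sets do not distinguish families that agree eventually.
\<close>

definition internal :: "('j \<Rightarrow> 'x set) \<Rightarrow> ('j \<Rightarrow> 'x) set" where
  "internal B = {x. eventually (\<lambda>j. x j \<in> B j) U}"

definition points :: "('j \<Rightarrow> 'x) set" where
  "points = internal (\<lambda>j. space (M j))"

definition internal_sets :: "('j \<Rightarrow> 'x) set set" where
  "internal_sets = internal ` {B. \<forall>j. B j \<in> sets (M j)}"

lemma internal_Int: "internal B \<inter> internal C = internal (\<lambda>j. B j \<inter> C j)"
  by (auto simp: internal_def eventually_conj_iff)

lemma internal_Un: "internal B \<union> internal C = internal (\<lambda>j. B j \<union> C j)"
  by (auto simp: internal_def eventually_disj)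

lemma internal_Diff: "internal B - internal C = internal (\<lambda>j. B j - C j)"
  by (auto simp: internal_def eventually_conj_iff eventually_not_iff)

text \<open>
  If eventually \<open>B j\<close> is not contained in \<open>C j\<close>, a choice of points in the differences is a point of
  the difference of the internal sets.
\<close>

lemma internal_subset_iff: "internal B \<subseteq> internal C \<longleftrightarrow> eventually (\<lambda>j. B j \<subseteq> C j) U"
proof
  assume sub: "internal B \<subseteq> internal C"
  show "eventually (\<lambda>j. B j \<subseteq> C j) U"
  proof (rule ccontr)
    assume "\<not> ?thesis"
    then have ev: "eventually (\<lambda>j. \<not> B j \<subseteq> C j) U" by (simp add: eventually_not_iff)
    define x where "x j = (SOME y. y \<in> B j - C j)" for j
    have "x j \<in> B j - C j" if "\<not> B j \<subseteq> C j" for j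
      unfolding x_def by (rule someI_ex) (use that in auto)
    with ev have "eventually (\<lambda>j. x j \<in> B j - C j) U" by (rule eventually_mono) auto
    then have "x \<in> internal B - internal C" unfolding internal_Diff by (simp add: internal_def)
    with sub show False by blast
  qed
next
  assume "eventually (\<lambda>j. B j \<subseteq> C j) U"
  then show "internal B \<subseteq> internal C"
    unfolding internal_def by (auto elim: eventually_elim2)
qed

lemma internal_eq_iff: "internal B = internal C \<longleftrightarrow> eventually (\<lambda>j. B j = C j) U"
  unfolding set_eq_subset[of "internal B"] internal_subset_iff
  by (simp add: eventually_conj_iff[symmetric] set_eq_subset[symmetric])

lemma internal_empty: "internal (\<lambda>j. {}) = {}"
  by (simp add: internal_def proper eventually_False)

lemma internal_setsI: "(\<And>j. B j \<in> sets (M j)) \<Longrightarrow> internal B \<in> internal_sets"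
  by (auto simp: internal_sets_def)

lemma internal_subset_points: "(\<And>j. B j \<in> sets (M j)) \<Longrightarrow> internal B \<subseteq> points"
  unfolding points_def internal_subset_iff by (simp add: sets.sets_into_space)

lemma internal_sets_into_points: "internal_sets \<subseteq> Pow points"
  using internal_subset_points by (auto simp: internal_sets_def)

lemma algebra_internal_sets: "Sigma_Algebra.algebra points internal_sets"
  unfolding algebra_iff_Int
proof (intro conjI ballI)
  show "internal_sets \<subseteq> Pow points" by (rule internal_sets_into_points)
  show "{} \<in> internal_sets" using internal_setsI[of "\<lambda>_. {}"] internal_empty by auto
next
  fix a assume "a \<in> internal_sets"
  then show "points - a \<in> internal_sets"
    by (auto simp: internal_sets_def points_def internal_Diff)
next
  fix a b assume "a \<in> internal_sets" "b \<in> internal_sets"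
  then show "a \<inter> b \<in> internal_sets"
    by (auto simp: internal_sets_def internal_Int)
qed

lemma Int_stable_internal_sets: "Int_stable internal_sets"
  using algebra_internal_sets unfolding algebra_iff_Int Int_stable_def by blast

text \<open>
  Countable compactness of internal sets. If no set is empty, then for each \<open>n\<close> eventually \<open>B n j\<close> is
  a nonempty subset of \<open>B k j\<close> for all \<open>k \<le> n\<close>; saturation allows \<open>n = m j\<close> to tend to infinity, and
  points of \<open>B (m j) j\<close> form a point of the intersection.
\<close>

lemma decseq_internal_empty:
  assumes dec: "decseq (\<lambda>n. internal (B n))" and emp: "(\<Inter>n. internal (B n)) = {}"
  shows "\<exists>n. internal (B n) = {}"
proof (rule ccontr)
  assume "\<not> ?thesis"
  then have ne: "eventually (\<lambda>j. B n j \<noteq> {}) U" for n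
    using internal_eq_iff[of "B n" "\<lambda>j. {}"] by (simp add: internal_empty eventually_not_iff)
  have sub: "eventually (\<lambda>j. B n j \<subseteq> B k j) U" if "k \<le> n" for k n
    using decseqD[OF dec that] by (simp add: internal_subset_iff)
  have "eventually (\<lambda>j. \<forall>k\<in>{..n}. B n j \<subseteq> B k j) U" for n
    using sub by (subst eventually_ball_finite_distrib) auto
  with ne have "eventually (\<lambda>j. B n j \<noteq> {} \<and> (\<forall>k\<in>{..n}. B n j \<subseteq> B k j)) U" for n
    by (simp add: eventually_conj_iff)
  then obtain m where m: "filterlim m at_top U"
    "eventually (\<lambda>j. B (m j) j \<noteq> {} \<and> (\<forall>k\<in>{..m j}. B (m j) j \<subseteq> B k j)) U"
    using diagonal[where P="\<lambda>n j. B n j \<noteq> {} \<and> (\<forall>k\<in>{..n}. B n j \<subseteq> B k j)"] by blast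
  define x where "x j = (SOME y. y \<in> B (m j) j)" for j
  have "x \<in> internal (B n)" for n
  proof -
    have "eventually (\<lambda>j. n \<le> m j) U" using m(1) by (simp add: filterlim_at_top)
    with m(2) have "eventually (\<lambda>j. x j \<in> B n j) U"
    proof eventually_elim
      case (elim j)
      then have "x j \<in> B (m j) j" unfolding x_def by (auto intro: someI)
      with elim show ?case by blast
    qed
    then show ?thesis by (simp add: internal_def)
  qed
  with emp show False by blast
qed

definition bounded_family :: "('j \<Rightarrow> 'x measure) \<Rightarrow> bool" where
  "bounded_family K \<longleftrightarrow> (\<forall>j. finite_measure (K j) \<and> sets (K j) = sets (M j)) \<and>
     (\<exists>C. eventually (\<lambda>j. measure (K j) (space (M j)) \<le> C) U)"

text \<open>
  The components of an internal set are only determined eventually. The content below does not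
  depend on the choice made here.
\<close>

definition rep :: "('j \<Rightarrow> 'x) set \<Rightarrow> 'j \<Rightarrow> 'x set" where
  "rep S = (SOME B. (\<forall>j. B j \<in> sets (M j)) \<and> internal B = S)"

definition content :: "('j \<Rightarrow> 'x measure) \<Rightarrow> ('j \<Rightarrow> 'x) set \<Rightarrow> ennreal" where
  "content K S = ennreal (Lim U (\<lambda>j. measure (K j) (rep S j)))"

definition loeb :: "('j \<Rightarrow> 'x measure) \<Rightarrow> ('j \<Rightarrow> 'x) measure" where
  "loeb K = measure_of points internal_sets
     (SOME \<mu>. (\<forall>S\<in>internal_sets. \<mu> S = content K S) \<and>
        measure_space points (sigma_sets points internal_sets) \<mu>)"

lemma space_loeb [simp]: "space (loeb K) = points"
  unfolding loeb_def using internal_sets_into_points by (simp add: space_measure_of_conv)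

lemma sets_loeb: "sets (loeb K) = sigma_sets points internal_sets"
  unfolding loeb_def using internal_sets_into_points by simp

lemma internal_in_sets_loeb: "(\<And>j. B j \<in> sets (M j)) \<Longrightarrow> internal B \<in> sets (loeb K)"
  unfolding sets_loeb by (intro sigma_sets.Basic internal_setsI)

lemma tendsto_measure:
  assumes K: "bounded_family K"
  shows "((\<lambda>j. measure (K j) (B j)) \<longlongrightarrow> Lim U (\<lambda>j. measure (K j) (B j))) U"
proof -
  obtain C where C: "eventually (\<lambda>j. measure (K j) (space (M j)) \<le> C) U"
    using K by (auto simp: bounded_family_def)
  have le: "measure (K j) (B j) \<le> measure (K j) (space (M j))" for j
    using K sets_eq_imp_space_eq[of "K j" "M j"] finite_measure.bounded_measure[of "K j" "B j"]
    by (auto simp: bounded_family_def)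
  show ?thesis
    by (rule tendsto_Lim_0_le[where C=C]) (use C in \<open>eventually_elim, use le order_trans in auto\<close>)
qed

lemma content_internal:
  assumes B: "\<And>j. B j \<in> sets (M j)" and K: "bounded_family K"
  shows "content K (internal B) = ennreal (Lim U (\<lambda>j. measure (K j) (B j)))"
proof -
  have "\<exists>C. (\<forall>j. C j \<in> sets (M j)) \<and> internal C = internal B" using B by blast
  from someI_ex[OF this] have "internal (rep (internal B)) = internal B"
    unfolding rep_def by blast
  then have "eventually (\<lambda>j. rep (internal B) j = B j) U" by (simp add: internal_eq_iff)
  then have "eventually (\<lambda>j. measure (K j) (B j) = measure (K j) (rep (internal B) j)) U"
    by eventually_elim simp
  then have "((\<lambda>j. measure (K j) (rep (internal B) j)) \<longlongrightarrow> Lim U (\<lambda>j. measure (K j) (B j))) U"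
    using tendsto_measure[OF K, of B] by (rule Lim_transform_eventually[rotated])
  then show ?thesis unfolding content_def by (simp add: tendsto_Lim[OF proper])
qed

text \<open>
  Finite additivity passes to the limit, and continuity at the empty set is trivial because a
  decreasing sequence of internal sets with empty intersection becomes empty. Hence Caratheodory's
  theorem applies.
\<close>

lemma emeasure_loeb:
  assumes B: "\<And>j. B j \<in> sets (M j)" and K: "bounded_family K"
  shows "emeasure (loeb K) (internal B) = ennreal (Lim U (\<lambda>j. measure (K j) (B j)))"
proof -
  interpret Sigma_Algebra.algebra points internal_sets by (rule algebra_internal_sets)
  have fin: "finite_measure (K j)" and sets: "sets (K j) = sets (M j)" for j
    using K by (auto simp: bounded_family_def)
  have ex: "\<exists>\<mu>. (\<forall>S\<in>internal_sets. \<mu> S = content K S) \<and>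
      measure_space points (sigma_sets points internal_sets) \<mu>"
  proof (rule caratheodory_empty_continuous)
    show "positive internal_sets (content K)"
      using content_internal[OF _ K, of "\<lambda>_. {}"] tendsto_Lim[OF proper tendsto_const[of "0::real"]]
      by (simp add: positive_def internal_empty)
    show "additive internal_sets (content K)"
      unfolding additive_def
    proof (intro ballI impI)
      fix S T assume "S \<in> internal_sets" "T \<in> internal_sets" and disj: "S \<inter> T = {}"
      then obtain B C where B: "\<And>j. B j \<in> sets (M j)" "S = internal B"
        and C: "\<And>j. C j \<in> sets (M j)" "T = internal C" by (auto simp: internal_sets_def)
      have "eventually (\<lambda>j. B j \<inter> C j = {}) U"
        using disj unfolding B C internal_Int internal_empty[symmetric] internal_eq_iff .
      then have "eventually (\<lambda>j. measure (K j) (B j) + measure (K j) (C j) = measure (K j) (B j \<union> C j)) U"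
        by eventually_elim (use B(1) C(1) in \<open>auto simp: finite_measure.finite_measure_Union[OF fin] sets\<close>)
      then have "((\<lambda>j. measure (K j) (B j \<union> C j)) \<longlongrightarrow>
          Lim U (\<lambda>j. measure (K j) (B j)) + Lim U (\<lambda>j. measure (K j) (C j))) U"
        using tendsto_add[OF tendsto_measure[OF K, of B] tendsto_measure[OF K, of C]]
        by (rule Lim_transform_eventually[rotated])
      then have "Lim U (\<lambda>j. measure (K j) (B j \<union> C j)) =
          Lim U (\<lambda>j. measure (K j) (B j)) + Lim U (\<lambda>j. measure (K j) (C j))"
        by (rule tendsto_Lim[OF proper])
      moreover have "0 \<le> Lim U (\<lambda>j. measure (K j) (X j))" for X
        by (rule tendsto_lowerbound[OF tendsto_measure[OF K] _ proper]) simp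
      ultimately show "content K (S \<union> T) = content K S + content K T"
        unfolding B C internal_Un using B(1) C(1) K by (simp add: content_internal)
    qed
    show "content K A \<noteq> \<infinity>" for A by (simp add: content_def)
  next
    fix A :: "nat \<Rightarrow> _" assume A: "range A \<subseteq> internal_sets" "decseq A" "(\<Inter>i. A i) = {}"
    have "\<forall>n. \<exists>B. (\<forall>j. B j \<in> sets (M j)) \<and> A n = internal B"
    proof
      fix n
      have "A n \<in> internal_sets" using A(1) by auto
      then show "\<exists>B. (\<forall>j. B j \<in> sets (M j)) \<and> A n = internal B"
        unfolding internal_sets_def by auto
    qed
    then obtain B where B: "\<And>n. A n = internal (B n)" by metis
    obtain n where n: "A n = {}" using decseq_internal_empty[of B] A(2,3)
      unfolding B[symmetric] by blast
    have "A i = {}" if "n \<le> i" for i using decseqD[OF A(2) that] n by simp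
    moreover have "content K {} = 0"
      using content_internal[OF _ K, of "\<lambda>_. {}"] tendsto_Lim[OF proper tendsto_const[of "0::real"]]
      by (simp add: internal_empty)
    ultimately have "eventually (\<lambda>i. content K (A i) = 0) sequentially"
      by (auto simp: eventually_sequentially intro!: exI[of _ n])
    then show "(\<lambda>i. content K (A i)) \<longlonglongrightarrow> 0" by (rule tendsto_eventually)
  qed
  define \<mu> where "\<mu> = (SOME \<mu>. (\<forall>S\<in>internal_sets. \<mu> S = content K S) \<and>
        measure_space points (sigma_sets points internal_sets) \<mu>)"
  have \<mu>: "\<forall>S\<in>internal_sets. \<mu> S = content K S" "measure_space points (sigma_sets points internal_sets) \<mu>"
    using someI_ex[OF ex] unfolding \<mu>_def by blast+
  have "emeasure (loeb K) (internal B) = \<mu> (internal B)"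
    unfolding loeb_def \<mu>_def[symmetric]
  proof (rule emeasure_measure_of[OF refl internal_sets_into_points])
    show "positive (sets (measure_of points internal_sets \<mu>)) \<mu>"
      "countably_additive (sets (measure_of points internal_sets \<mu>)) \<mu>"
      using \<mu>(2) internal_sets_into_points by (auto simp: measure_space_def)
    show "internal B \<in> sets (measure_of points internal_sets \<mu>)"
      using internal_sets_into_points internal_setsI[of B] B by auto
  qed
  then show ?thesis using \<mu>(1) internal_setsI[of B] B content_internal[of B, OF _ K] by auto
qed

lemma finite_measure_loeb:
  assumes "bounded_family K"
  shows "finite_measure (loeb K)"
proof (rule finite_measureI)
  have "emeasure (loeb K) (internal (\<lambda>j. space (M j))) \<noteq> \<infinity>"
    by (subst emeasure_loeb) (use assms in auto)
  then show "emeasure (loeb K) (space (loeb K)) \<noteq> \<infinity>" by (simp add: points_def)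
qed

lemma measure_loeb:
  assumes B: "\<And>j. B j \<in> sets (M j)" and K: "bounded_family K"
  shows "measure (loeb K) (internal B) = Lim U (\<lambda>j. measure (K j) (B j))"
proof -
  have "0 \<le> Lim U (\<lambda>j. measure (K j) (B j))"
    by (rule tendsto_lowerbound[OF tendsto_measure[OF K] _ proper]) simp
  then show ?thesis unfolding measure_def emeasure_loeb[of B, OF assms] by simp
qed

text \<open>
  The limit is at most \<open>c\<close> iff eventually \<open>h j (x j) \<le> c + 1 / (n + 1)\<close>, for every \<open>n\<close>; each of these
  conditions defines an internal set.
\<close>

lemma borel_measurable_Lim_real:
  fixes h :: "'j \<Rightarrow> 'x \<Rightarrow> real"
  assumes h: "\<And>j. h j \<in> borel_measurable (M j)"
    and N: "sets N = sigma_sets points internal_sets"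
    and W: "W \<in> sets N"
    and fin: "\<And>x. x \<in> W \<Longrightarrow> \<exists>C. eventually (\<lambda>j. norm (h j (x j)) \<le> C) U"
  shows "(\<lambda>x. if x \<in> W then Lim U (\<lambda>j. h j (x j)) else 0) \<in> borel_measurable N"
proof (rule borel_measurableI_le)
  fix c :: real
  have "sets N = sets (sigma points internal_sets)"
    using N internal_sets_into_points by simp
  then have spN: "space N = points"
    using internal_sets_into_points by (drule_tac sets_eq_imp_space_eq) (simp add: space_measure_of_conv)
  define D where "D n = internal (\<lambda>j. {y \<in> space (M j). h j y \<le> c + 1 / real (Suc n)})" for n
  have D: "D n \<in> sets N" for n
    unfolding D_def N using h by (intro sigma_sets.Basic internal_setsI) measurable
  have "Lim U (\<lambda>j. h j (x j)) \<le> c \<longleftrightarrow> (\<forall>n. x \<in> D n)" if x: "x \<in> W" for x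
  proof -
    obtain C where "eventually (\<lambda>j. norm (h j (x j)) \<le> C) U" using fin[OF x] by blast
    then have lim: "((\<lambda>j. h j (x j)) \<longlongrightarrow> Lim U (\<lambda>j. h j (x j))) U" by (rule tendsto_Lim_bounded)
    have xs: "eventually (\<lambda>j. x j \<in> space (M j)) U"
      using x sets.sets_into_space[OF W] spN by (auto simp: points_def internal_def)
    have Dx: "x \<in> D n \<longleftrightarrow> eventually (\<lambda>j. h j (x j) \<le> c + 1 / real (Suc n)) U" for n
      using xs by (simp add: D_def internal_def eventually_conj_iff)
    show ?thesis
    proof
      assume le: "Lim U (\<lambda>j. h j (x j)) \<le> c"
      show "\<forall>n. x \<in> D n"
      proof
        fix n
        have "Lim U (\<lambda>j. h j (x j)) < c + 1 / real (Suc n)" using le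
          by (smt (verit) of_nat_0_less_iff zero_less_Suc zero_less_divide_1_iff)
        from order_tendstoD(2)[OF lim this] show "x \<in> D n" unfolding Dx
          by eventually_elim simp
      qed
    next
      assume "\<forall>n. x \<in> D n"
      then have "Lim U (\<lambda>j. h j (x j)) \<le> c + 1 / real (Suc n)" for n
        by (intro tendsto_upperbound[OF lim _ proper]) (simp add: Dx)
      then have "Lim U (\<lambda>j. h j (x j)) - c \<le> 1 / real (Suc n)" for n by (simp add: algebra_simps)
      then have "Lim U (\<lambda>j. h j (x j)) - c \<le> 0"
        by (intro LIMSEQ_le_const[OF LIMSEQ_Suc[OF lim_1_over_n]]) auto
      then show "Lim U (\<lambda>j. h j (x j)) \<le> c" by simp
    qed
  qed
  then have "{x \<in> space N. (if x \<in> W then Lim U (\<lambda>j. h j (x j)) else 0) \<le> c} =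
     (W \<inter> (\<Inter>n. D n)) \<union> (if 0 \<le> c then space N - W else {})"
    using sets.sets_into_space[OF W] by auto
  also have "\<dots> \<in> sets N" using D W by auto
  finally show "{x \<in> space N. (if x \<in> W then Lim U (\<lambda>j. h j (x j)) else 0) \<le> c} \<in> sets N" .
qed

text \<open>
  For bounded integrands integration commutes with the limit along the ultrafilter: the level sets
  of \<open>h j\<close> for a grid of mesh \<open>d\<close> form internal sets which partition the Loeb space, and the step
  bounds on both sides have the same limit.
\<close>

lemma integral_loeb:
  fixes h :: "'j \<Rightarrow> 'x \<Rightarrow> real"
  assumes K: "bounded_family K"
    and h: "\<And>j. h j \<in> borel_measurable (M j)"
    and bd: "\<And>j x. x \<in> space (M j) \<Longrightarrow> 0 \<le> h j x \<and> h j x \<le> C"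
  defines "g \<equiv> \<lambda>x. if x \<in> points then Lim U (\<lambda>j. h j (x j)) else 0"
  shows "integrable (loeb K) g"
    and "((\<lambda>j. integral\<^sup>L (K j) (h j)) \<longlongrightarrow> integral\<^sup>L (loeb K) g) U"
proof -
  define S where "S = measure (loeb K) points"
  have fin: "finite_measure (K j)" and setsK [measurable_cong]: "sets (K j) = sets (M j)" for j
    using K by (auto simp: bounded_family_def)
  have spK: "space (K j) = space (M j)" for j using setsK by (rule sets_eq_imp_space_eq)
  have hb: "\<exists>C. eventually (\<lambda>j. norm (h j (x j)) \<le> C) U" if "x \<in> points" for x
    using that unfolding points_def internal_def mem_Collect_eq
    by (intro exI[of _ C]) (auto elim!: eventually_mono dest: bd)
  have ptsL: "points \<in> sets (loeb K)" using sets.top[of "loeb K"] by simp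
  have gm: "g \<in> borel_measurable (loeb K)"
    unfolding g_def by (rule borel_measurable_Lim_real[OF h sets_loeb ptsL hb])
  have lim: "((\<lambda>j. h j (x j)) \<longlongrightarrow> g x) U" if "x \<in> points" for x
    using hb[OF that] that tendsto_Lim_bounded[of "\<lambda>j. h j (x j)"] by (auto simp: g_def)
  have main: "integrable (loeb K) g \<and> (\<forall>e>0. eventually (\<lambda>j. \<bar>integral\<^sup>L (K j) (h j) - integral\<^sup>L (loeb K) g\<bar> \<le> d * (S + 1) * 3 + e) U)"
    if d: "0 < d" for d :: real
  proof -
    \<comment> \<open>The largest index of a grid interval that \<open>h\<close> can meet.\<close>
    define m where "m = nat \<lfloor>\<bar>C\<bar> / d\<rfloor>"
    define B where "B k j = {y \<in> space (M j). d * real k \<le> h j y \<and> h j y < d * real (Suc k)}" for k j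
    have BM: "B k j \<in> sets (M j)" for k j unfolding B_def using h by measurable
    have disj: "B k j \<inter> B l j = {}" if "k \<noteq> l" for k l j
    proof -
      have False if "k < l" "d * real l \<le> t" "t < d * real (Suc k)" for k l t
      proof -
        have "d * real (Suc k) \<le> d * real l" using that d by (intro mult_left_mono) auto
        with that show False by simp
      qed
      then show ?thesis using \<open>k \<noteq> l\<close> by (auto simp: B_def) (metis linorder_neqE_nat of_nat_Suc)
    qed
    have cov: "\<exists>k\<le>m. y \<in> B k j" if y: "y \<in> space (M j)" for y j
    proof -
      define k where "k = nat \<lfloor>h j y / d\<rfloor>"
      have h0: "0 \<le> h j y" "h j y \<le> C" using bd[OF y] by auto
      have q: "0 \<le> h j y / d" using h0 d by simp
      have "h j y / d \<le> \<bar>C\<bar> / d" using h0 d by (intro divide_right_mono) auto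
      then have "k \<le> m" unfolding k_def m_def by (intro nat_mono floor_mono)
      moreover have "real k \<le> h j y / d" "h j y / d < real (Suc k)"
        unfolding k_def using q by (simp_all add: of_nat_nat) linarith+
      then have "y \<in> B k j" unfolding B_def using y d
        by (auto simp: field_simps)
      ultimately show ?thesis by blast
    qed
    have K1: "(\<Sum>k\<le>m. d * real k * measure (K j) (B k j)) \<le> integral\<^sup>L (K j) (h j)"
        "integral\<^sup>L (K j) (h j) \<le> (\<Sum>k\<le>m. d * real k * measure (K j) (B k j)) + d * measure (K j) (space (K j))" for j
    proof -
      have a: "h j \<in> borel_measurable (K j)" using h by measurable
      have b: "disjoint_family_on (\<lambda>k. B k j) {..m}" using disj by (auto simp: disjoint_family_on_def)
      have c: "(\<Union>k\<le>m. B k j) = space (K j)" using cov unfolding spK by (auto simp: B_def)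
      note * = finite_measure_step_bounds[OF fin a _ b c _ d]
      show "(\<Sum>k\<le>m. d * real k * measure (K j) (B k j)) \<le> integral\<^sup>L (K j) (h j)"
        by (rule *(1)) (auto simp: BM setsK, auto simp: B_def)
      show "integral\<^sup>L (K j) (h j) \<le> (\<Sum>k\<le>m. d * real k * measure (K j) (B k j)) + d * measure (K j) (space (K j))"
        by (rule *(2)) (auto simp: BM setsK, auto simp: B_def)
    qed
    have Bp: "internal (B k) \<subseteq> points" for k by (rule internal_subset_points) (rule BM)
    have covL: "(\<Union>k\<le>m. internal (B k)) = points"
    proof (intro equalityI subsetI)
      fix x assume "x \<in> (\<Union>k\<le>m. internal (B k))"
      then show "x \<in> points" using Bp by blast
    next
      fix x assume "x \<in> points"
      then have "eventually (\<lambda>j. \<exists>k\<in>{..m}. x j \<in> B k j) U"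
        unfolding points_def internal_def by (auto elim!: eventually_mono dest: cov)
      then show "x \<in> (\<Union>k\<le>m. internal (B k))"
        by (subst (asm) eventually_finite_Bex) (auto simp: internal_def)
    qed
    have disjL: "disjoint_family_on (\<lambda>k. internal (B k)) {..m}"
      by (auto simp: disjoint_family_on_def internal_Int disj internal_empty)
    have bdL: "d * real k \<le> g x \<and> g x \<le> d * real (Suc k)" if x: "x \<in> internal (B k)" for k x
    proof -
      have xp: "x \<in> points" using x Bp by blast
      show ?thesis
        using x unfolding internal_def B_def
        by (auto intro!: tendsto_lowerbound[OF lim[OF xp] _ proper] tendsto_upperbound[OF lim[OF xp] _ proper] elim!: eventually_mono)
    qed
    have L1: "(\<Sum>k\<le>m. d * real k * measure (loeb K) (internal (B k))) \<le> integral\<^sup>L (loeb K) g"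
        "integral\<^sup>L (loeb K) g \<le> (\<Sum>k\<le>m. d * real k * measure (loeb K) (internal (B k))) + d * S"
        "integrable (loeb K) g"
      unfolding S_def using finite_measure_step_bounds[OF finite_measure_loeb[OF K] gm _ disjL _ bdL d] covL
        internal_in_sets_loeb[OF BM] by auto
    have tB: "((\<lambda>j. measure (K j) (B k j)) \<longlongrightarrow> measure (loeb K) (internal (B k))) U" for k
      using tendsto_measure[OF K, of "B k"] measure_loeb[of "B k", OF BM K] by simp
    have tS: "((\<lambda>j. measure (K j) (space (K j))) \<longlongrightarrow> S) U"
      unfolding S_def points_def spK using tendsto_measure[OF K] measure_loeb[OF sets.top K] by metis
    have t2: "((\<lambda>j. \<Sum>k\<le>m. d * real k * measure (K j) (B k j)) \<longlongrightarrow> (\<Sum>k\<le>m. d * real k * measure (loeb K) (internal (B k)))) U"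
      by (intro tendsto_intros tB)
    have S0: "0 \<le> S" by (simp add: S_def)
    have "eventually (\<lambda>j. \<bar>integral\<^sup>L (K j) (h j) - integral\<^sup>L (loeb K) g\<bar> \<le> d * (S + 1) * 3 + e) U" if e: "0 < e" for e
    proof -
      have "eventually (\<lambda>j. dist (\<Sum>k\<le>m. d * real k * measure (K j) (B k j)) (\<Sum>k\<le>m. d * real k * measure (loeb K) (internal (B k))) < e) U"
        using tendstoD[OF t2 e] .
      moreover have "eventually (\<lambda>j. dist (measure (K j) (space (K j))) S < 1) U"
        using tendstoD[OF tS] by simp
      ultimately show ?thesis
      proof eventually_elim
        case (elim j)
        have "d * measure (K j) (space (K j)) \<le> d * (S + 1)"
          using elim(2) d by (intro mult_left_mono) (auto simp: dist_real_def)
        moreover have "d * S \<le> d * (S + 1)" "0 \<le> d * S" using d S0 by auto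
        ultimately show ?case using elim(1) K1[of j] L1 by (auto simp: dist_real_def)
      qed
    qed
    then show ?thesis using L1(3) by blast
  qed
  show "integrable (loeb K) g" using main[of 1] by simp
  show "((\<lambda>j. integral\<^sup>L (K j) (h j)) \<longlongrightarrow> integral\<^sup>L (loeb K) g) U"
  proof (rule tendstoI)
    fix e :: real assume e: "0 < e"
    define d where "d = e / (12 * (S + 1))"
    have S0: "0 \<le> S" by (simp add: S_def)
    have d: "0 < d" using e S0 by (simp add: d_def)
    have "d * (S + 1) * 3 = e / 4" using S0 by (simp add: d_def field_simps)
    then have "d * (S + 1) * 3 + e / 4 < e" using e by simp
    moreover have "eventually (\<lambda>j. \<bar>integral\<^sup>L (K j) (h j) - integral\<^sup>L (loeb K) g\<bar> \<le> d * (S + 1) * 3 + e / 4) U"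
      using main[OF d] e by simp
    ultimately show "eventually (\<lambda>j. dist (integral\<^sup>L (K j) (h j)) (integral\<^sup>L (loeb K) g) < e) U"
      by (auto elim!: eventually_mono simp: dist_real_def)
  qed
qed

end

section \<open>Bounded families of integrable functions\<close>

locale Lp_ultraproduct = loeb_space U lev M
  for U :: "'j filter" and lev :: "'j \<Rightarrow> nat" and M :: "'j \<Rightarrow> 'x measure" +
  fixes p :: real
  assumes p: "1 \<le> p"
begin

text \<open>
  The bounded families of \<open>p\<close>-integrable functions; modulo those with \<open>unorm f = 0\<close> they form the
  ultraproduct.
\<close>

definition fam :: "('j \<Rightarrow> 'x \<Rightarrow> complex) \<Rightarrow> bool" where
  "fam f \<longleftrightarrow> (\<forall>j. f j \<in> Lp p (M j)) \<and> (\<exists>C. eventually (\<lambda>j. pnorm p (M j) (f j) \<le> C) U)"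

definition unorm :: "('j \<Rightarrow> 'x \<Rightarrow> complex) \<Rightarrow> real" where
  "unorm f = Lim U (\<lambda>j. pnorm p (M j) (f j))"

definition upint :: "('j \<Rightarrow> 'x \<Rightarrow> complex) \<Rightarrow> real" where
  "upint f = Lim U (\<lambda>j. pint p (M j) (f j))"

lemma famI: "(\<And>j. f j \<in> Lp p (M j)) \<Longrightarrow> eventually (\<lambda>j. pnorm p (M j) (f j) \<le> C) U \<Longrightarrow> fam f"
  by (auto simp: fam_def)

lemma fam_Lp: "fam f \<Longrightarrow> f j \<in> Lp p (M j)"
  by (auto simp: fam_def)

lemma fam_measurable: "fam f \<Longrightarrow> f j \<in> borel_measurable (M j)"
  using fam_Lp[of f j] by (simp add: Lp_iff)

lemma tendsto_unorm: "fam f \<Longrightarrow> ((\<lambda>j. pnorm p (M j) (f j)) \<longlongrightarrow> unorm f) U"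
  unfolding unorm_def fam_def using tendsto_Lim_0_le[of "\<lambda>j. pnorm p (M j) (f j)"]
  by (auto simp: pnorm_nonneg)

lemma unorm_nonneg: "fam f \<Longrightarrow> 0 \<le> unorm f"
  by (rule tendsto_lowerbound[OF tendsto_unorm _ proper]) (simp_all add: pnorm_nonneg)

lemma tendsto_pint_powr: "fam f \<Longrightarrow> ((\<lambda>j. pint p (M j) (f j)) \<longlongrightarrow> unorm f powr p) U"
  using tendsto_powr'[OF tendsto_unorm tendsto_const[of p]] p
  by (simp add: pnorm_powr pnorm_nonneg)

lemma upint_eq: "fam f \<Longrightarrow> upint f = unorm f powr p"
  unfolding upint_def by (rule tendsto_Lim[OF proper tendsto_pint_powr])

lemma tendsto_upint: "fam f \<Longrightarrow> ((\<lambda>j. pint p (M j) (f j)) \<longlongrightarrow> upint f) U"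
  using tendsto_pint_powr by (simp add: upint_eq)

lemma upint_nonneg: "fam f \<Longrightarrow> 0 \<le> upint f"
  by (simp add: upint_eq)

lemma fam_dominated:
  assumes f: "fam f" and g: "\<And>j. g j \<in> borel_measurable (M j)"
    and le: "\<And>j x. x \<in> space (M j) \<Longrightarrow> cmod (g j x) \<le> cmod (f j x)"
  shows "fam g" "upint g \<le> upint f"
proof -
  note d = Lp_dominated[OF p fam_Lp[OF f] g le]
  obtain C where C: "eventually (\<lambda>j. pnorm p (M j) (f j) \<le> C) U" using f by (auto simp: fam_def)
  show fg: "fam g"
    by (rule famI[where C=C]) (use d(1) in blast, use C in \<open>eventually_elim, use d(3) order_trans in blast\<close>)
  show "upint g \<le> upint f"
    by (rule tendsto_le[OF proper tendsto_upint[OF f] tendsto_upint[OF fg]]) (use d(2) in simp)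
qed

lemma fam_zero: "fam (\<lambda>j x. 0)"
  by (rule famI[where C=0]) (auto simp: Lp_zero pnorm_zero p)

lemma fam_cmult:
  assumes "fam f" shows "fam (\<lambda>j x. c * f j x)" "unorm (\<lambda>j x. c * f j x) = cmod c * unorm f"
proof -
  obtain C where C: "eventually (\<lambda>j. pnorm p (M j) (f j) \<le> C) U" using assms by (auto simp: fam_def)
  show "fam (\<lambda>j x. c * f j x)"
    by (rule famI[where C="cmod c * C"])
      (use assms in \<open>auto intro: Lp_cmult fam_Lp\<close>, use C in \<open>eventually_elim, auto simp: pnorm_cmult p intro!: mult_left_mono\<close>)
  have "((\<lambda>j. cmod c * pnorm p (M j) (f j)) \<longlongrightarrow> cmod c * unorm f) U"
    by (intro tendsto_intros tendsto_unorm assms)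
  then show "unorm (\<lambda>j x. c * f j x) = cmod c * unorm f"
    unfolding unorm_def[of "\<lambda>j x. c * f j x"] using p by (simp add: pnorm_cmult tendsto_Lim[OF proper])
qed

lemma fam_add:
  assumes "fam f" "fam g"
  shows "fam (\<lambda>j x. f j x + g j x)"
proof -
  obtain C D where "eventually (\<lambda>j. pnorm p (M j) (f j) \<le> C) U" "eventually (\<lambda>j. pnorm p (M j) (g j) \<le> D) U"
    using assms by (auto simp: fam_def)
  then have "eventually (\<lambda>j. pnorm p (M j) (\<lambda>x. f j x + g j x) \<le> C + D) U"
  proof eventually_elim
    case (elim j)
    then show ?case using minkowski[OF p fam_Lp[OF assms(1), of j] fam_Lp[OF assms(2), of j]] by linarith
  qed
  then show ?thesis
    using assms by (intro famI) (auto intro: Lp_add[OF p] fam_Lp)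
qed

lemma fam_diff:
  assumes "fam f" "fam g"
  shows "fam (\<lambda>j x. f j x - g j x)"
  using fam_add[OF assms(1) fam_cmult(1)[OF assms(2), of "-1"]] by simp

definition restr :: "('j \<Rightarrow> 'x set) \<Rightarrow> ('j \<Rightarrow> 'x \<Rightarrow> complex) \<Rightarrow> 'j \<Rightarrow> 'x \<Rightarrow> complex" where
  "restr G f j x = (if x \<in> G j then f j x else 0)"

lemma restr_measurable:
  assumes "fam f" "\<And>j. G j \<in> sets (M j)"
  shows "restr G f j \<in> borel_measurable (M j)"
  unfolding restr_def[abs_def] using fam_measurable[OF assms(1)] assms(2) by measurable

lemma fam_restr:
  assumes "fam f" "\<And>j. G j \<in> sets (M j)"
  shows "fam (restr G f)" "upint (restr G f) \<le> upint f"
  using fam_dominated[OF assms(1) restr_measurable[OF assms]] by (auto simp: restr_def)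

lemma restr_powr: "cmod (restr G f j x) powr p = cmod (f j x) powr p * indicator (G j) x"
  by (auto simp: restr_def)

lemma restr_integrable:
  assumes "fam f" "G \<in> sets (M j)"
  shows "integrable (M j) (\<lambda>x. cmod (f j x) powr p * indicator G x)"
  using integrable_mult_indicator[OF assms(2) Lp_integrable[OF fam_Lp[OF assms(1)]]]
  by (simp add: mult.commute)

lemma pint_restr_Un_Int:
  assumes f: "fam f" and G: "\<And>j. G j \<in> sets (M j)" and H: "\<And>j. H j \<in> sets (M j)"
  shows "pint p (M j) (restr (\<lambda>j. G j \<union> H j) f j) + pint p (M j) (restr (\<lambda>j. G j \<inter> H j) f j)
    = pint p (M j) (restr G f j) + pint p (M j) (restr H f j)"
proof -
  have "pint p (M j) (restr (\<lambda>j. G j \<union> H j) f j) + pint p (M j) (restr (\<lambda>j. G j \<inter> H j) f j)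
     = (LINT x|M j. cmod (f j x) powr p * indicator (G j \<union> H j) x + cmod (f j x) powr p * indicator (G j \<inter> H j) x)"
    unfolding restr_powr using G[of j] H[of j] by (intro Bochner_Integration.integral_add[symmetric] restr_integrable f) auto
  also have "\<dots> = (LINT x|M j. cmod (f j x) powr p * indicator (G j) x + cmod (f j x) powr p * indicator (H j) x)"
    by (intro Bochner_Integration.integral_cong) (auto simp: indicator_def)
  also have "\<dots> = pint p (M j) (restr G f j) + pint p (M j) (restr H f j)"
    unfolding restr_powr using G[of j] H[of j] by (intro Bochner_Integration.integral_add restr_integrable f) auto
  finally show ?thesis .
qed

lemma pint_restr_mono:
  assumes f: "fam f" and G: "\<And>j. G j \<in> sets (M j)" and H: "\<And>j. H j \<in> sets (M j)" and sub: "G j \<subseteq> H j"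
  shows "pint p (M j) (restr G f j) \<le> pint p (M j) (restr H f j)"
  unfolding restr_powr using G[of j] H[of j] sub
  by (intro integral_mono restr_integrable f) (auto simp: indicator_def)

section \<open>The components of an ultraproduct in Loeb spaces\<close>

text \<open>
  For \<open>u\<close> in a bounded family the measure \<open>\<bar>u\<^sub>j\<bar>\<^sup>p M\<^sub>j\<close> is finite, whatever the size of \<open>M\<^sub>j\<close>.
\<close>

definition weight :: "('j \<Rightarrow> 'x \<Rightarrow> complex) \<Rightarrow> 'j \<Rightarrow> 'x measure" where
  "weight u j = density (M j) (\<lambda>x. ennreal (cmod (u j x) powr p))"

lemma measure_weight:
  assumes "fam u" "\<And>j. B j \<in> sets (M j)"
  shows "emeasure (weight u j) (B j) = ennreal (pint p (M j) (restr B u j))"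
    "measure (weight u j) (B j) = pint p (M j) (restr B u j)"
proof -
  have "emeasure (weight u j) (B j) = (\<integral>\<^sup>+x. ennreal (cmod (u j x) powr p) * indicator (B j) x \<partial>M j)"
    unfolding weight_def using assms fam_measurable[of u j] by (intro emeasure_density) measurable
  also have "\<dots> = (\<integral>\<^sup>+x. ennreal (cmod (u j x) powr p * indicator (B j) x) \<partial>M j)"
    by (intro nn_integral_cong) (auto simp: indicator_def)
  also have "\<dots> = ennreal (pint p (M j) (restr B u j))"
    unfolding restr_powr using assms by (intro nn_integral_eq_integral restr_integrable) auto
  finally show e: "emeasure (weight u j) (B j) = ennreal (pint p (M j) (restr B u j))" .
  then show "measure (weight u j) (B j) = pint p (M j) (restr B u j)"
    by (simp add: measure_def pint_nonneg)
qed

lemma bounded_family_weight: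
  assumes u: "fam u"
  shows "bounded_family (weight u)"
proof -
  note m = measure_weight[OF u, of "\<lambda>j. space (M j)"]
  have "finite_measure (weight u j)" for j
    using m(1)[of j] by (intro finite_measureI) (simp add: weight_def)
  moreover have "sets (weight u j) = sets (M j)" for j by (simp add: weight_def)
  moreover have "\<exists>C. eventually (\<lambda>j. measure (weight u j) (space (M j)) \<le> C) U"
  proof -
    have "eventually (\<lambda>j. pint p (M j) (u j) < upint u + 1) U"
      using order_tendstoD(2)[OF tendsto_upint[OF u]] by simp
    moreover have "measure (weight u j) (space (M j)) \<le> pint p (M j) (u j)" for j
      unfolding m(2)[OF sets.top] by (rule Lp_dominated(2)[OF p fam_Lp[OF u] restr_measurable[OF u]]) (auto simp: restr_def)
    ultimately show ?thesis
      by (intro exI[of _ "upint u + 1"]) (auto elim!: eventually_mono intro: order_trans less_imp_le)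
  qed
  ultimately show ?thesis by (auto simp: bounded_family_def)
qed

abbreviation \<nu> :: "('j \<Rightarrow> 'x \<Rightarrow> complex) \<Rightarrow> ('j \<Rightarrow> 'x) measure" where
  "\<nu> u \<equiv> loeb (weight u)"

lemma emeasure_\<nu>:
  assumes "fam u" "\<And>j. B j \<in> sets (M j)"
  shows "emeasure (\<nu> u) (internal B) = ennreal (upint (restr B u))"
  unfolding upint_def using emeasure_loeb[OF assms(2) bounded_family_weight[OF assms(1)]] measure_weight(2)[OF assms]
  by simp

definition ratio :: "('j \<Rightarrow> 'x \<Rightarrow> complex) \<Rightarrow> ('j \<Rightarrow> 'x \<Rightarrow> complex) \<Rightarrow> 'j \<Rightarrow> 'x \<Rightarrow> complex" where
  "ratio f u j x = f j x / u j x"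

definition finite_points :: "('j \<Rightarrow> 'x \<Rightarrow> complex) \<Rightarrow> ('j \<Rightarrow> 'x \<Rightarrow> complex) \<Rightarrow> ('j \<Rightarrow> 'x) set" where
  "finite_points f u = {x \<in> points. \<exists>C. eventually (\<lambda>j. cmod (ratio f u j (x j)) \<le> C) U}"

text \<open>
  The density of \<open>f\<close> relative to \<open>u\<close>. Where the quotients are not eventually bounded, \<open>f\<close> is infinitely larger than
  \<open>u\<close> and the component is set to \<open>0\<close>.
\<close>

definition component :: "('j \<Rightarrow> 'x \<Rightarrow> complex) \<Rightarrow> ('j \<Rightarrow> 'x \<Rightarrow> complex) \<Rightarrow> ('j \<Rightarrow> 'x) \<Rightarrow> complex" where
  "component f u x = (if x \<in> finite_points f u then Lim U (\<lambda>j. ratio f u j (x j)) else 0)"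

text \<open>
  The part of the space on which \<open>f\<close> is dominated by \<open>n u\<close>.
\<close>

definition level :: "nat \<Rightarrow> ('j \<Rightarrow> 'x \<Rightarrow> complex) \<Rightarrow> ('j \<Rightarrow> 'x \<Rightarrow> complex) \<Rightarrow> 'j \<Rightarrow> 'x set" where
  "level n f u j = {x \<in> space (M j). cmod (f j x) \<le> real n * cmod (u j x)}"

lemma level_sets: "fam f \<Longrightarrow> fam u \<Longrightarrow> level n f u j \<in> sets (M j)"
  unfolding level_def using fam_measurable[of f j] fam_measurable[of u j] by measurable

lemma ratio_measurable: "fam f \<Longrightarrow> fam u \<Longrightarrow> ratio f u j \<in> borel_measurable (M j)"
  unfolding ratio_def[abs_def] using fam_measurable[of f j] fam_measurable[of u j] by measurable

lemma tendsto_ratio: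
  "x \<in> finite_points f u \<Longrightarrow> ((\<lambda>j. ratio f u j (x j)) \<longlongrightarrow> component f u x) U"
  using tendsto_Lim_bounded[of "\<lambda>j. ratio f u j (x j)"] by (auto simp: finite_points_def component_def)

lemma componentI:
  assumes "x \<in> points" "((\<lambda>j. ratio f u j (x j)) \<longlongrightarrow> l) U"
  shows "component f u x = l" "x \<in> finite_points f u"
proof -
  have "eventually (\<lambda>j. cmod (ratio f u j (x j)) < cmod l + 1) U"
    using order_tendstoD(2)[OF tendsto_norm[OF assms(2)]] by simp
  then show "x \<in> finite_points f u"
    using assms(1) by (auto simp: finite_points_def elim!: eventually_mono intro!: exI[of _ "cmod l + 1"])
  then show "component f u x = l" using tendsto_Lim[OF proper assms(2)] by (simp add: component_def)
qed

lemma finite_points_sets: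
  assumes f: "fam f" and u: "fam u"
  shows "finite_points f u \<in> sets (loeb K)"
proof -
  define B where "B n j = {y \<in> space (M j). cmod (ratio f u j y) \<le> real n}" for n :: nat and j
  have "internal (B n) \<in> sets (loeb K)" for n
    unfolding B_def using ratio_measurable[OF assms] by (intro internal_in_sets_loeb) measurable
  moreover have "finite_points f u = (\<Union>n. internal (B n))"
  proof (intro equalityI subsetI)
    fix x assume "x \<in> finite_points f u"
    then obtain C where x: "eventually (\<lambda>j. x j \<in> space (M j)) U" "eventually (\<lambda>j. cmod (ratio f u j (x j)) \<le> C) U"
      by (auto simp: finite_points_def points_def internal_def)
    obtain n :: nat where "C \<le> real n" using real_arch_simple by blast
    with x(2) have "eventually (\<lambda>j. cmod (ratio f u j (x j)) \<le> real n) U" by (auto elim!: eventually_mono)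
    with x(1) have "x \<in> internal (B n)" by (simp add: internal_def B_def eventually_conj_iff)
    then show "x \<in> (\<Union>n. internal (B n))" by blast
  next
    fix x assume "x \<in> (\<Union>n. internal (B n))"
    then show "x \<in> finite_points f u"
      by (auto simp: internal_def B_def finite_points_def points_def eventually_conj_iff)
  qed
  ultimately show ?thesis by auto
qed

lemma component_measurable:
  assumes f: "fam f" and u: "fam u"
  shows "component f u \<in> borel_measurable (loeb K)"
proof -
  have fin: "\<exists>C. eventually (\<lambda>j. cmod (ratio f u j (x j)) \<le> C) U" if "x \<in> finite_points f u" for x
    using that by (auto simp: finite_points_def)
  have re: "(\<lambda>x. if x \<in> finite_points f u then Lim U (\<lambda>j. Re (ratio f u j (x j))) else 0) \<in> borel_measurable (loeb K)"
    using ratio_measurable[OF assms]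
    by (intro borel_measurable_Lim_real[OF _ sets_loeb finite_points_sets[OF assms]])
      (auto dest!: fin intro: order_trans[OF abs_Re_le_cmod] elim!: eventually_mono)
  have im: "(\<lambda>x. if x \<in> finite_points f u then Lim U (\<lambda>j. Im (ratio f u j (x j))) else 0) \<in> borel_measurable (loeb K)"
    using ratio_measurable[OF assms]
    by (intro borel_measurable_Lim_real[OF _ sets_loeb finite_points_sets[OF assms]])
      (auto dest!: fin intro: order_trans[OF abs_Im_le_cmod] elim!: eventually_mono)
  have "component f u = (\<lambda>x. Complex (if x \<in> finite_points f u then Lim U (\<lambda>j. Re (ratio f u j (x j))) else 0)
      (if x \<in> finite_points f u then Lim U (\<lambda>j. Im (ratio f u j (x j))) else 0))"
  proof
    fix x
    show "component f u x = Complex (if x \<in> finite_points f u then Lim U (\<lambda>j. Re (ratio f u j (x j))) else 0)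
      (if x \<in> finite_points f u then Lim U (\<lambda>j. Im (ratio f u j (x j))) else 0)"
    proof (cases "x \<in> finite_points f u")
      case True
      have "Lim U (\<lambda>j. Re (ratio f u j (x j))) = Re (component f u x)" "Lim U (\<lambda>j. Im (ratio f u j (x j))) = Im (component f u x)"
        by (intro tendsto_Lim proper tendsto_Re tendsto_Im tendsto_ratio True)+
      then show ?thesis using True by simp
    qed (simp add: component_def zero_complex.code)
  qed
  then show ?thesis using re im by (simp add: borel_measurable_complex_iff)
qed

text \<open>
  On a level set the quotient \<open>f / u\<close> is bounded, so integration commutes with the limit, and the
  weight \<open>\<bar>u\<bar>\<^sup>p\<close> cancels the denominator.
\<close>

lemma nn_integral_component_level:
  assumes f: "fam f" and u: "fam u"
  shows "(\<integral>\<^sup>+x. ennreal (cmod (component f u x) powr p) * indicator (internal (level n f u)) x \<partial>\<nu> u) =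
    ennreal (upint (restr (level n f u) f))"
proof -
  define h where "h j y = cmod (ratio f u j y) powr p * indicator (level n f u j) y" for j y
  have hm: "h j \<in> borel_measurable (M j)" for j
    unfolding h_def[abs_def] using ratio_measurable[OF assms, of j] level_sets[OF assms, of n j] by measurable
  have rn: "cmod (ratio f u j y) \<le> real n" if "y \<in> level n f u j" for j y
    using that by (cases "u j y = 0") (auto simp: level_def ratio_def norm_divide divide_simps)
  have hb: "0 \<le> h j y \<and> h j y \<le> real n powr p" for j y
    using rn[of y j] p by (auto simp: h_def indicator_def intro: powr_mono2)
  define g where "g x = (if x \<in> points then Lim U (\<lambda>j. h j (x j)) else 0)" for x
  note il = integral_loeb[OF bounded_family_weight[OF u] hm hb, folded g_def]
  have geq: "g x = cmod (component f u x) powr p * indicator (internal (level n f u)) x" if x: "x \<in> points" for x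
  proof (cases "x \<in> internal (level n f u)")
    case True
    then have ev: "eventually (\<lambda>j. x j \<in> level n f u j) U" by (simp add: internal_def)
    then have "eventually (\<lambda>j. cmod (ratio f u j (x j)) \<le> real n) U" by eventually_elim (rule rn)
    then have "x \<in> finite_points f u" using x by (auto simp: finite_points_def)
    then have "((\<lambda>j. cmod (ratio f u j (x j)) powr p) \<longlongrightarrow> cmod (component f u x) powr p) U"
      using p by (intro tendsto_powr' tendsto_norm tendsto_ratio tendsto_const) auto
    moreover have "eventually (\<lambda>j. cmod (ratio f u j (x j)) powr p = h j (x j)) U"
      using ev by eventually_elim (simp add: h_def)
    ultimately have "((\<lambda>j. h j (x j)) \<longlongrightarrow> cmod (component f u x) powr p) U"
      by (rule Lim_transform_eventually)
    then show ?thesis using x True by (simp add: g_def tendsto_Lim[OF proper])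
  next
    case False
    then have "eventually (\<lambda>j. x j \<notin> level n f u j) U" by (simp add: internal_def eventually_not_iff)
    then have "eventually (\<lambda>j. 0 = h j (x j)) U" by eventually_elim (simp add: h_def)
    then have "((\<lambda>j. h j (x j)) \<longlongrightarrow> 0) U" by (rule Lim_transform_eventually[OF tendsto_const])
    then show ?thesis using x False by (simp add: g_def tendsto_Lim[OF proper])
  qed
  have "integral\<^sup>L (weight u j) (h j) = pint p (M j) (restr (level n f u) f j)" for j
  proof -
    have "integral\<^sup>L (weight u j) (h j) = (LINT y|M j. cmod (u j y) powr p * h j y)"
      unfolding weight_def using fam_measurable[OF u, of j] hm by (subst integral_real_density) auto
    also have "\<dots> = pint p (M j) (restr (level n f u) f j)"
    proof (rule Bochner_Integration.integral_cong[OF refl])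
      fix y
      show "cmod (u j y) powr p * h j y = cmod (restr (level n f u) f j y) powr p"
        by (cases "u j y = 0") (auto simp: h_def restr_def ratio_def level_def norm_divide powr_divide)
    qed
    finally show ?thesis .
  qed
  then have "integral\<^sup>L (\<nu> u) g = upint (restr (level n f u) f)"
    using tendsto_Lim[OF proper il(2)] by (simp add: upint_def)
  moreover have "0 \<le> g x" for x by (cases "x \<in> points") (simp add: geq, simp add: g_def)
  ultimately have "(\<integral>\<^sup>+x. ennreal (g x) \<partial>\<nu> u) = ennreal (upint (restr (level n f u) f))"
    using il(1) by (subst nn_integral_eq_integral) auto
  moreover have "(\<integral>\<^sup>+x. ennreal (g x) \<partial>\<nu> u) =
      (\<integral>\<^sup>+x. ennreal (cmod (component f u x) powr p) * indicator (internal (level n f u)) x \<partial>\<nu> u)"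
    by (intro nn_integral_cong) (auto simp: geq indicator_def)
  ultimately show ?thesis by simp
qed

text \<open>
  A point where the component is nonzero lies in one of the level sets, so the integral is a
  monotone limit.
\<close>

lemma nn_integral_component:
  assumes f: "fam f" and u: "fam u"
  shows "(\<integral>\<^sup>+x. ennreal (cmod (component f u x) powr p) \<partial>\<nu> u) =
    (SUP n. ennreal (upint (restr (level n f u) f)))"
proof -
  let ?F = "\<lambda>n x. ennreal (cmod (component f u x) powr p) * indicator (internal (level n f u)) x"
  have mono: "internal (level m f u) \<subseteq> internal (level n f u)" if "m \<le> n" for m n
    unfolding internal_subset_iff using that
    by (intro always_eventually) (auto simp: level_def elim!: order_trans intro!: mult_right_mono)
  have inc: "incseq ?F"
    using mono by (auto simp: incseq_def le_fun_def indicator_def)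
  have meas: "?F n \<in> borel_measurable (\<nu> u)" for n
    using component_measurable[OF assms] internal_in_sets_loeb[OF level_sets[OF assms]] by measurable
  have "(SUP n. ?F n x) = ennreal (cmod (component f u x) powr p)" if x: "x \<in> space (\<nu> u)" for x
  proof (cases "component f u x = 0")
    case False
    then have fx: "x \<in> finite_points f u" by (auto simp: component_def split: if_splits)
    then obtain C where C: "eventually (\<lambda>j. cmod (ratio f u j (x j)) \<le> C) U" by (auto simp: finite_points_def)
    obtain n :: nat where n: "C \<le> real n" using real_arch_simple by blast
    have "eventually (\<lambda>j. ratio f u j (x j) \<noteq> 0) U"
      using tendsto_imp_eventually_ne[OF tendsto_ratio[OF fx] False] .
    moreover have "eventually (\<lambda>j. x j \<in> space (M j)) U" using x by (simp add: points_def internal_def)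
    ultimately have "eventually (\<lambda>j. x j \<in> level n f u j) U" using C
    proof eventually_elim
      case (elim j)
      then have "u j (x j) \<noteq> 0" "cmod (f j (x j)) \<le> C * cmod (u j (x j))" by (auto simp: ratio_def norm_divide divide_simps split: if_splits)
      then show ?case using n elim by (auto simp: level_def intro: order_trans mult_right_mono)
    qed
    then have "x \<in> internal (level n f u)" by (simp add: internal_def)
    then show ?thesis
      by (intro antisym SUP_least) (auto simp: indicator_def intro!: SUP_upper2[of n])
  qed simp
  then have "(\<integral>\<^sup>+x. ennreal (cmod (component f u x) powr p) \<partial>\<nu> u) = (\<integral>\<^sup>+x. (SUP n. ?F n x) \<partial>\<nu> u)"
    by (intro nn_integral_cong) simp
  also have "\<dots> = (SUP n. \<integral>\<^sup>+x. ?F n x \<partial>\<nu> u)"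
    by (intro nn_integral_monotone_convergence_SUP inc meas)
  finally show ?thesis by (simp add: nn_integral_component_level[OF assms])
qed

text \<open>
  On the set where \<open>\<bar>f\<bar> > n \<bar>u\<bar>\<close>, the mass of \<open>u\<close> is at most the mass of \<open>f\<close> divided by \<open>n\<^sup>p\<close>. This
  makes the component additive almost everywhere, although the exceptional value \<open>0\<close> is not
  compatible with sums.
\<close>

lemma AE_finite_points:
  assumes f: "fam f" and u: "fam u"
  shows "AE x in \<nu> u. x \<in> finite_points f u"
proof -
  define B where "B n j = {y \<in> space (M j). real (Suc n) * cmod (u j y) < cmod (f j y) \<and> u j y \<noteq> 0}" for n j
  have BM: "B n j \<in> sets (M j)" for n j
    unfolding B_def using fam_measurable[OF f, of j] fam_measurable[OF u, of j] by measurable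
  let ?W = "points - finite_points f u"
  have W: "?W \<in> sets (\<nu> u)" using finite_points_sets[OF assms] sets.top[of "\<nu> u"] by auto
  have sub: "?W \<subseteq> internal (B n)" for n
  proof
    fix x assume x: "x \<in> ?W"
    then have "\<not> eventually (\<lambda>j. cmod (ratio f u j (x j)) \<le> real (Suc n)) U" by (auto simp: finite_points_def)
    then have "eventually (\<lambda>j. \<not> cmod (ratio f u j (x j)) \<le> real (Suc n)) U" using ultra by blast
    moreover have "eventually (\<lambda>j. x j \<in> space (M j)) U" using x by (simp add: points_def internal_def)
    ultimately have "eventually (\<lambda>j. x j \<in> B n j) U"
    proof eventually_elim
      case (elim j)
      then have "u j (x j) \<noteq> 0" by (auto simp: ratio_def)
      then show ?case using elim by (auto simp: B_def ratio_def norm_divide divide_simps not_le mult.commute)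
    qed
    then show "x \<in> internal (B n)" by (simp add: internal_def)
  qed
  have bd: "upint (restr (B n) u) \<le> upint f / real (Suc n)" for n
  proof -
    have "cmod (of_nat (Suc n) * restr (B n) u j x) \<le> cmod (f j x)" for j x
      by (auto simp: restr_def B_def norm_mult simp del: of_nat_Suc)
    then have "upint (\<lambda>j x. of_nat (Suc n) * restr (B n) u j x) \<le> upint f"
      using restr_measurable[OF u BM] by (intro fam_dominated(2)[OF f]) auto
    then have "real (Suc n) powr p * upint (restr (B n) u) \<le> upint f"
      using fam_restr(1)[OF u, of "B n", OF BM]
      by (simp add: upint_eq fam_cmult powr_mult unorm_nonneg del: of_nat_Suc)
    moreover have "real (Suc n) powr 1 \<le> real (Suc n) powr p" using p by (intro powr_mono) auto
    then have "real (Suc n) * upint (restr (B n) u) \<le> real (Suc n) powr p * upint (restr (B n) u)"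
      using upint_nonneg[OF fam_restr(1)[OF u, of "B n", OF BM]] by (intro mult_right_mono) auto
    ultimately show ?thesis by (simp add: field_simps)
  qed
  have "emeasure (\<nu> u) ?W \<le> ennreal (upint f / real (Suc n))" for n
  proof -
    have "emeasure (\<nu> u) ?W \<le> emeasure (\<nu> u) (internal (B n))"
      using sub internal_in_sets_loeb[OF BM] by (intro emeasure_mono) auto
    also have "\<dots> \<le> ennreal (upint f / real (Suc n))"
      unfolding emeasure_\<nu>[OF u BM] by (intro ennreal_leI bd)
    finally show ?thesis .
  qed
  moreover have "(\<lambda>n. ennreal (upint f / real (Suc n))) \<longlonglongrightarrow> ennreal 0"
    by (intro tendsto_ennrealI LIMSEQ_Suc[OF lim_const_over_n])
  ultimately have "emeasure (\<nu> u) ?W \<le> ennreal 0"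
    by (intro LIMSEQ_le_const) auto
  then have "?W \<in> null_sets (\<nu> u)" using W by (simp add: null_sets_def)
  then have "AE x in \<nu> u. x \<notin> ?W" by (rule AE_not_in)
  with AE_space show ?thesis by eventually_elim auto
qed

lemma component_add:
  assumes "fam f" "fam g" "fam u"
  shows "AE x in \<nu> u. component (\<lambda>j x. f j x + g j x) u x = component f u x + component g u x"
  using AE_finite_points[OF assms(1,3)] AE_finite_points[OF assms(2,3)]
proof eventually_elim
  case (elim x)
  then have "((\<lambda>j. ratio f u j (x j) + ratio g u j (x j)) \<longlongrightarrow> component f u x + component g u x) U"
    by (intro tendsto_add tendsto_ratio)
  moreover have "x \<in> points" using elim by (auto simp: finite_points_def)
  ultimately show ?case
    by (intro componentI(1)) (auto simp: ratio_def add_divide_distrib)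
qed

lemma component_cmult:
  assumes "fam f" "fam u"
  shows "AE x in \<nu> u. component (\<lambda>j x. c * f j x) u x = c * component f u x"
  using AE_finite_points[OF assms]
proof eventually_elim
  case (elim x)
  then have "((\<lambda>j. c * ratio f u j (x j)) \<longlongrightarrow> c * component f u x) U"
    by (intro tendsto_mult_left tendsto_ratio)
  moreover have "x \<in> points" using elim by (auto simp: finite_points_def)
  ultimately show ?case
    by (intro componentI(1)) (auto simp: ratio_def)
qed

end

section \<open>Maximal orthogonal families\<close>

context Lp_ultraproduct
begin

definition fmin :: "('j \<Rightarrow> 'x \<Rightarrow> complex) \<Rightarrow> ('j \<Rightarrow> 'x \<Rightarrow> complex) \<Rightarrow> 'j \<Rightarrow> 'x \<Rightarrow> complex" where
  "fmin u v j x = complex_of_real (min (cmod (u j x)) (cmod (v j x)))"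

text \<open>
  Disjointness of \<open>\<bar>u\<bar>\<close> and \<open>\<bar>v\<bar>\<close> in the vector lattice of families modulo null families.
\<close>

definition perp :: "('j \<Rightarrow> 'x \<Rightarrow> complex) \<Rightarrow> ('j \<Rightarrow> 'x \<Rightarrow> complex) \<Rightarrow> bool" where
  "perp u v \<longleftrightarrow> upint (fmin u v) = 0"

lemma fam_fmin:
  assumes "fam u" "fam v" shows "fam (fmin u v)"
proof (rule fam_dominated(1)[OF assms(1)])
  show "fmin u v j \<in> borel_measurable (M j)" for j
    unfolding fmin_def[abs_def] using fam_measurable[OF assms(1), of j] fam_measurable[OF assms(2), of j] by measurable
qed (auto simp: fmin_def)

lemma fmin_commute: "fmin u v = fmin v u"
  by (auto simp: fmin_def fun_eq_iff min.commute)

lemma perp_commute: "perp u v \<longleftrightarrow> perp v u"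
  by (simp add: perp_def fmin_commute)

lemma perp_self:
  assumes "fam u" "perp u u" shows "unorm u = 0"
proof -
  have "upint u = upint (fmin u u)" unfolding upint_def by (simp add: fmin_def)
  then show ?thesis using assms upint_eq[OF assms(1)] by (simp add: perp_def)
qed

lemma upint_restr_Un_Int:
  assumes f: "fam f" and G: "\<And>j. G j \<in> sets (M j)" and H: "\<And>j. H j \<in> sets (M j)"
  shows "upint (restr (\<lambda>j. G j \<union> H j) f) + upint (restr (\<lambda>j. G j \<inter> H j) f) = upint (restr G f) + upint (restr H f)"
proof (rule tendsto_unique[OF proper])
  have "fam (restr (\<lambda>j. G j \<union> H j) f)" "fam (restr (\<lambda>j. G j \<inter> H j) f)"
    using G H by (auto intro!: fam_restr(1)[OF f])
  then show "((\<lambda>j. pint p (M j) (restr (\<lambda>j. G j \<union> H j) f j) + pint p (M j) (restr (\<lambda>j. G j \<inter> H j) f j))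
      \<longlongrightarrow> upint (restr (\<lambda>j. G j \<union> H j) f) + upint (restr (\<lambda>j. G j \<inter> H j) f)) U"
    by (intro tendsto_add tendsto_upint)
  show "((\<lambda>j. pint p (M j) (restr (\<lambda>j. G j \<union> H j) f j) + pint p (M j) (restr (\<lambda>j. G j \<inter> H j) f j))
      \<longlongrightarrow> upint (restr G f) + upint (restr H f)) U"
    unfolding pint_restr_Un_Int[OF f G H] by (intro tendsto_add tendsto_upint fam_restr f G H)
qed

lemma upint_restr_mono:
  assumes f: "fam f" and G: "\<And>j. G j \<in> sets (M j)" and H: "\<And>j. H j \<in> sets (M j)" and sub: "\<And>j. G j \<subseteq> H j"
  shows "upint (restr G f) \<le> upint (restr H f)"
  by (rule tendsto_le[OF proper tendsto_upint[OF fam_restr(1)[OF f H]] tendsto_upint[OF fam_restr(1)[OF f G]]])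
    (intro always_eventually allI pint_restr_mono f G H sub)

lemma upint_restr_empty: "upint (restr (\<lambda>j. {}) f) = 0"
  using p by (simp add: upint_def restr_def tendsto_Lim[OF proper])

text \<open>
  The part of the space on which \<open>f\<close> is dominated by \<open>n\<close> times some member of \<open>S\<close>.
\<close>

definition cover :: "('j \<Rightarrow> 'x \<Rightarrow> complex) set \<Rightarrow> nat \<Rightarrow> ('j \<Rightarrow> 'x \<Rightarrow> complex) \<Rightarrow> 'j \<Rightarrow> 'x set" where
  "cover S n f j = (\<Union>u\<in>S. level n f u j)"

lemma cover_sets: "finite S \<Longrightarrow> \<forall>u\<in>S. fam u \<Longrightarrow> fam f \<Longrightarrow> cover S n f j \<in> sets (M j)"
  unfolding cover_def by (auto intro!: level_sets)

lemma level_mono: "m \<le> n \<Longrightarrow> level m f u j \<subseteq> level n f u j"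
  by (auto simp: level_def elim!: order_trans intro!: mult_right_mono)

lemma cover_mono: "S \<subseteq> T \<Longrightarrow> m \<le> n \<Longrightarrow> cover S m f j \<subseteq> cover T n f j"
  unfolding cover_def by (intro UN_mono level_mono)

text \<open>
  Where \<open>f\<close> is dominated by \<open>n u\<close> and by \<open>n v\<close>, it is dominated by \<open>n min(\<bar>u\<bar>, \<bar>v\<bar>)\<close>.
\<close>

lemma upint_level_Int:
  assumes f: "fam f" and u: "fam u" and v: "fam v" and "perp u v"
  shows "upint (restr (\<lambda>j. level n f u j \<inter> level n f v j) f) = 0"
proof -
  have m: "restr (\<lambda>j. level n f u j \<inter> level n f v j) f j \<in> borel_measurable (M j)" for j
    using level_sets[OF f u] level_sets[OF f v] by (intro restr_measurable[OF f]) auto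
  have "upint (restr (\<lambda>j. level n f u j \<inter> level n f v j) f) \<le> upint (\<lambda>j x. of_nat n * fmin u v j x)"
    by (rule fam_dominated(2)[OF fam_cmult(1)[OF fam_fmin[OF u v]] m])
      (auto simp: restr_def level_def norm_mult fmin_def min_def)
  also have "\<dots> = real n powr p * upint (fmin u v)"
    using fam_cmult[OF fam_fmin[OF u v], of "of_nat n"] fam_fmin[OF u v]
    by (simp add: upint_eq powr_mult unorm_nonneg)
  also have "\<dots> = 0" using assms by (simp add: perp_def)
  finally have "upint (restr (\<lambda>j. level n f u j \<inter> level n f v j) f) \<le> 0" .
  moreover have "fam (restr (\<lambda>j. level n f u j \<inter> level n f v j) f)"
    using level_sets[OF f u] level_sets[OF f v] by (intro fam_restr(1)[OF f]) auto
  ultimately show ?thesis using upint_nonneg by (auto intro: antisym)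
qed

text \<open>
  The level sets for different members of an orthogonal set overlap in parts that carry no mass of \<open>f\<close>.
\<close>

lemma upint_cover:
  assumes f: "fam f" and S: "finite S" "\<forall>u\<in>S. fam u" "\<forall>u\<in>S. \<forall>v\<in>S. u \<noteq> v \<longrightarrow> perp u v"
  shows "upint (restr (cover S n f) f) = (\<Sum>u\<in>S. upint (restr (level n f u) f))"
  using S
proof (induction S rule: finite_induct)
  case empty
  then show ?case by (simp add: cover_def[abs_def] upint_restr_empty)
next
  case (insert u S)
  have u: "fam u" using insert.prems by auto
  note S' = insert.prems insert.hyps
  have zero: "upint (restr (\<lambda>j. level n f u j \<inter> cover T n f j) f) = 0" if "finite T" "T \<subseteq> S" for T
    using that
  proof (induction T rule: finite_induct)
    case empty
    then show ?case by (simp add: cover_def upint_restr_empty)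
  next
    case (insert v T)
    have v: "fam v" "perp u v" using insert.prems S' by auto
    have T: "cover T n f j \<in> sets (M j)" for j
      using insert S' f by (intro cover_sets) auto
    let ?G = "\<lambda>j. level n f u j \<inter> level n f v j" and ?H = "\<lambda>j. level n f u j \<inter> cover T n f j"
    have G: "?G j \<in> sets (M j)" "?H j \<in> sets (M j)" for j
      using level_sets[OF f u] level_sets[OF f v(1)] T by auto
    have "(\<lambda>j. level n f u j \<inter> cover (insert v T) n f j) = (\<lambda>j. ?G j \<union> ?H j)"
      by (auto simp: cover_def fun_eq_iff)
    moreover have "upint (restr (\<lambda>j. ?G j \<union> ?H j) f) + upint (restr (\<lambda>j. ?G j \<inter> ?H j) f) = 0"
      using upint_restr_Un_Int[OF f G] upint_level_Int[OF f u v] insert by simp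
    moreover have "0 \<le> upint (restr (\<lambda>j. ?G j \<union> ?H j) f)" "0 \<le> upint (restr (\<lambda>j. ?G j \<inter> ?H j) f)"
      using G by (auto intro!: upint_nonneg fam_restr(1)[OF f])
    ultimately show ?case by simp
  qed
  have S: "cover S n f j \<in> sets (M j)" for j
    using insert f by (intro cover_sets) auto
  have "cover (insert u S) n f = (\<lambda>j. level n f u j \<union> cover S n f j)"
    by (auto simp: cover_def fun_eq_iff)
  then have "upint (restr (cover (insert u S) n f) f) = upint (restr (level n f u) f) + upint (restr (cover S n f) f)"
    using upint_restr_Un_Int[OF f, of "level n f u" "cover S n f", OF level_sets[OF f u] S] zero[of S] insert.hyps by simp
  then show ?case using insert by simp
qed

text \<open>
  Maximality is expressed by its consequence: a family that is orthogonal to \<open>D\<close> could be added to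
  \<open>D\<close>, so it is orthogonal to itself and null.
\<close>

lemma maximal_orthogonal_exists:
  obtains D where "\<And>u. u \<in> D \<Longrightarrow> fam u" "\<And>u v. u \<in> D \<Longrightarrow> v \<in> D \<Longrightarrow> u \<noteq> v \<Longrightarrow> perp u v"
    "\<And>g. fam g \<Longrightarrow> (\<And>v. v \<in> D \<Longrightarrow> perp g v) \<Longrightarrow> unorm g = 0"
proof -
  define X where "X = {D. (\<forall>u\<in>D. fam u) \<and> (\<forall>u\<in>D. \<forall>v\<in>D. u \<noteq> v \<longrightarrow> perp u v)}"
  have "\<exists>D\<in>X. \<forall>E\<in>X. D \<subseteq> E \<longrightarrow> E = D"
  proof (rule subset_Zorn')
    fix C assume "subset.chain X C"
    then have C: "C \<subseteq> X" "\<And>D E. D \<in> C \<Longrightarrow> E \<in> C \<Longrightarrow> D \<subseteq> E \<or> E \<subseteq> D"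
      by (auto simp: subset_chain_def)
    have "perp u v" if uv: "u \<in> D" "v \<in> E" "D \<in> C" "E \<in> C" "u \<noteq> v" for u v D E
    proof -
      have "(u \<in> E \<and> E \<in> X) \<or> (v \<in> D \<and> D \<in> X)" using C uv by blast
      then show ?thesis using uv C(1) by (auto simp: X_def)
    qed
    then show "\<Union>C \<in> X" using C(1) by (auto simp: X_def)
  qed
  then obtain D where D: "D \<in> X" "\<And>E. E \<in> X \<Longrightarrow> D \<subseteq> E \<Longrightarrow> E = D" by blast
  have "unorm g = 0" if g: "fam g" "\<And>v. v \<in> D \<Longrightarrow> perp g v" for g
  proof -
    have "insert g D \<in> X" using D(1) g perp_commute by (auto simp: X_def)
    then have "g \<in> D" using D(2)[of "insert g D"] by auto
    then show ?thesis using g perp_self by blast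
  qed
  then show thesis using D(1) that[of D] by (auto simp: X_def)
qed

end

locale Lp_ultraproduct_basis = Lp_ultraproduct U lev M p
  for U :: "'j filter" and lev :: "'j \<Rightarrow> nat" and M :: "'j \<Rightarrow> 'x measure" and p :: real +
  fixes D :: "('j \<Rightarrow> 'x \<Rightarrow> complex) set"
  assumes D_fam: "\<And>u. u \<in> D \<Longrightarrow> fam u"
    and D_perp: "\<And>u v. u \<in> D \<Longrightarrow> v \<in> D \<Longrightarrow> u \<noteq> v \<Longrightarrow> perp u v"
    and D_max: "\<And>g. fam g \<Longrightarrow> (\<And>v. v \<in> D \<Longrightarrow> perp g v) \<Longrightarrow> unorm g = 0"
begin

text \<open>
  The parts of \<open>f\<close> that are dominated by finitely many members of \<open>D\<close> exhaust its mass. Let \<open>s\<close> be the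
  supremum of their masses, and choose an increasing sequence of covers \<open>cv k\<close> whose masses approach
  \<open>s\<close>. By saturation there are \<open>m j\<close> tending to infinity such that the cover \<open>cv (m j) j\<close> carries at
  most mass \<open>s\<close> in the limit. The remainder \<open>g\<close> of \<open>f\<close> outside of these covers is orthogonal to every
  \<open>v \<in> D\<close>: if it had mass on a level set of \<open>v\<close>, then joining \<open>v\<close> to a cover would exceed \<open>s\<close>. By
  maximality \<open>g\<close> is null, and the mass of \<open>f\<close> is at most \<open>s\<close>.
\<close>

lemma upint_le_covers:
  assumes f: "fam f"
  assumes c: "\<And>S n. finite S \<Longrightarrow> S \<subseteq> D \<Longrightarrow> upint (restr (cover S n f) f) \<le> c"
  shows "upint f \<le> c"
proof -
  define P where "P Sn = upint (restr (cover (fst Sn) (snd Sn) f) f)" for Sn :: "('j \<Rightarrow> 'x \<Rightarrow> complex) set \<times> nat"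
  define Y where "Y = {S. finite S \<and> S \<subseteq> D} \<times> (UNIV :: nat set)"
  define s where "s = (SUP Sn\<in>Y. P Sn)"
  have Yne: "Y \<noteq> {}" by (auto simp: Y_def)
  have bdd: "bdd_above (P ` Y)" using c by (auto simp: P_def Y_def intro!: bdd_aboveI2[where M=c])
  have sc: "s \<le> c" unfolding s_def using c Yne by (intro cSUP_least) (auto simp: P_def Y_def)
  have covM: "cover S n f j \<in> sets (M j)" if "finite S" "S \<subseteq> D" for S n j
    using that D_fam f by (intro cover_sets) auto
  have "\<exists>Sn\<in>Y. s - 1 / real (Suc k) < P Sn" for k
    using less_cSUP_iff[OF Yne bdd, of "s - 1 / real (Suc k)"] unfolding s_def[symmetric] by simp
  then obtain F where F: "\<And>k. F k \<in> Y" "\<And>k. s - 1 / real (Suc k) < P (F k)" by metis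
  define T where "T k = (\<Union>i\<le>k. fst (F i))" for k
  \<comment> \<open>The sum is an increasing majorant of the multiples used by the first \<open>k\<close> covers.\<close>
  define N where "N k = (\<Sum>i\<le>k. snd (F i))" for k
  have T: "finite (T k)" "T k \<subseteq> D" for k
    using F(1) by (auto simp: T_def Y_def mem_Times_iff)
  have Tm: "T k \<subseteq> T l" "N k \<le> N l" if "k \<le> l" for k l
    unfolding T_def N_def using that by (intro UN_mono sum_mono2; auto)+
  have FT: "fst (F k) \<subseteq> T k" "snd (F k) \<le> N k" for k
    by (auto simp: T_def N_def intro!: member_le_sum)
  define cv where "cv k = cover (T k) (N k) f" for k
  have cvM: "cv k j \<in> sets (M j)" for k j unfolding cv_def by (rule covM[OF T])
  have cv_mono: "cv k j \<subseteq> cv l j" if "k \<le> l" for k l j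
    unfolding cv_def using Tm[OF that] by (rule cover_mono)
  have Ps: "upint (restr (cover S n f) f) \<le> s" if "finite S" "S \<subseteq> D" for S n
    unfolding s_def using that bdd cSUP_upper[of "(S, n)" Y P] by (simp add: P_def Y_def)
  have cv_lower: "s - 1 / real (Suc k) < upint (restr (cv k) f)" for k
  proof -
    have "P (F k) \<le> upint (restr (cv k) f)"
      unfolding P_def cv_def using FT[of k] T[of k] F(1)[of k]
      by (intro upint_restr_mono f covM cover_mono) (auto simp: Y_def mem_Times_iff)
    then show ?thesis using F(2)[of k] by linarith
  qed
  have cv_ev: "eventually (\<lambda>j. pint p (M j) (restr (cv k) f j) < s + 1 / real (Suc k)) U" for k
  proof -
    have "upint (restr (cv k) f) < s + 1 / real (Suc k)"
    proof -
      have "upint (restr (cv k) f) \<le> s" unfolding cv_def by (rule Ps[OF T])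
      moreover have "0 < 1 / real (Suc k)" by simp
      ultimately show ?thesis by linarith
    qed
    from order_tendstoD(2)[OF tendsto_upint[OF fam_restr(1)[OF f cvM]] this] show ?thesis .
  qed
  obtain m where m: "filterlim m at_top U"
    "eventually (\<lambda>j. pint p (M j) (restr (cv (m j)) f j) < s + 1 / real (Suc (m j))) U"
    using diagonal[where P="\<lambda>k j. pint p (M j) (restr (cv k) f j) < s + 1 / real (Suc k)"] cv_ev by blast
  define G where "G j = cv (m j) j" for j
  have GM: "G j \<in> sets (M j)" "space (M j) - G j \<in> sets (M j)" for j
    unfolding G_def using cvM by auto
  define g where "g = restr (\<lambda>j. space (M j) - G j) f"
  have g: "fam g" unfolding g_def by (rule fam_restr(1)[OF f]) (rule GM)
  have split: "pint p (M j) (f j) = pint p (M j) (restr G f j) + pint p (M j) (g j)" for j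
  proof -
    have "pint p (M j) (f j) = pint p (M j) (restr (\<lambda>j. G j \<union> (space (M j) - G j)) f j)"
      by (intro Bochner_Integration.integral_cong refl) (auto simp: restr_def)
    moreover have "pint p (M j) (restr (\<lambda>j. G j \<inter> (space (M j) - G j)) f j) = 0"
      by (simp add: restr_def)
    ultimately show ?thesis using pint_restr_Un_Int[OF f GM, of j] by (simp add: g_def)
  qed
  have "upint f \<le> s + 0 + upint g"
  proof (rule tendsto_le[OF proper _ tendsto_upint[OF f]])
    show "((\<lambda>j. s + 1 / real (Suc (m j)) + pint p (M j) (g j)) \<longlongrightarrow> s + 0 + upint g) U"
      by (intro tendsto_add tendsto_const tendsto_upint g filterlim_compose[OF LIMSEQ_Suc[OF lim_1_over_n] m(1)])
    show "eventually (\<lambda>j. pint p (M j) (f j) \<le> s + 1 / real (Suc (m j)) + pint p (M j) (g j)) U"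
      using m(2) by eventually_elim (simp add: split G_def[symmetric] restr_def)
  qed
  moreover have "perp g v" if v: "v \<in> D" for v
  proof -
    note fv = D_fam[OF v]
    \<comment> \<open>On the level set \<open>A\<close> of \<open>v\<close> and outside of \<open>cv n\<close>, the mass of \<open>f\<close> is at most \<open>1 / (n + 1)\<close>;
      outside of \<open>A\<close>, the minimum is at most \<open>\<bar>f\<bar> / (n + 1)\<close>.\<close>
    have bound: "upint (fmin g v) \<le> 1 / real (Suc n) + upint f / real (Suc n)" for n
    proof -
      define A where "A j = level (Suc n) f v j" for j
      have AM: "A j \<in> sets (M j)" for j unfolding A_def using f fv by (rule level_sets)
      have AcM: "A j - cv n j \<in> sets (M j)" for j using AM cvM by auto
      have "upint (restr (\<lambda>j. A j - cv n j) f) \<le> 1 / real (Suc n)"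
      proof -
        have "(\<lambda>j. (A j - cv n j) \<union> cv n j) = (\<lambda>j. A j \<union> cv n j)" "(\<lambda>j. (A j - cv n j) \<inter> cv n j) = (\<lambda>j. {})"
          by auto
        then have "upint (restr (\<lambda>j. A j - cv n j) f) + upint (restr (cv n) f) = upint (restr (\<lambda>j. A j \<union> cv n j) f)"
          using upint_restr_Un_Int[OF f, of "\<lambda>j. A j - cv n j" "cv n", OF AcM cvM] by (simp add: upint_restr_empty)
        also have "\<dots> \<le> upint (restr (cover (insert v (T n)) (max (Suc n) (N n)) f) f)"
        proof (intro upint_restr_mono f covM)
          show "A j \<union> cv n j \<in> sets (M j)" for j using AM cvM by auto
          have "A j \<subseteq> level (max (Suc n) (N n)) f v j" for j unfolding A_def by (rule level_mono) simp
          moreover have "cv n j \<subseteq> cover (insert v (T n)) (max (Suc n) (N n)) f j" for j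
            unfolding cv_def by (rule cover_mono) auto
          ultimately show "A j \<union> cv n j \<subseteq> cover (insert v (T n)) (max (Suc n) (N n)) f j" for j
            by (auto simp: cover_def)
        qed (use T v in auto)
        also have "\<dots> \<le> s" using T v by (intro Ps) auto
        finally show ?thesis using cv_lower[of n] by linarith
      qed
      moreover have "upint (fmin g v) \<le> upint (restr (\<lambda>j. A j - cv n j) f) + upint f / real (Suc n)"
      proof (rule tendsto_le[OF proper _ tendsto_upint[OF fam_fmin[OF g fv]]])
        show "((\<lambda>j. pint p (M j) (restr (\<lambda>j. A j - cv n j) f j) + pint p (M j) (f j) / real (Suc n)) \<longlongrightarrow>
            upint (restr (\<lambda>j. A j - cv n j) f) + upint f / real (Suc n)) U"
          by (intro tendsto_add tendsto_divide tendsto_const tendsto_upint f fam_restr(1)[OF f] AcM) auto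
        have "eventually (\<lambda>j. n \<le> m j) U" using m(1) by (simp add: filterlim_at_top)
        then show "eventually (\<lambda>j. pint p (M j) (fmin g v j) \<le>
            pint p (M j) (restr (\<lambda>j. A j - cv n j) f j) + pint p (M j) (f j) / real (Suc n)) U"
        proof eventually_elim
          case (elim j)
          have sub: "cv n j \<subseteq> G j" unfolding G_def using elim by (rule cv_mono)
          have i1: "integrable (M j) (\<lambda>x. cmod (restr (\<lambda>j. A j - cv n j) f j x) powr p)"
            by (rule Lp_integrable[OF fam_Lp[OF fam_restr(1)[OF f AcM]]])
          have i2: "integrable (M j) (\<lambda>x. cmod (f j x) powr p / real (Suc n))"
            using Lp_integrable[OF fam_Lp[OF f]] by auto
          have pw: "cmod (fmin g v j x) powr p \<le> cmod (restr (\<lambda>j. A j - cv n j) f j x) powr p + cmod (f j x) powr p / real (Suc n)"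
            if x: "x \<in> space (M j)" for x
          proof (cases "x \<in> G j")
            case True
            then show ?thesis by (simp add: fmin_def g_def restr_def)
          next
            case False
            then have gx: "g j x = f j x" using x by (simp add: g_def restr_def)
            show ?thesis
            proof (cases "x \<in> A j")
              case True
              then have "cmod (restr (\<lambda>j. A j - cv n j) f j x) = cmod (f j x)" using False sub by (auto simp: restr_def)
              moreover have "cmod (fmin g v j x) powr p \<le> cmod (f j x) powr p"
                using p by (intro powr_mono2) (auto simp: fmin_def gx)
              ultimately show ?thesis by (simp add: add_increasing2)
            next
              case False
              then have "real (Suc n) * cmod (v j x) \<le> cmod (f j x)" using x by (simp add: A_def level_def)
              then have "real (Suc n) * cmod (fmin g v j x) \<le> cmod (f j x)"
                by (smt (verit) fmin_def min.cobounded2 min.cobounded1 mult_left_mono norm_ge_zero norm_of_real of_nat_0_le_iff)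
              then have "(real (Suc n) * cmod (fmin g v j x)) powr p \<le> cmod (f j x) powr p"
                using p by (intro powr_mono2) auto
              then have "real (Suc n) powr p * cmod (fmin g v j x) powr p \<le> cmod (f j x) powr p"
                by (simp add: powr_mult del: of_nat_Suc)
              moreover have "real (Suc n) powr 1 \<le> real (Suc n) powr p" using p by (intro powr_mono) auto
              then have "real (Suc n) * cmod (fmin g v j x) powr p \<le> real (Suc n) powr p * cmod (fmin g v j x) powr p"
                by (intro mult_right_mono) auto
              ultimately have "cmod (fmin g v j x) powr p \<le> cmod (f j x) powr p / real (Suc n)"
                by (simp add: field_simps)
              then show ?thesis by (simp add: add_increasing)
            qed
          qed
          have "pint p (M j) (fmin g v j) \<le> (LINT x|M j. cmod (restr (\<lambda>j. A j - cv n j) f j x) powr p + cmod (f j x) powr p / real (Suc n))"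
            by (intro integral_mono pw Lp_integrable fam_Lp fam_fmin g fv Bochner_Integration.integrable_add i1 i2)
          also have "\<dots> = pint p (M j) (restr (\<lambda>j. A j - cv n j) f j) + pint p (M j) (f j) / real (Suc n)"
            using i1 i2 by (subst Bochner_Integration.integral_add) auto
          finally show ?case .
        qed
      qed
      ultimately show ?thesis by linarith
    qed
    have "(\<lambda>n. 1 / real (Suc n) + upint f / real (Suc n)) \<longlonglongrightarrow> 0 + 0"
      by (intro tendsto_add LIMSEQ_Suc[OF lim_1_over_n] LIMSEQ_Suc[OF lim_const_over_n])
    then have "upint (fmin g v) \<le> 0" using bound by (intro LIMSEQ_le_const[of _ "0"]) auto
    then show ?thesis using upint_nonneg[OF fam_fmin[OF g fv]] by (simp add: perp_def)
  qed
  then have "upint g = 0" using D_max[OF g] p by (simp add: upint_eq[OF g])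
  ultimately show ?thesis using sc by simp
qed

section \<open>The ultraproduct as a direct sum of Loeb spaces\<close>

definition loeb_sum :: "(('j \<Rightarrow> 'x \<Rightarrow> complex) \<times> ('j \<Rightarrow> 'x)) measure" where
  "loeb_sum = dsum D \<nu>"

definition J :: "('j \<Rightarrow> 'x \<Rightarrow> complex) \<Rightarrow> ('j \<Rightarrow> 'x \<Rightarrow> complex) \<times> ('j \<Rightarrow> 'x) \<Rightarrow> complex" where
  "J f z = component f (fst z) (snd z)"

lemma J_measurable: "fam f \<Longrightarrow> J f \<in> borel_measurable loeb_sum"
  unfolding loeb_sum_def measurable_dsum_iff J_def by (auto intro: component_measurable D_fam)

text \<open>
  The integral on the left is the sum over \<open>u \<in> D\<close> of the limits of the masses of \<open>f\<close> on the level sets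
  for \<open>u\<close>. Its finite partial sums are limits of masses on covers, which do not exceed the mass of
  \<open>f\<close> and exhaust it.
\<close>

lemma nn_integral_J:
  assumes f: "fam f"
  shows "(\<integral>\<^sup>+z. ennreal (cmod (J f z) powr p) \<partial>loeb_sum) = ennreal (upint f)"
proof -
  define a where "a u n = ennreal (upint (restr (level n f u) f))" for u n
  have meas: "(\<lambda>z. ennreal (cmod (J f z) powr p)) \<in> borel_measurable loeb_sum"
    using J_measurable[OF f] by measurable
  have eq: "(\<integral>\<^sup>+z. ennreal (cmod (J f z) powr p) \<partial>loeb_sum) = (\<integral>\<^sup>+u. (SUP n. a u n) \<partial>count_space D)"
    unfolding loeb_sum_def nn_integral_dsum[OF meas[unfolded loeb_sum_def]] a_def
    by (intro nn_integral_cong) (auto simp: J_def nn_integral_component[OF f] D_fam)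
  have inc: "incseq (a u)" if "u \<in> D" for u
    unfolding a_def incseq_def using D_fam[OF that] f
    by (auto intro!: ennreal_leI upint_restr_mono level_sets level_mono)
  have sum: "(\<Sum>u\<in>S. a u n) = ennreal (upint (restr (cover S n f) f))" if "finite S" "S \<subseteq> D" for S n
    unfolding a_def
  proof (subst upint_cover[OF f])
    show "\<forall>u\<in>S. fam u" "\<forall>u\<in>S. \<forall>v\<in>S. u \<noteq> v \<longrightarrow> perp u v"
      using that(2) by (auto intro: D_fam D_perp)
    show "(\<Sum>u\<in>S. ennreal (upint (restr (level n f u) f))) = ennreal (\<Sum>u\<in>S. upint (restr (level n f u) f))"
      using that(2) by (intro sum_ennreal upint_nonneg fam_restr(1)[OF f] level_sets f) (auto intro: D_fam)
  qed fact
  show ?thesis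
  proof (rule antisym)
    show "(\<integral>\<^sup>+z. ennreal (cmod (J f z) powr p) \<partial>loeb_sum) \<le> ennreal (upint f)"
      unfolding eq
    proof (rule nn_integral_count_space_le)
      fix S assume S: "finite S" "S \<subseteq> D"
      have "(\<Sum>u\<in>S. SUP n. a u n) = (SUP n. \<Sum>u\<in>S. a u n)"
        using S inc by (intro ennreal_SUP_sum[symmetric]) auto
      also have "\<dots> \<le> ennreal (upint f)"
        unfolding sum[OF S] using S D_fam
        by (intro SUP_least ennreal_leI fam_restr(2)[OF f] cover_sets f) auto
      finally show "(\<Sum>u\<in>S. SUP n. a u n) \<le> ennreal (upint f)" .
    qed
    show "ennreal (upint f) \<le> (\<integral>\<^sup>+z. ennreal (cmod (J f z) powr p) \<partial>loeb_sum)"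
    proof (cases "\<integral>\<^sup>+z. ennreal (cmod (J f z) powr p) \<partial>loeb_sum")
      case (real c)
      have "upint f \<le> c"
      proof (rule upint_le_covers[OF f])
        fix S n assume S: "finite S" "S \<subseteq> D"
        have "ennreal (upint (restr (cover S n f) f)) \<le> (\<Sum>u\<in>S. SUP n. a u n)"
          unfolding sum[OF S, symmetric] by (intro sum_mono SUP_upper) auto
        also have "\<dots> \<le> ennreal c"
          unfolding real(2)[symmetric] eq by (rule sum_le_nn_integral_count_space[OF S])
        finally show "upint (restr (cover S n f) f) \<le> c" using real(1) by simp
      qed
      then show ?thesis unfolding real(2) by (rule ennreal_leI)
    qed simp
  qed
qed

lemma J_Lp:
  assumes f: "fam f"
  shows "J f \<in> Lp p loeb_sum" "pnorm p loeb_sum (J f) = unorm f"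
proof -
  show L: "J f \<in> Lp p loeb_sum"
    unfolding Lp_iff using nn_integral_J[OF f] J_measurable[OF f]
    by (auto intro!: integrableI_nonneg)
  have "ennreal (pint p loeb_sum (J f)) = ennreal (upint f)"
    unfolding nn_integral_J[OF f, symmetric] using L by (intro nn_integral_eq_integral[symmetric]) (auto simp: Lp_iff)
  then have "pint p loeb_sum (J f) = upint f" using upint_nonneg[OF f] by (simp add: pint_nonneg)
  then show "pnorm p loeb_sum (J f) = unorm f"
    unfolding pnorm_def using p unorm_nonneg[OF f] by (simp add: upint_eq[OF f] powr_powr)
qed

lemma AE_loeb_sumI:
  assumes "a \<in> borel_measurable loeb_sum" "b \<in> borel_measurable loeb_sum"
    and "\<And>u. u \<in> D \<Longrightarrow> AE x in \<nu> u. a (u, x) = (b (u, x) :: complex)"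
  shows "AE z in loeb_sum. a z = b z"
proof -
  have "{z \<in> space loeb_sum. \<not> a z = b z} \<in> sets loeb_sum" using assms(1,2) by measurable
  then show ?thesis using assms(3) unfolding loeb_sum_def by (rule AE_dsum)
qed

lemma J_add:
  assumes f: "fam f" and g: "fam g"
  shows "AE z in loeb_sum. J (\<lambda>j x. f j x + g j x) z = J f z + J g z"
proof (rule AE_loeb_sumI)
  show "J (\<lambda>j x. f j x + g j x) \<in> borel_measurable loeb_sum" "(\<lambda>z. J f z + J g z) \<in> borel_measurable loeb_sum"
    using J_measurable[OF fam_add[OF assms]] J_measurable[OF f] J_measurable[OF g] by measurable
qed (use component_add[OF f g D_fam] in \<open>simp add: J_def\<close>)

lemma J_cmult:
  assumes f: "fam f"
  shows "AE z in loeb_sum. J (\<lambda>j x. c * f j x) z = c * J f z"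
proof (rule AE_loeb_sumI)
  show "J (\<lambda>j x. c * f j x) \<in> borel_measurable loeb_sum" "(\<lambda>z. c * J f z) \<in> borel_measurable loeb_sum"
    using J_measurable[OF fam_cmult(1)[OF f]] J_measurable[OF f] by measurable
qed (use component_cmult[OF f D_fam] in \<open>simp add: J_def\<close>)

end

section \<open>Completeness of the ultraproduct and surjectivity\<close>

context Lp_ultraproduct
begin

text \<open>
  Bounded families are complete by saturation, which provides indices \<open>m j\<close>
  tending to infinity such that the Cauchy estimates up to \<open>m j\<close> hold for the components with index
  \<open>j\<close>, and the limit is formed by the components \<open>F (m j) j\<close>.
\<close>

lemma fam_limit:
  assumes F: "\<And>n. fam (F n)"
    and cauchy: "\<And>n k. unorm (\<lambda>j x. F n j x - F k j x) \<le> 1 / real (Suc n) + 1 / real (Suc k)"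
  obtains f where "fam f" "\<And>n. unorm (\<lambda>j x. F n j x - f j x) \<le> 4 / real (Suc n)"
proof -
  \<comment> \<open>The numerator \<open>2\<close> instead of \<open>1\<close> leaves room for a strict inequality in the limit.\<close>
  define Q where "Q k j \<longleftrightarrow> (\<forall>n\<in>{..k}. pnorm p (M j) (\<lambda>x. F n j x - F k j x) \<le> 1 / real (Suc n) + 2 / real (Suc k))" for k j
  have "eventually (Q k) U" for k
    unfolding Q_def
  proof (subst eventually_ball_finite_distrib)
    have "eventually (\<lambda>j. pnorm p (M j) (\<lambda>x. F n j x - F k j x) < 1 / real (Suc n) + 2 / real (Suc k)) U" for n
    proof (rule order_tendstoD(2)[OF tendsto_unorm[OF fam_diff[OF F F]]])
      have "1 / real (Suc k) < 2 / real (Suc k)" by (intro divide_strict_right_mono) auto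
      then show "unorm (\<lambda>j x. F n j x - F k j x) < 1 / real (Suc n) + 2 / real (Suc k)"
        using cauchy[of n k] by linarith
    qed
    then show "\<forall>n\<in>{..k}. eventually (\<lambda>j. pnorm p (M j) (\<lambda>x. F n j x - F k j x) \<le> 1 / real (Suc n) + 2 / real (Suc k)) U"
      by (intro ballI) (rule eventually_mono, assumption, rule less_imp_le)
  qed simp
  then obtain m where m: "filterlim m at_top U" "eventually (\<lambda>j. Q (m j) j) U"
    using diagonal[of Q] by blast
  define f where "f j = F (m j) j" for j
  have fL: "f j \<in> Lp p (M j)" for j unfolding f_def by (rule fam_Lp[OF F])
  have ev: "eventually (\<lambda>j. pnorm p (M j) (\<lambda>x. F n j x - f j x) \<le> 4 / real (Suc n)) U" for n
  proof -
    have "eventually (\<lambda>j. n \<le> m j) U" using m(1) by (simp add: filterlim_at_top)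
    with m(2) show ?thesis
    proof eventually_elim
      case (elim j)
      then have "pnorm p (M j) (\<lambda>x. F n j x - f j x) \<le> 1 / real (Suc n) + 2 / real (Suc (m j))"
        by (auto simp: Q_def f_def)
      also have "\<dots> \<le> 1 / real (Suc n) + 2 / real (Suc n)"
        using elim by (intro add_left_mono divide_left_mono) auto
      also have "\<dots> \<le> 4 / real (Suc n)"
        by (simp add: add_divide_distrib[symmetric] divide_right_mono)
      finally show ?case .
    qed
  qed
  have "fam (\<lambda>j x. F 0 j x - f j x)"
    by (rule famI[OF _ ev[of 0]]) (intro Lp_diff p fam_Lp[OF F] fL)
  from fam_diff[OF F[of 0] this] have f: "fam f" by simp
  moreover have "unorm (\<lambda>j x. F n j x - f j x) \<le> 4 / real (Suc n)" for n
    by (rule tendsto_upperbound[OF tendsto_unorm[OF fam_diff[OF F f]] ev proper])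
  ultimately show thesis using that by blast
qed

end

context Lp_ultraproduct_basis
begin

lemma J_diff:
  assumes f: "fam f" and g: "fam g"
  shows "AE z in loeb_sum. J (\<lambda>j x. f j x - g j x) z = J f z - J g z"
  using J_add[OF f fam_cmult(1)[OF g, of "-1"]] J_cmult[OF g, of "-1"]
  by eventually_elim simp

lemma pnorm_J_diff:
  assumes f: "fam f" and g: "fam g"
  shows "pnorm p loeb_sum (\<lambda>z. J f z - J g z) = unorm (\<lambda>j x. f j x - g j x)"
proof -
  have "pnorm p loeb_sum (J (\<lambda>j x. f j x - g j x)) = pnorm p loeb_sum (\<lambda>z. J f z - J g z)"
    using J_measurable[OF fam_diff[OF assms]] borel_measurable_diff[OF J_measurable[OF f] J_measurable[OF g]]
    by (intro pnorm_cong_AE J_diff assms)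
  then show ?thesis using J_Lp(2)[OF fam_diff[OF assms]] by simp
qed

definition in_range :: "(('j \<Rightarrow> 'x \<Rightarrow> complex) \<times> ('j \<Rightarrow> 'x) \<Rightarrow> complex) \<Rightarrow> bool" where
  "in_range \<xi> \<longleftrightarrow> \<xi> \<in> borel_measurable loeb_sum \<and> (\<exists>f. fam f \<and> (AE z in loeb_sum. J f z = \<xi> z))"

lemma in_range_J: "fam f \<Longrightarrow> in_range (J f)"
  by (auto simp: in_range_def J_measurable)

lemma in_range_cong:
  assumes "in_range \<xi>" "\<eta> \<in> borel_measurable loeb_sum" "AE z in loeb_sum. \<xi> z = \<eta> z"
  shows "in_range \<eta>"
proof -
  obtain f where "fam f" "AE z in loeb_sum. J f z = \<xi> z" using assms(1) by (auto simp: in_range_def)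
  moreover from this(2) assms(3) have "AE z in loeb_sum. J f z = \<eta> z" by eventually_elim simp
  ultimately show ?thesis using assms(2) by (auto simp: in_range_def)
qed

lemma in_range_add:
  assumes "in_range \<xi>" "in_range \<eta>" shows "in_range (\<lambda>z. \<xi> z + \<eta> z)"
proof -
  obtain f g where f: "fam f" "AE z in loeb_sum. J f z = \<xi> z" and g: "fam g" "AE z in loeb_sum. J g z = \<eta> z"
    using assms by (auto simp: in_range_def)
  have "AE z in loeb_sum. J (\<lambda>j x. f j x + g j x) z = \<xi> z + \<eta> z"
    using J_add[OF f(1) g(1)] f(2) g(2) by eventually_elim simp
  then show ?thesis
    using assms by (auto simp: in_range_def intro!: exI[of _ "\<lambda>j x. f j x + g j x"] fam_add f g)
qed

lemma in_range_cmult: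
  assumes "in_range \<xi>" shows "in_range (\<lambda>z. c * \<xi> z)"
proof -
  obtain f where f: "fam f" "AE z in loeb_sum. J f z = \<xi> z"
    using assms by (auto simp: in_range_def)
  have "AE z in loeb_sum. J (\<lambda>j x. c * f j x) z = c * \<xi> z"
    using J_cmult[OF f(1)] f(2) by eventually_elim simp
  then show ?thesis
    using assms by (auto simp: in_range_def intro!: exI[of _ "\<lambda>j x. c * f j x"] fam_cmult f)
qed

lemma in_range_zero: "in_range (\<lambda>z. 0)"
  using in_range_cmult[OF in_range_J[OF fam_zero], of 0] by simp

lemma in_range_sum:
  "finite S \<Longrightarrow> (\<And>y. y \<in> S \<Longrightarrow> in_range (\<xi> y)) \<Longrightarrow> in_range (\<lambda>z. \<Sum>y\<in>S. \<xi> y z)"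
  by (induction S rule: finite_induct) (auto intro: in_range_zero in_range_add)

text \<open>
  The map \<open>J\<close> is isometric and its domain is complete.
\<close>

lemma in_range_closed:
  assumes \<xi>: "\<xi> \<in> Lp p loeb_sum"
    and approx: "\<And>e. 0 < e \<Longrightarrow> \<exists>\<eta>. in_range \<eta> \<and> pnorm p loeb_sum (\<lambda>z. \<eta> z - \<xi> z) < e"
  shows "in_range \<xi>"
proof -
  have "\<exists>f. fam f \<and> pnorm p loeb_sum (\<lambda>z. J f z - \<xi> z) < 1 / real (Suc n)" for n
  proof -
    obtain \<eta> where \<eta>: "in_range \<eta>" "pnorm p loeb_sum (\<lambda>z. \<eta> z - \<xi> z) < 1 / real (Suc n)"
      using approx[of "1 / real (Suc n)"] by auto
    then obtain f where f: "fam f" "AE z in loeb_sum. J f z = \<eta> z" by (auto simp: in_range_def)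
    have "pnorm p loeb_sum (\<lambda>z. J f z - \<xi> z) = pnorm p loeb_sum (\<lambda>z. \<eta> z - \<xi> z)"
    proof (rule pnorm_cong_AE)
      show "(\<lambda>z. J f z - \<xi> z) \<in> borel_measurable loeb_sum" "(\<lambda>z. \<eta> z - \<xi> z) \<in> borel_measurable loeb_sum"
        using J_measurable[OF f(1)] \<eta>(1) \<xi> by (auto simp: in_range_def Lp_iff)
    qed (use f(2) in \<open>eventually_elim, simp\<close>)
    then show ?thesis using f \<eta> by auto
  qed
  then obtain F where F: "\<And>n. fam (F n)" "\<And>n. pnorm p loeb_sum (\<lambda>z. J (F n) z - \<xi> z) < 1 / real (Suc n)" by metis
  have d: "(\<lambda>z. J (F n) z - \<xi> z) \<in> Lp p loeb_sum" for n by (intro Lp_diff p J_Lp F \<xi>)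
  have d': "pnorm p loeb_sum (\<lambda>z. \<xi> z - J (F n) z) < 1 / real (Suc n)" for n
    using pnorm_cmult[OF p, of loeb_sum "-1" "\<lambda>z. J (F n) z - \<xi> z"] F(2)[of n] by simp
  have "unorm (\<lambda>j x. F n j x - F k j x) \<le> 1 / real (Suc n) + 1 / real (Suc k)" for n k
  proof -
    have "unorm (\<lambda>j x. F n j x - F k j x) = pnorm p loeb_sum (\<lambda>z. (J (F n) z - \<xi> z) + (\<xi> z - J (F k) z))"
      using pnorm_J_diff[OF F(1) F(1)] by simp
    also have "\<dots> \<le> pnorm p loeb_sum (\<lambda>z. J (F n) z - \<xi> z) + pnorm p loeb_sum (\<lambda>z. \<xi> z - J (F k) z)"
      by (intro minkowski p Lp_diff J_Lp F \<xi>)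
    finally show ?thesis using F(2)[of n] d'[of k] by linarith
  qed
  from fam_limit[of F, OF F(1) this] obtain f where f: "fam f" "\<And>n. unorm (\<lambda>j x. F n j x - f j x) \<le> 4 / real (Suc n)"
    by metis
  have bound: "pnorm p loeb_sum (\<lambda>z. J f z - \<xi> z) \<le> 5 / real (Suc n)" for n
  proof -
    have "pnorm p loeb_sum (\<lambda>z. J f z - J (F n) z) = pnorm p loeb_sum (\<lambda>z. J (F n) z - J f z)"
      using pnorm_cmult[OF p, of loeb_sum "-1" "\<lambda>z. J (F n) z - J f z"] by simp
    also have "\<dots> \<le> 4 / real (Suc n)" unfolding pnorm_J_diff[OF F(1) f(1)] by (rule f(2))
    finally have "pnorm p loeb_sum (\<lambda>z. J f z - J (F n) z) \<le> 4 / real (Suc n)" .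
    moreover have "pnorm p loeb_sum (\<lambda>z. (J f z - J (F n) z) + (J (F n) z - \<xi> z)) \<le>
        pnorm p loeb_sum (\<lambda>z. J f z - J (F n) z) + pnorm p loeb_sum (\<lambda>z. J (F n) z - \<xi> z)"
      by (intro minkowski p Lp_diff J_Lp F f \<xi>)
    ultimately have "pnorm p loeb_sum (\<lambda>z. J f z - \<xi> z) \<le> 4 / real (Suc n) + 1 / real (Suc n)"
      using F(2)[of n] by simp
    then show ?thesis by (simp add: add_divide_distrib[symmetric])
  qed
  have "pnorm p loeb_sum (\<lambda>z. J f z - \<xi> z) \<le> 0"
    by (rule LIMSEQ_le_const[OF LIMSEQ_Suc[OF lim_const_over_n[of 5]]]) (use bound in simp)
  then have "pnorm p loeb_sum (\<lambda>z. J f z - \<xi> z) = 0" using pnorm_nonneg[of p loeb_sum] by (simp add: antisym)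
  then have "AE z in loeb_sum. J f z - \<xi> z = 0"
    by (subst (asm) pnorm_eq_0_iff) (auto intro: Lp_diff p J_Lp f \<xi>)
  then show ?thesis using f(1) \<xi> by (auto simp: in_range_def Lp_iff)
qed

lemma emeasure_loeb_sum:
  "A \<in> sets loeb_sum \<Longrightarrow> emeasure loeb_sum A = (\<integral>\<^sup>+u. emeasure (\<nu> u) (Pair u -` A) \<partial>count_space D)"
  unfolding loeb_sum_def by (rule emeasure_dsum)

lemma sets_loeb_sum: "A \<in> sets loeb_sum \<longleftrightarrow> A \<subseteq> D \<times> points \<and> (\<forall>u\<in>D. Pair u -` A \<in> sets (\<nu> u))"
  by (auto simp: loeb_sum_def sets_dsum)

lemma section_in_sets_loeb_sum:
  assumes "u \<in> D" "S \<in> sets (\<nu> u)"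
  shows "{u} \<times> S \<in> sets loeb_sum"
proof -
  have "Pair v -` ({u} \<times> S) = (if v = u then S else {})" for v by auto
  then show ?thesis unfolding sets_loeb_sum using assms sets.sets_into_space[OF assms(2)] by auto
qed

lemma emeasure_loeb_sum_finite_union:
  assumes A: "A \<in> sets loeb_sum" and S: "finite S" "S \<subseteq> D"
  shows "A \<inter> S \<times> UNIV \<in> sets loeb_sum" "emeasure loeb_sum (A \<inter> S \<times> UNIV) = (\<Sum>u\<in>S. emeasure (\<nu> u) (Pair u -` A))"
proof -
  have v: "Pair u -` (A \<inter> S \<times> UNIV) = (if u \<in> S then Pair u -` A else {})" for u by auto
  show m: "A \<inter> S \<times> UNIV \<in> sets loeb_sum"
    using A unfolding sets_loeb_sum v by auto
  show "emeasure loeb_sum (A \<inter> S \<times> UNIV) = (\<Sum>u\<in>S. emeasure (\<nu> u) (Pair u -` A))"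
    unfolding emeasure_loeb_sum[OF m] v using S by (subst nn_integral_count_space'[of S]) auto
qed

lemma Lp_indicator:
  assumes "A \<in> sets loeb_sum" "emeasure loeb_sum A < \<infinity>"
  shows "(\<lambda>z. indicator A z) \<in> Lp p loeb_sum"
proof -
  have "(\<lambda>z. cmod (indicator A z) powr p) = (\<lambda>z. indicat_real A z)" by (auto simp: indicator_def)
  then show ?thesis using assms by (auto simp: Lp_iff)
qed

lemma emeasure_loeb_sum_section_finite:
  assumes "u \<in> D" "S \<in> sets (\<nu> u)"
  shows "emeasure loeb_sum ({u} \<times> S) < \<infinity>"
proof -
  have "emeasure loeb_sum ({u} \<times> S \<inter> {u} \<times> UNIV) = (\<Sum>v\<in>{u}. emeasure (\<nu> v) (Pair v -` ({u} \<times> S)))"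
    using assms by (intro emeasure_loeb_sum_finite_union section_in_sets_loeb_sum) auto
  also have "\<dots> < \<infinity>"
    using finite_measure.emeasure_finite[OF finite_measure_loeb[OF bounded_family_weight[OF D_fam[OF assms(1)]]]]
    by (simp add: less_top)
  also have "{u} \<times> S \<inter> {u} \<times> UNIV = {u} \<times> S" by auto
  finally show ?thesis .
qed

text \<open>
  The lift is \<open>u\<close> restricted to \<open>B\<close>. Its component along \<open>u\<close> is the indicator of the internal set,
  except where \<open>u\<close> vanishes, which is a null set for \<open>\<nu> u\<close>; its other components vanish almost
  everywhere by orthogonality.
\<close>

lemma in_range_internal:
  assumes u: "u \<in> D" and B: "\<And>j. B j \<in> sets (M j)"
  shows "in_range (\<lambda>z. indicator ({u} \<times> internal B) z)"
proof -
  let ?f = "restr B u"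
  have f: "fam ?f" by (rule fam_restr(1)[OF D_fam[OF u] B])
  have mZ: "(\<lambda>z. indicator ({u} \<times> internal B) z :: complex) \<in> borel_measurable loeb_sum"
    by (intro borel_measurable_indicator section_in_sets_loeb_sum u internal_in_sets_loeb B)
  have "AE x in \<nu> v. J ?f (v, x) = indicator ({u} \<times> internal B) (v, x)" if v: "v \<in> D" for v
  proof (cases "v = u")
    case True
    define Z where "Z j = {x \<in> space (M j). u j x = 0}" for j
    have ZM: "Z j \<in> sets (M j)" for j
      unfolding Z_def using fam_measurable[OF D_fam[OF u], of j] by measurable
    have "upint (restr Z u) = 0"
      using p by (simp add: upint_def restr_def Z_def tendsto_Lim[OF proper] if_distrib cong: if_cong)
    then have "internal Z \<in> null_sets (\<nu> u)"
      using emeasure_\<nu>[OF D_fam[OF u] ZM] internal_in_sets_loeb[OF ZM] by (auto simp: null_sets_def)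
    then have "AE x in \<nu> u. x \<notin> internal Z" by (rule AE_not_in)
    with AE_space have "AE x in \<nu> u. J ?f (u, x) = indicator ({u} \<times> internal B) (u, x)"
    proof eventually_elim
      case (elim x)
      then have x: "x \<in> points" "eventually (\<lambda>j. x j \<in> space (M j)) U" by (auto simp: points_def internal_def)
      have "eventually (\<lambda>j. x j \<notin> Z j) U" using elim by (simp add: internal_def eventually_not_iff)
      with x(2) have nz: "eventually (\<lambda>j. u j (x j) \<noteq> 0) U" by eventually_elim (auto simp: Z_def)
      have "((\<lambda>j. ratio ?f u j (x j)) \<longlongrightarrow> indicator (internal B) x) U"
      proof (cases "x \<in> internal B")
        case True
        then have "eventually (\<lambda>j. x j \<in> B j) U" by (simp add: internal_def)
        with nz have "eventually (\<lambda>j. 1 = ratio ?f u j (x j)) U"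
          by eventually_elim (auto simp: ratio_def restr_def)
        from Lim_transform_eventually[OF tendsto_const this] show ?thesis using True by simp
      next
        case False
        then have "eventually (\<lambda>j. x j \<notin> B j) U" by (simp add: internal_def eventually_not_iff)
        then have "eventually (\<lambda>j. 0 = ratio ?f u j (x j)) U"
          by eventually_elim (auto simp: ratio_def restr_def)
        from Lim_transform_eventually[OF tendsto_const this] show ?thesis using False by simp
      qed
      from componentI(1)[OF x(1) this] show ?case by (simp add: J_def indicator_def)
    qed
    then show ?thesis unfolding True .
  next
    case False
    have pp: "perp u v" using D_perp[OF u v] False by auto
    have "upint (restr (level n ?f v) ?f) = 0" for n
    proof -
      have m: "restr (level n ?f v) ?f j \<in> borel_measurable (M j)" for j
        by (intro restr_measurable f level_sets D_fam v)
      \<comment> \<open>The factor \<open>n + 1\<close> bounds both \<open>1\<close> and \<open>n\<close>, also for \<open>n = 0\<close>.\<close>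
      have fm: "fam (\<lambda>j x. of_nat (Suc n) * fmin u v j x)" "fam (fmin u v)"
        by (intro fam_cmult fam_fmin D_fam u v)+
      have "upint (restr (level n ?f v) ?f) \<le> upint (\<lambda>j x. of_nat (Suc n) * fmin u v j x)"
      proof (rule fam_dominated(2)[OF fm(1) m])
        fix j x
        have "cmod (u j x) \<le> real (Suc n) * cmod (v j x)" if "cmod (u j x) \<le> real n * cmod (v j x)"
          using that by (simp add: algebra_simps add_increasing)
        moreover have "cmod (u j x) \<le> real (Suc n) * cmod (u j x)" by (simp add: algebra_simps)
        ultimately show "cmod (restr (level n ?f v) ?f j x) \<le> cmod (of_nat (Suc n) * fmin u v j x)"
          by (auto simp: restr_def level_def norm_mult fmin_def min_def simp del: of_nat_Suc)
      qed
      also have "\<dots> = real (Suc n) powr p * upint (fmin u v)"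
        using fam_cmult(2)[OF fm(2), of "of_nat (Suc n)"] fm unorm_nonneg[OF fm(2)]
        by (simp add: upint_eq powr_mult del: of_nat_Suc)
      also have "\<dots> = 0" using pp by (simp add: perp_def)
      finally show ?thesis
        using upint_nonneg[OF fam_restr(1)[OF f, of "level n ?f v", OF level_sets[OF f D_fam[OF v]]]] by simp
    qed
    then have "(\<integral>\<^sup>+x. ennreal (cmod (component ?f v x) powr p) \<partial>\<nu> v) = 0"
      unfolding nn_integral_component[OF f D_fam[OF v]] by simp
    then have "AE x in \<nu> v. ennreal (cmod (component ?f v x) powr p) = 0"
      using component_measurable[OF f D_fam[OF v]] by (subst (asm) nn_integral_0_iff_AE) auto
    then show ?thesis by eventually_elim (use False in \<open>auto simp: J_def\<close>)
  qed
  from AE_loeb_sumI[OF J_measurable[OF f] mZ this] show ?thesis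
    using f mZ by (auto simp: in_range_def)
qed

lemma in_range_dominated_limit:
  assumes \<xi>: "\<xi> \<in> Lp p loeb_sum" and s: "\<And>i. in_range (s i)"
    and lim: "\<And>x. x \<in> space loeb_sum \<Longrightarrow> (\<lambda>i. s i x) \<longlonglongrightarrow> \<xi> x"
    and bd: "\<And>i x. x \<in> space loeb_sum \<Longrightarrow> cmod (s i x) \<le> 2 * cmod (\<xi> x)"
  shows "in_range \<xi>"
proof (rule in_range_closed[OF \<xi>])
  fix e :: real assume "0 < e"
  have sm: "s i \<in> borel_measurable loeb_sum" for i using s[of i] by (simp add: in_range_def)
  have "eventually (\<lambda>i. pnorm p loeb_sum (\<lambda>x. s i x - \<xi> x) < e) sequentially"
    using order_tendstoD(2)[OF pnorm_dominated_convergence(1)[OF p \<xi> sm lim bd]] \<open>0 < e\<close> by blast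
  then obtain i where "pnorm p loeb_sum (\<lambda>x. s i x - \<xi> x) < e" by (auto simp: eventually_sequentially)
  then show "\<exists>\<eta>. in_range \<eta> \<and> pnorm p loeb_sum (\<lambda>z. \<eta> z - \<xi> z) < e" using s by blast
qed

text \<open>
  The internal sets are closed under intersections and generate the \<open>\<sigma>\<close>-algebra, and the sets whose
  indicators are in the range form a Dynkin system, since \<open>\<nu> u\<close> is finite.
\<close>

lemma in_range_section:
  assumes u: "u \<in> D" and S: "S \<in> sets (\<nu> u)"
  shows "in_range (\<lambda>z. indicator ({u} \<times> S) z)"
proof -
  have in_sets: "A \<in> sets (\<nu> u)" if "A \<in> sigma_sets points internal_sets" for A
    using that by (simp add: sets_loeb)
  from S have "S \<in> sigma_sets points internal_sets" by (simp add: sets_loeb)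
  with Int_stable_internal_sets internal_sets_into_points show ?thesis
  proof (induction rule: sigma_sets_induct_disjoint)
    case (basic A)
    then show ?case using in_range_internal[OF u] by (auto simp: internal_sets_def)
  next
    case empty
    then show ?case using in_range_zero by simp
  next
    case (compl A)
    have "in_range (\<lambda>z. indicator ({u} \<times> points) z)"
      using in_range_internal[OF u, of "\<lambda>j. space (M j)"] by (simp add: points_def)
    from in_range_add[OF this in_range_cmult[OF compl(2), of "-1"]]
    have "in_range (\<lambda>z. indicator ({u} \<times> points) z - indicator ({u} \<times> A) z)" by simp
    moreover have "A \<subseteq> points" using sets.sets_into_space[OF in_sets[OF compl(1)]] by simp
    then have "(\<lambda>z. indicator ({u} \<times> points) z - indicator ({u} \<times> A) z :: complex) = (\<lambda>z. indicator ({u} \<times> (points - A)) z)"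
      by (auto simp: indicator_def fun_eq_iff)
    ultimately show ?case by simp
  next
    case (union A)
    have r1: "in_range (\<lambda>z. indicator (\<Union>i<n. {u} \<times> A i) z)" for n :: nat
    proof (induction n)
      case 0
      then show ?case using in_range_zero by simp
    next
      case (Suc n)
      have "A i \<inter> A n = {}" if "i < n" for i using union(1) that by (auto simp: disjoint_family_on_def)
      then have "(\<lambda>z. indicator (\<Union>i<Suc n. {u} \<times> A i) z :: complex) =
          (\<lambda>z. indicator (\<Union>i<n. {u} \<times> A i) z + indicator ({u} \<times> A n) z)"
        by (auto simp: indicator_def fun_eq_iff less_Suc_eq)
      then show ?case using in_range_add[OF Suc union(3)[of n]] by simp
    qed
    have r2: "(\<lambda>z. indicator (\<Union>i. {u} \<times> A i) z) \<in> Lp p loeb_sum"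
    proof -
      have "(\<Union>i. {u} \<times> A i) = {u} \<times> (\<Union>i. A i)" by auto
      moreover have "(\<Union>i. A i) \<in> sets (\<nu> u)" using union(2) in_sets by (intro sets.countable_UN) auto
      ultimately show ?thesis using u by (auto intro!: Lp_indicator section_in_sets_loeb_sum emeasure_loeb_sum_section_finite)
    qed
    have "in_range (\<lambda>z. indicator (\<Union>i. {u} \<times> A i) z)"
      by (rule in_range_dominated_limit[OF r2 r1])
        (rule LIMSEQ_indicator_UN, auto simp: indicator_def)
    moreover have "(\<Union>i. {u} \<times> A i) = {u} \<times> (\<Union>i. A i)" by auto
    ultimately show ?case by simp
  qed
qed

text \<open>
  A set of finite measure is approximated by its intersection with finitely many summands.
\<close>

lemma in_range_indicator:
  assumes A: "A \<in> sets loeb_sum" and fin: "emeasure loeb_sum A < \<infinity>"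
  shows "in_range (\<lambda>z. indicator A z)"
proof (rule in_range_closed)
  show "(\<lambda>z. indicator A z) \<in> Lp p loeb_sum" by (rule Lp_indicator[OF assms])
  fix e :: real assume e: "0 < e"
  \<comment> \<open>The norm of an indicator is the \<open>p\<close>-th root of the measure of the set.\<close>
  define d where "d = (e / 2) powr p"
  have d: "0 < d" using e by (simp add: d_def)
  obtain a where a: "emeasure loeb_sum A = ennreal a" "0 \<le> a" using fin by (cases "emeasure loeb_sum A") auto
  have "\<exists>S. finite S \<and> S \<subseteq> D \<and> ennreal a < (\<Sum>u\<in>S. emeasure (\<nu> u) (Pair u -` A)) + ennreal d"
  proof (rule ccontr)
    assume "\<not> ?thesis"
    then have n: "(\<Sum>u\<in>S. emeasure (\<nu> u) (Pair u -` A)) + ennreal d \<le> ennreal a" if "finite S" "S \<subseteq> D" for S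
      using that by (auto simp: not_less)
    from n[of "{}"] have da: "d \<le> a" using a d by simp
    have "ennreal a \<le> ennreal (a - d)"
      unfolding a(1)[symmetric] emeasure_loeb_sum[OF A]
    proof (rule nn_integral_count_space_le)
      fix S assume S: "finite S" "S \<subseteq> D"
      have "(\<Sum>u\<in>S. emeasure (\<nu> u) (Pair u -` A)) + ennreal d \<le> ennreal (a - d) + ennreal d"
        using n[OF S] da d by (simp flip: ennreal_plus)
      then show "(\<Sum>u\<in>S. emeasure (\<nu> u) (Pair u -` A)) \<le> ennreal (a - d)"
        by (simp add: ennreal_add_left_cancel_le add.commute)
    qed
    then show False using d da by simp
  qed
  then obtain S where S: "finite S" "S \<subseteq> D" "ennreal a < (\<Sum>u\<in>S. emeasure (\<nu> u) (Pair u -` A)) + ennreal d" by blast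
  let ?B = "A \<inter> S \<times> UNIV"
  note B = emeasure_loeb_sum_finite_union[OF A S(1,2)]
  have "in_range (\<lambda>z. \<Sum>u\<in>S. indicator ({u} \<times> Pair u -` A) z)"
    using S A by (intro in_range_sum in_range_section) (auto simp: sets_loeb_sum)
  also have "(\<lambda>z. \<Sum>u\<in>S. indicator ({u} \<times> Pair u -` A) z :: complex) = (\<lambda>z. indicator ?B z)"
  proof
    fix z
    have "(\<Sum>u\<in>S. indicator ({u} \<times> Pair u -` A) z :: complex) = (\<Sum>u\<in>S. if u = fst z then indicator A z else 0)"
      by (intro sum.cong) (cases z, auto simp: indicator_def)+
    also have "\<dots> = indicator ?B z" using S(1) by (auto simp: indicator_def mem_Times_iff)
    finally show "(\<Sum>u\<in>S. indicator ({u} \<times> Pair u -` A) z :: complex) = indicator ?B z" .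
  qed
  finally have r: "in_range (\<lambda>z. indicator ?B z)" .
  have fB: "emeasure loeb_sum ?B \<noteq> \<infinity>"
    using emeasure_mono[of ?B A loeb_sum] A fin by auto
  have "pint p loeb_sum (\<lambda>z. indicator ?B z - indicator A z) = (LINT z|loeb_sum. indicat_real (A - ?B) z)"
    by (intro Bochner_Integration.integral_cong) (auto simp: indicator_def)
  also have "\<dots> = measure loeb_sum (A - ?B)"
  proof -
    have "(A - ?B) \<inter> space loeb_sum = A - ?B" using sets.sets_into_space[OF A] by blast
    then show ?thesis by simp
  qed
  also have "\<dots> = measure loeb_sum A - measure loeb_sum ?B"
    using A B(1) fin by (intro measure_Diff) auto
  also have "\<dots> < d"
  proof -
    obtain b where b: "emeasure loeb_sum ?B = ennreal b" "0 \<le> b" using fB by (cases "emeasure loeb_sum ?B") auto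
    have "ennreal a < ennreal (b + d)" using S(3) b d unfolding B(2)[symmetric] by simp
    then have "a < b + d" using a b d by (subst (asm) ennreal_less_iff) auto
    then show ?thesis using a b by (simp add: measure_def)
  qed
  finally have "pnorm p loeb_sum (\<lambda>z. indicator ?B z - indicator A z) \<le> e / 2"
    using e p unfolding d_def by (subst pnorm_le_iff) auto
  then show "\<exists>\<eta>. in_range \<eta> \<and> pnorm p loeb_sum (\<lambda>z. \<eta> z - indicator A z) < e"
    using e r by (intro exI[of _ "\<lambda>z. indicator ?B z"]) auto
qed

theorem J_surj:
  assumes \<xi>: "\<xi> \<in> Lp p loeb_sum"
  obtains f where "fam f" "AE z in loeb_sum. J f z = \<xi> z"
proof -
  obtain s where s: "\<And>i. simple_function loeb_sum (s i)" "\<And>x. x \<in> space loeb_sum \<Longrightarrow> (\<lambda>i. s i x) \<longlonglongrightarrow> \<xi> x"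
    "\<And>i x. x \<in> space loeb_sum \<Longrightarrow> cmod (s i x) \<le> 2 * cmod (\<xi> x)"
  proof -
    have "\<xi> \<in> borel_measurable loeb_sum" using \<xi> by (simp add: Lp_iff)
    from borel_measurable_implies_sequence_metric[OF this, of 0] show thesis
      using that unfolding dist_0_norm dist_commute[of _ "0::complex"] by blast
  qed
  have sm: "s i \<in> borel_measurable loeb_sum" for i using s(1) by (rule borel_measurable_simple_function)
  have sL: "s i \<in> Lp p loeb_sum" for i by (rule pnorm_dominated_convergence(2)[OF p \<xi> sm s(2,3)])
  have "in_range (s i)" for i
  proof -
    let ?A = "\<lambda>y. s i -` {y} \<inter> space loeb_sum"
    have "in_range (\<lambda>z. y * indicator (?A y) z)" for y
    proof (cases "y = 0")
      case False
      have A: "?A y \<in> sets loeb_sum" using simple_functionD(2)[OF s(1)] .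
      have "(\<lambda>z. y * indicator (?A y) z) \<in> Lp p loeb_sum"
      proof (rule Lp_dominated(1)[OF p sL[of i]])
        show "(\<lambda>z. y * indicator (?A y) z) \<in> borel_measurable loeb_sum"
          by (intro borel_measurable_times borel_measurable_const borel_measurable_indicator A)
      qed (auto simp: indicator_def)
      then have "(\<lambda>z. inverse y * (y * indicator (?A y) z)) \<in> Lp p loeb_sum" by (rule Lp_cmult)
      then have "integrable loeb_sum (\<lambda>z. cmod (indicator (?A y) z) powr p)"
        using False by (simp add: Lp_iff mult.assoc[symmetric] del: mult.assoc)
      moreover have "(\<lambda>z. cmod (indicator (?A y) z) powr p) = (\<lambda>z. indicat_real (?A y) z)" by (auto simp: indicator_def)
      ultimately have "emeasure loeb_sum (?A y) < \<infinity>" using A by (simp add: integrable_indicator_iff)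
      then show ?thesis by (intro in_range_cmult in_range_indicator A)
    qed (simp add: in_range_zero)
    then have "in_range (\<lambda>z. \<Sum>y\<in>s i ` space loeb_sum. y * indicator (?A y) z)"
      using simple_functionD(1)[OF s(1)] by (intro in_range_sum) auto
    moreover have "AE z in loeb_sum. (\<Sum>y\<in>s i ` space loeb_sum. y * indicator (?A y) z) = s i z"
    proof (rule AE_I2)
      fix z assume "z \<in> space loeb_sum"
      then have "(\<Sum>y\<in>s i ` space loeb_sum. indicator (?A y) z *\<^sub>R y) = s i z"
        by (rule simple_function_indicator_representation_banach[OF s(1), symmetric])
      moreover have "y * indicator (?A y) z = indicator (?A y) z *\<^sub>R y" for y
        by (cases "z \<in> ?A y") auto
      ultimately show "(\<Sum>y\<in>s i ` space loeb_sum. y * indicator (?A y) z) = s i z" by simp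
    qed
    ultimately show ?thesis by (rule in_range_cong[OF _ sm])
  qed
  then have "in_range \<xi>" by (rule in_range_dominated_limit[OF \<xi> _ s(2,3)])
  then show thesis using that by (auto simp: in_range_def)
qed

text \<open>
  Since \<open>J\<close> is an isometry onto this space, completeness is inherited from bounded families.
\<close>

theorem Lp_loeb_sum_complete:
  assumes \<xi>: "\<And>n. \<xi> n \<in> Lp p loeb_sum"
    and cauchy: "\<And>e. 0 < e \<Longrightarrow> \<exists>N. \<forall>m\<ge>N. \<forall>n\<ge>N. pnorm p loeb_sum (\<lambda>z. \<xi> m z - \<xi> n z) < e"
  obtains \<eta> where "\<eta> \<in> Lp p loeb_sum" "(\<lambda>n. pnorm p loeb_sum (\<lambda>z. \<xi> n z - \<eta> z)) \<longlonglongrightarrow> 0"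
proof -
  have "\<exists>N. \<forall>m\<ge>N. \<forall>n\<ge>N. pnorm p loeb_sum (\<lambda>z. \<xi> m z - \<xi> n z) < 1 / real (Suc k)" for k
    using cauchy[of "1 / real (Suc k)"] by simp
  then obtain N where N: "\<And>k m n. N k \<le> m \<Longrightarrow> N k \<le> n \<Longrightarrow> pnorm p loeb_sum (\<lambda>z. \<xi> m z - \<xi> n z) < 1 / real (Suc k)" by metis
  have "\<exists>f. fam f \<and> (AE z in loeb_sum. J f z = \<xi> (N k) z)" for k using J_surj[OF \<xi>] by metis
  then obtain F where F: "\<And>k. fam (F k)" "\<And>k. AE z in loeb_sum. J (F k) z = \<xi> (N k) z" by metis
  have eq: "pnorm p loeb_sum (\<lambda>z. J (F k) z - g z) = pnorm p loeb_sum (\<lambda>z. \<xi> (N k) z - g z)"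
    if [measurable]: "g \<in> borel_measurable loeb_sum" for k g
    using J_measurable[OF F(1)[of k]] \<xi>[of "N k"] F(2)[of k] by (intro pnorm_cong_AE) (auto simp: Lp_iff)
  have eq': "pnorm p loeb_sum (\<lambda>z. g z - h z) = pnorm p loeb_sum (\<lambda>z. h z - g z)" for g h
    using pnorm_cmult[OF p, of loeb_sum "-1" "\<lambda>z. g z - h z"] by simp
  have "unorm (\<lambda>j x. F n j x - F k j x) \<le> 1 / real (Suc n) + 1 / real (Suc k)" for n k
  proof -
    have "unorm (\<lambda>j x. F n j x - F k j x) = pnorm p loeb_sum (\<lambda>z. J (F n) z - J (F k) z)"
      by (rule pnorm_J_diff[OF F(1) F(1), symmetric])
    also have "\<dots> = pnorm p loeb_sum (\<lambda>z. \<xi> (N n) z - J (F k) z)" by (rule eq[OF J_measurable[OF F(1)]])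
    also have "\<dots> = pnorm p loeb_sum (\<lambda>z. \<xi> (N k) z - \<xi> (N n) z)"
      using \<xi>[of "N n"] by (subst eq', subst eq) (auto simp: Lp_iff)
    also have "\<dots> \<le> 1 / real (Suc n) + 1 / real (Suc k)"
    proof (cases "N n \<le> N k")
      case True
      then show ?thesis using N[of n "N k" "N n"] by (simp add: add_increasing2 less_imp_le)
    next
      case False
      then show ?thesis using N[of k "N k" "N n"] by (simp add: add_increasing less_imp_le)
    qed
    finally show ?thesis .
  qed
  from fam_limit[of F, OF F(1) this] obtain f where f: "fam f" "\<And>n. unorm (\<lambda>j x. F n j x - f j x) \<le> 4 / real (Suc n)"
    by metis
  have bound: "pnorm p loeb_sum (\<lambda>z. \<xi> n z - J f z) \<le> 5 / real (Suc k)" if "N k \<le> n" for n k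
  proof -
    have "pnorm p loeb_sum (\<lambda>z. \<xi> (N k) z - J f z) = pnorm p loeb_sum (\<lambda>z. J (F k) z - J f z)"
      by (rule eq[OF J_measurable[OF f(1)], symmetric])
    also have "\<dots> \<le> 4 / real (Suc k)" unfolding pnorm_J_diff[OF F(1) f(1)] by (rule f(2))
    finally have "pnorm p loeb_sum (\<lambda>z. \<xi> (N k) z - J f z) \<le> 4 / real (Suc k)" .
    moreover have "pnorm p loeb_sum (\<lambda>z. (\<xi> n z - \<xi> (N k) z) + (\<xi> (N k) z - J f z)) \<le>
        pnorm p loeb_sum (\<lambda>z. \<xi> n z - \<xi> (N k) z) + pnorm p loeb_sum (\<lambda>z. \<xi> (N k) z - J f z)"
      by (intro minkowski p Lp_diff J_Lp f \<xi>)
    ultimately have "pnorm p loeb_sum (\<lambda>z. \<xi> n z - J f z) \<le> 1 / real (Suc k) + 4 / real (Suc k)"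
      using N[OF that order_refl] by simp
    then show ?thesis by (simp add: add_divide_distrib[symmetric])
  qed
  have "(\<lambda>n. pnorm p loeb_sum (\<lambda>z. \<xi> n z - J f z)) \<longlonglongrightarrow> 0"
  proof (rule LIMSEQ_I)
    fix e :: real assume "0 < e"
    then obtain k where k: "5 / e < real (Suc k)" using reals_Archimedean2[of "5 / e"]
      by (metis less_SucI less_trans of_nat_less_iff lessI)
    then have "5 / real (Suc k) < e" using \<open>0 < e\<close> by (simp add: field_simps)
    then show "\<exists>n0. \<forall>n\<ge>n0. norm (pnorm p loeb_sum (\<lambda>z. \<xi> n z - J f z) - 0) < e"
      using bound[of k] by (intro exI[of _ "N k"]) (auto simp: pnorm_nonneg intro: le_less_trans)
  qed
  then show thesis using that J_Lp(1)[OF f(1)] by blast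
qed

end

section \<open>Operators on ultraproducts\<close>

text \<open>
  The normed space \<open>W\<close> is the ultraproduct of the spaces \<open>V j\<close>: the map \<open>ulim\<close> sends the bounded
  families onto \<open>W\<close>, and the norm of an image is the limit of the norms.
\<close>

locale ultraproduct_space =
  fixes U :: "'j filter" and V :: "'j \<Rightarrow> 'v normed_algebra" and W :: "'w normed_algebra"
    and ulim :: "('j \<Rightarrow> 'v) \<Rightarrow> 'w" and bfam :: "('j \<Rightarrow> 'v) \<Rightarrow> bool"
  assumes proper: "U \<noteq> bot"
    and normed_V: "normed_module (V j)"
    and normed_W: "normed_module W"
    and bfam_iff: "bfam X \<longleftrightarrow> (\<forall>j. X j \<in> carrier (V j)) \<and> (\<exists>C. eventually (\<lambda>j. vnorm (V j) (X j) \<le> C) U)"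
    and ulim_in: "bfam X \<Longrightarrow> ulim X \<in> carrier W"
    and ulim_add: "bfam X \<Longrightarrow> bfam Y \<Longrightarrow> ulim (\<lambda>j. X j \<oplus>\<^bsub>V j\<^esub> Y j) = ulim X \<oplus>\<^bsub>W\<^esub> ulim Y"
    and ulim_smult: "bfam X \<Longrightarrow> ulim (\<lambda>j. c \<odot>\<^bsub>V j\<^esub> X j) = c \<odot>\<^bsub>W\<^esub> ulim X"
    and ulim_norm: "bfam X \<Longrightarrow> ((\<lambda>j. vnorm (V j) (X j)) \<longlongrightarrow> vnorm W (ulim X)) U"
    and ulim_surj: "w \<in> carrier W \<Longrightarrow> \<exists>X. bfam X \<and> ulim X = w"
begin

interpretation W: operators_on W by (rule operators_on.intro) (rule normed_W)

lemma V_ops: "operators_on (V j)"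
  by (rule operators_on.intro) (rule normed_V)

lemma V_cmodule: "cmodule (V j)"
  using normed_V by (rule normed_module.axioms(1))

lemma bfam_in: "bfam X \<Longrightarrow> X j \<in> carrier (V j)"
  by (simp add: bfam_iff)

lemma bfamI: "(\<And>j. X j \<in> carrier (V j)) \<Longrightarrow> eventually (\<lambda>j. vnorm (V j) (X j) \<le> C) U \<Longrightarrow> bfam X"
  by (auto simp: bfam_iff)

lemma bfam_add: "bfam X \<Longrightarrow> bfam Y \<Longrightarrow> bfam (\<lambda>j. X j \<oplus>\<^bsub>V j\<^esub> Y j)"
proof -
  assume X: "bfam X" and Y: "bfam Y"
  then obtain C D where "eventually (\<lambda>j. vnorm (V j) (X j) \<le> C) U" "eventually (\<lambda>j. vnorm (V j) (Y j) \<le> D) U"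
    by (auto simp: bfam_iff)
  then have "eventually (\<lambda>j. vnorm (V j) (X j \<oplus>\<^bsub>V j\<^esub> Y j) \<le> C + D) U"
  proof eventually_elim
    case (elim j)
    then show ?case using normed_module.vnorm_triangle[OF normed_V bfam_in[OF X] bfam_in[OF Y], of j] by simp
  qed
  moreover have "X j \<oplus>\<^bsub>V j\<^esub> Y j \<in> carrier (V j)" for j
  proof -
    interpret cmodule "V j" by (rule V_cmodule)
    show ?thesis using bfam_in[OF X] bfam_in[OF Y] by simp
  qed
  ultimately show ?thesis by (intro bfamI)
qed

lemma bfam_smult: "bfam X \<Longrightarrow> bfam (\<lambda>j. c \<odot>\<^bsub>V j\<^esub> X j)"
proof -
  assume X: "bfam X"
  then obtain C where "eventually (\<lambda>j. vnorm (V j) (X j) \<le> C) U"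
    by (auto simp: bfam_iff)
  then have "eventually (\<lambda>j. vnorm (V j) (c \<odot>\<^bsub>V j\<^esub> X j) \<le> cmod c * C) U"
  proof eventually_elim
    case (elim j)
    then show ?case using normed_module.vnorm_smult[OF normed_V bfam_in[OF X], of j c] by (simp add: mult_left_mono)
  qed
  then show ?thesis using cmodule.sm_closed[OF V_cmodule bfam_in[OF X]] by (intro bfamI)
qed

lemma ulim_diff:
  assumes X: "bfam X" and Y: "bfam Y"
  shows "ulim (\<lambda>j. X j \<ominus>\<^bsub>V j\<^esub> Y j) = ulim X \<ominus>\<^bsub>W\<^esub> ulim Y" "bfam (\<lambda>j. X j \<ominus>\<^bsub>V j\<^esub> Y j)"
proof -
  have eq: "(\<lambda>j. X j \<ominus>\<^bsub>V j\<^esub> Y j) = (\<lambda>j. X j \<oplus>\<^bsub>V j\<^esub> (-1) \<odot>\<^bsub>V j\<^esub> Y j)"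
    using cmodule.minus_smult[OF V_cmodule bfam_in[OF X] bfam_in[OF Y]] by auto
  show "ulim (\<lambda>j. X j \<ominus>\<^bsub>V j\<^esub> Y j) = ulim X \<ominus>\<^bsub>W\<^esub> ulim Y"
    unfolding eq using ulim_add[OF X bfam_smult[OF Y]] ulim_smult[OF Y] W.minus_smult[OF ulim_in[OF X] ulim_in[OF Y]] by simp
  show "bfam (\<lambda>j. X j \<ominus>\<^bsub>V j\<^esub> Y j)"
    unfolding eq by (intro bfam_add bfam_smult X Y)
qed

lemma ulim_eqI:
  assumes X: "bfam X" and Y: "bfam Y" and lim: "((\<lambda>j. vnorm (V j) (X j \<ominus>\<^bsub>V j\<^esub> Y j)) \<longlongrightarrow> 0) U"
  shows "ulim X = ulim Y"
proof -
  have "vnorm W (ulim X \<ominus>\<^bsub>W\<^esub> ulim Y) = 0"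
    using tendsto_unique[OF proper ulim_norm[OF ulim_diff(2)[OF X Y]] lim] ulim_diff(1)[OF X Y] by simp
  then show ?thesis using ulim_in[OF X] ulim_in[OF Y] by (simp add: W.vnorm_diff_eq_0)
qed

lemma ulim_cong:
  assumes X: "bfam X" and Y: "bfam Y" and eq: "eventually (\<lambda>j. X j = Y j) U"
  shows "ulim X = ulim Y"
proof (rule ulim_eqI[OF X Y])
  have "eventually (\<lambda>j. 0 = vnorm (V j) (X j \<ominus>\<^bsub>V j\<^esub> Y j)) U"
    using eq by eventually_elim (use normed_module.vnorm_diff_eq_0[OF normed_V bfam_in[OF Y] bfam_in[OF Y]] in simp)
  then show "((\<lambda>j. vnorm (V j) (X j \<ominus>\<^bsub>V j\<^esub> Y j)) \<longlongrightarrow> 0) U"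
    by (rule Lim_transform_eventually[OF tendsto_const])
qed

abbreviation BV :: "'j \<Rightarrow> ('v \<Rightarrow> 'v) normed_algebra" where "BV j \<equiv> bounded_operators (V j)"
abbreviation BW :: "('w \<Rightarrow> 'w) normed_algebra" where "BW \<equiv> bounded_operators W"

definition opfam :: "('j \<Rightarrow> 'v \<Rightarrow> 'v) \<Rightarrow> bool" where
  "opfam c \<longleftrightarrow> (\<forall>j. c j \<in> carrier (BV j)) \<and> (\<exists>C. eventually (\<lambda>j. vnorm (BV j) (c j) \<le> C) U)"

definition lift :: "'w \<Rightarrow> 'j \<Rightarrow> 'v" where
  "lift w = (SOME X. bfam X \<and> ulim X = w)"

lemma lift: "w \<in> carrier W \<Longrightarrow> bfam (lift w) \<and> ulim (lift w) = w"
  unfolding lift_def using someI_ex[OF ulim_surj, of w] by simp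

text \<open>
  The ultraproduct of a bounded family of operators: lift a vector to a bounded family, apply the
  operators, and return to \<open>W\<close>.
\<close>

definition \<Theta> :: "('j \<Rightarrow> 'v \<Rightarrow> 'v) \<Rightarrow> 'w \<Rightarrow> 'w" where
  "\<Theta> c = (\<lambda>w\<in>carrier W. ulim (\<lambda>j. c j (lift w j)))"

lemma opfam_in: "opfam c \<Longrightarrow> c j \<in> carrier (BV j)"
  by (simp add: opfam_def)

lemma opfam_bound:
  assumes "opfam c"
  obtains C where "0 \<le> C" "eventually (\<lambda>j. vnorm (BV j) (c j) \<le> C) U"
proof -
  obtain C where "eventually (\<lambda>j. vnorm (BV j) (c j) \<le> C) U" using assms by (auto simp: opfam_def)
  then have "eventually (\<lambda>j. vnorm (BV j) (c j) \<le> max 0 C) U" by (auto elim!: eventually_mono)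
  then show thesis using that[of "max 0 C"] by simp
qed

lemma opfam_app_bound:
  assumes c: "opfam c" and X: "bfam X"
  shows "vnorm (V j) (c j (X j)) \<le> vnorm (BV j) (c j) * vnorm (V j) (X j)"
  by (rule operators_on.op_bound[OF V_ops opfam_in[OF c] bfam_in[OF X]])

lemma bfam_app:
  assumes c: "opfam c" and X: "bfam X"
  shows "bfam (\<lambda>j. c j (X j))"
proof -
  obtain C where C: "0 \<le> C" "eventually (\<lambda>j. vnorm (BV j) (c j) \<le> C) U" using opfam_bound[OF c] .
  obtain D where D: "eventually (\<lambda>j. vnorm (V j) (X j) \<le> D) U" using X by (auto simp: bfam_iff)
  have "eventually (\<lambda>j. vnorm (V j) (c j (X j)) \<le> C * D) U"
    using C(2) D
  proof eventually_elim
    case (elim j)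
    have "vnorm (BV j) (c j) * vnorm (V j) (X j) \<le> C * D"
      using elim C(1) normed_module.vnorm_nonneg[OF normed_V bfam_in[OF X]] by (intro mult_mono) auto
    then show ?case using opfam_app_bound[OF c X, of j] by simp
  qed
  then show ?thesis by (intro bfamI operators_on.opD(1)[OF V_ops opfam_in[OF c] bfam_in[OF X]])
qed

lemma ulim_app_bound:
  assumes c: "opfam c" and X: "bfam X" and C: "eventually (\<lambda>j. vnorm (BV j) (c j) \<le> C) U"
  shows "vnorm W (ulim (\<lambda>j. c j (X j))) \<le> C * vnorm W (ulim X)"
proof (rule tendsto_le[OF proper _ ulim_norm[OF bfam_app[OF c X]]])
  show "((\<lambda>j. C * vnorm (V j) (X j)) \<longlongrightarrow> C * vnorm W (ulim X)) U"
    by (intro tendsto_mult_left ulim_norm X)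
  show "eventually (\<lambda>j. vnorm (V j) (c j (X j)) \<le> C * vnorm (V j) (X j)) U"
    using C
  proof eventually_elim
    case (elim j)
    show ?case
      by (rule order_trans[OF opfam_app_bound[OF c X] mult_right_mono[OF elim normed_module.vnorm_nonneg[OF normed_V bfam_in[OF X]]]])
  qed
qed

text \<open>
  The choice of the lift is immaterial, because families with the same image differ by a null family
  and bounded families of operators preserve null families.
\<close>

lemma \<Theta>_ulim:
  assumes c: "opfam c" and X: "bfam X"
  shows "\<Theta> c (ulim X) = ulim (\<lambda>j. c j (X j))"
proof -
  let ?Y = "lift (ulim X)"
  have Y: "bfam ?Y" "ulim ?Y = ulim X" using lift[OF ulim_in[OF X]] by auto
  obtain C where C: "0 \<le> C" "eventually (\<lambda>j. vnorm (BV j) (c j) \<le> C) U" using opfam_bound[OF c] .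
  note d = ulim_diff[OF Y(1) X]
  have eq: "(\<lambda>j. c j (?Y j \<ominus>\<^bsub>V j\<^esub> X j)) = (\<lambda>j. c j (?Y j) \<ominus>\<^bsub>V j\<^esub> c j (X j))"
  proof
    fix j
    interpret operators_on "V j" by (rule V_ops)
    show "c j (?Y j \<ominus>\<^bsub>V j\<^esub> X j) = c j (?Y j) \<ominus>\<^bsub>V j\<^esub> c j (X j)"
      using opD[OF opfam_in[OF c]] bfam_in[OF X] bfam_in[OF Y(1)] by (simp add: minus_smult)
  qed
  have "vnorm W (ulim (\<lambda>j. c j (?Y j \<ominus>\<^bsub>V j\<^esub> X j))) \<le> C * vnorm W (ulim (\<lambda>j. ?Y j \<ominus>\<^bsub>V j\<^esub> X j))"
    by (rule ulim_app_bound[OF c d(2) C(2)])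
  also have "\<dots> = 0" unfolding d(1) Y(2) using ulim_in[OF X] by (simp add: W.diff_self W.vnorm_zero)
  finally have "vnorm W (ulim (\<lambda>j. c j (?Y j)) \<ominus>\<^bsub>W\<^esub> ulim (\<lambda>j. c j (X j))) \<le> 0"
    unfolding eq ulim_diff(1)[OF bfam_app[OF c Y(1)] bfam_app[OF c X]] .
  moreover have in_W: "ulim (\<lambda>j. c j (?Y j)) \<in> carrier W" "ulim (\<lambda>j. c j (X j)) \<in> carrier W"
    by (rule ulim_in[OF bfam_app[OF c Y(1)]], rule ulim_in[OF bfam_app[OF c X]])
  ultimately have "vnorm W (ulim (\<lambda>j. c j (?Y j)) \<ominus>\<^bsub>W\<^esub> ulim (\<lambda>j. c j (X j))) = 0"
    using W.vnorm_nonneg[OF W.minus_closed[OF in_W]] by simp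
  then have "ulim (\<lambda>j. c j (?Y j)) = ulim (\<lambda>j. c j (X j))" using in_W by (simp add: W.vnorm_diff_eq_0)
  then show ?thesis using ulim_in[OF X] by (simp add: \<Theta>_def)
qed

lemma \<Theta>_in:
  assumes c: "opfam c"
  shows "\<Theta> c \<in> carrier BW"
proof -
  obtain C where C: "0 \<le> C" "eventually (\<lambda>j. vnorm (BV j) (c j) \<le> C) U" using opfam_bound[OF c] .
  have \<Theta>_lift: "ulim (\<lambda>j. c j (lift w j)) = \<Theta> c w" if "w \<in> carrier W" for w using that by (simp add: \<Theta>_def)
  show ?thesis
    unfolding \<Theta>_def
  proof (rule W.opI[where C=C])
    fix w assume w: "w \<in> carrier W"
    show "ulim (\<lambda>j. c j (lift w j)) \<in> carrier W" using lift[OF w] by (intro ulim_in bfam_app[OF c]) simp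
    show "vnorm W (ulim (\<lambda>j. c j (lift w j))) \<le> C * vnorm W w"
      using ulim_app_bound[OF c _ C(2), of "lift w"] lift[OF w] by simp
    fix a
    obtain X where X: "bfam X" "w = ulim X" using ulim_surj[OF w] by blast
    have "\<Theta> c (a \<odot>\<^bsub>W\<^esub> w) = ulim (\<lambda>j. c j (a \<odot>\<^bsub>V j\<^esub> X j))"
      unfolding X(2) ulim_smult[OF X(1), symmetric] by (rule \<Theta>_ulim[OF c bfam_smult[OF X(1)]])
    also have "\<dots> = ulim (\<lambda>j. a \<odot>\<^bsub>V j\<^esub> c j (X j))"
      using operators_on.opD(3)[OF V_ops opfam_in[OF c] bfam_in[OF X(1)]] by simp
    also have "\<dots> = a \<odot>\<^bsub>W\<^esub> \<Theta> c w" unfolding X(2) by (simp add: ulim_smult[OF bfam_app[OF c X(1)]] \<Theta>_ulim[OF c X(1)])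
    finally show "ulim (\<lambda>j. c j (lift (a \<odot>\<^bsub>W\<^esub> w) j)) = a \<odot>\<^bsub>W\<^esub> ulim (\<lambda>j. c j (lift w j))"
      using w by (simp add: \<Theta>_lift)
  next
    fix w w' assume w: "w \<in> carrier W" "w' \<in> carrier W"
    obtain X where X: "bfam X" "w = ulim X" using ulim_surj[OF w(1)] by blast
    obtain Y where Y: "bfam Y" "w' = ulim Y" using ulim_surj[OF w(2)] by blast
    have "\<Theta> c (w \<oplus>\<^bsub>W\<^esub> w') = ulim (\<lambda>j. c j (X j \<oplus>\<^bsub>V j\<^esub> Y j))"
      unfolding X(2) Y(2) ulim_add[OF X(1) Y(1), symmetric] by (rule \<Theta>_ulim[OF c bfam_add[OF X(1) Y(1)]])
    also have "\<dots> = ulim (\<lambda>j. c j (X j) \<oplus>\<^bsub>V j\<^esub> c j (Y j))"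
      using operators_on.opD(2)[OF V_ops opfam_in[OF c] bfam_in[OF X(1)] bfam_in[OF Y(1)]] by simp
    also have "\<dots> = \<Theta> c w \<oplus>\<^bsub>W\<^esub> \<Theta> c w'"
      unfolding X(2) Y(2) by (simp add: ulim_add[OF bfam_app[OF c X(1)] bfam_app[OF c Y(1)]] \<Theta>_ulim[OF c X(1)] \<Theta>_ulim[OF c Y(1)])
    finally show "ulim (\<lambda>j. c j (lift (w \<oplus>\<^bsub>W\<^esub> w') j)) = ulim (\<lambda>j. c j (lift w j)) \<oplus>\<^bsub>W\<^esub> ulim (\<lambda>j. c j (lift w' j))"
      using w by (simp add: \<Theta>_lift)
  qed
qed

lemma \<Theta>_eqI:
  assumes "opfam c" "T \<in> carrier BW" "\<And>X. bfam X \<Longrightarrow> ulim (\<lambda>j. c j (X j)) = T (ulim X)"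
  shows "\<Theta> c = T"
proof (rule W.op_eqI[OF \<Theta>_in[OF assms(1)] assms(2)])
  fix w assume "w \<in> carrier W"
  then obtain X where "bfam X" "w = ulim X" using ulim_surj by blast
  then show "\<Theta> c w = T w" using assms \<Theta>_ulim by simp
qed

lemma \<Theta>_cong:
  assumes c: "opfam c" and d: "opfam d" and eq: "eventually (\<lambda>j. c j = d j) U"
  shows "\<Theta> c = \<Theta> d"
proof (rule \<Theta>_eqI[OF c \<Theta>_in[OF d]])
  fix X assume X: "bfam X"
  show "ulim (\<lambda>j. c j (X j)) = \<Theta> d (ulim X)"
    unfolding \<Theta>_ulim[OF d X] by (rule ulim_cong[OF bfam_app[OF c X] bfam_app[OF d X]]) (use eq in eventually_elim, simp)
qed

lemma \<Theta>_add:
  assumes c: "opfam c" and d: "opfam d" and e: "opfam e" and eq: "eventually (\<lambda>j. e j = c j \<oplus>\<^bsub>BV j\<^esub> d j) U"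
  shows "\<Theta> e = \<Theta> c \<oplus>\<^bsub>BW\<^esub> \<Theta> d"
proof (rule \<Theta>_eqI[OF e W.op_add[OF \<Theta>_in[OF c] \<Theta>_in[OF d]]])
  fix X assume X: "bfam X"
  have "ulim (\<lambda>j. e j (X j)) = ulim (\<lambda>j. c j (X j) \<oplus>\<^bsub>V j\<^esub> d j (X j))"
  proof (rule ulim_cong[OF bfam_app[OF e X] bfam_add[OF bfam_app[OF c X] bfam_app[OF d X]]])
    show "eventually (\<lambda>j. e j (X j) = c j (X j) \<oplus>\<^bsub>V j\<^esub> d j (X j)) U"
      using eq by eventually_elim (simp add: operators_on.B_ops[OF V_ops] bfam_in[OF X])
  qed
  then show "ulim (\<lambda>j. e j (X j)) = (\<Theta> c \<oplus>\<^bsub>BW\<^esub> \<Theta> d) (ulim X)"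
    using ulim_in[OF X] by (simp add: W.B_ops \<Theta>_ulim[OF c X] \<Theta>_ulim[OF d X] ulim_add[OF bfam_app[OF c X] bfam_app[OF d X]])
qed

lemma \<Theta>_smult:
  assumes c: "opfam c" and e: "opfam e" and eq: "eventually (\<lambda>j. e j = a \<odot>\<^bsub>BV j\<^esub> c j) U"
  shows "\<Theta> e = a \<odot>\<^bsub>BW\<^esub> \<Theta> c"
proof (rule \<Theta>_eqI[OF e W.op_smult[OF \<Theta>_in[OF c]]])
  fix X assume X: "bfam X"
  have "ulim (\<lambda>j. e j (X j)) = ulim (\<lambda>j. a \<odot>\<^bsub>V j\<^esub> c j (X j))"
  proof (rule ulim_cong[OF bfam_app[OF e X] bfam_smult[OF bfam_app[OF c X]]])
    show "eventually (\<lambda>j. e j (X j) = a \<odot>\<^bsub>V j\<^esub> c j (X j)) U"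
      using eq by eventually_elim (simp add: operators_on.B_ops[OF V_ops] bfam_in[OF X])
  qed
  then show "ulim (\<lambda>j. e j (X j)) = (a \<odot>\<^bsub>BW\<^esub> \<Theta> c) (ulim X)"
    using ulim_in[OF X] by (simp add: W.B_ops \<Theta>_ulim[OF c X] ulim_smult[OF bfam_app[OF c X]])
qed

lemma \<Theta>_mult:
  assumes c: "opfam c" and d: "opfam d" and e: "opfam e" and eq: "eventually (\<lambda>j. e j = c j \<otimes>\<^bsub>BV j\<^esub> d j) U"
  shows "\<Theta> e = \<Theta> c \<otimes>\<^bsub>BW\<^esub> \<Theta> d"
proof (rule \<Theta>_eqI[OF e W.op_mult(1)[OF \<Theta>_in[OF c] \<Theta>_in[OF d]]])
  fix X assume X: "bfam X"
  have "ulim (\<lambda>j. e j (X j)) = ulim (\<lambda>j. c j (d j (X j)))"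
  proof (rule ulim_cong[OF bfam_app[OF e X] bfam_app[OF c bfam_app[OF d X]]])
    show "eventually (\<lambda>j. e j (X j) = c j (d j (X j))) U"
      using eq by eventually_elim (simp add: operators_on.B_ops[OF V_ops] compose_def bfam_in[OF X])
  qed
  then show "ulim (\<lambda>j. e j (X j)) = (\<Theta> c \<otimes>\<^bsub>BW\<^esub> \<Theta> d) (ulim X)"
    using ulim_in[OF X] by (simp add: W.B_ops compose_def \<Theta>_ulim[OF d X] \<Theta>_ulim[OF c bfam_app[OF d X]])
qed

text \<open>
  For the lower bound choose in each \<open>V j\<close> a vector of norm at most \<open>1\<close> on which \<open>c j\<close> nearly attains its
  norm; these vectors form a bounded family.
\<close>

lemma vnorm_\<Theta>:
  assumes c: "opfam c" and lim: "((\<lambda>j. vnorm (BV j) (c j)) \<longlongrightarrow> l) U"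
  shows "vnorm BW (\<Theta> c) = l"
proof (rule antisym)
  have l0: "0 \<le> l"
    by (rule tendsto_lowerbound[OF lim _ proper]) (simp add: operators_on.op_vnorm_nonneg[OF V_ops opfam_in[OF c]])
  show "vnorm BW (\<Theta> c) \<le> l"
  proof (rule W.op_vnorm_leI[OF \<Theta>_in[OF c] _ l0])
    fix w assume "w \<in> carrier W"
    then obtain X where X: "bfam X" "w = ulim X" using ulim_surj by blast
    show "vnorm W (\<Theta> c w) \<le> l * vnorm W w"
      unfolding X(2) \<Theta>_ulim[OF c X(1)]
    proof (rule tendsto_le[OF proper _ ulim_norm[OF bfam_app[OF c X(1)]]])
      show "((\<lambda>j. vnorm (BV j) (c j) * vnorm (V j) (X j)) \<longlongrightarrow> l * vnorm W (ulim X)) U"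
        by (intro tendsto_mult lim ulim_norm X)
    qed (use opfam_app_bound[OF c X(1)] in simp)
  qed
  show "l \<le> vnorm BW (\<Theta> c)"
  proof (rule field_le_epsilon)
    fix e :: real assume e: "0 < e"
    have "\<exists>x. x \<in> carrier (V j) \<and> vnorm (V j) x \<le> 1 \<and> vnorm (BV j) (c j) - e < vnorm (V j) (c j x)" for j
      using operators_on.op_near[OF V_ops opfam_in[OF c] e] by metis
    then obtain X where X: "\<And>j. X j \<in> carrier (V j)" "\<And>j. vnorm (V j) (X j) \<le> 1"
      "\<And>j. vnorm (BV j) (c j) - e < vnorm (V j) (c j (X j))" by metis
    have bX: "bfam X" by (rule bfamI[OF X(1), where C=1]) (simp add: X(2))
    have n1: "vnorm W (ulim X) \<le> 1"
      by (rule tendsto_upperbound[OF ulim_norm[OF bX] _ proper]) (simp add: X(2))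
    have "l - e \<le> vnorm W (ulim (\<lambda>j. c j (X j)))"
      by (rule tendsto_le[OF proper ulim_norm[OF bfam_app[OF c bX]] tendsto_diff[OF lim tendsto_const]])
        (simp add: X(3) less_imp_le)
    also have "\<dots> = vnorm W (\<Theta> c (ulim X))" by (simp add: \<Theta>_ulim[OF c bX])
    also have "\<dots> \<le> vnorm BW (\<Theta> c) * vnorm W (ulim X)" by (rule W.op_bound[OF \<Theta>_in[OF c] ulim_in[OF bX]])
    also have "\<dots> \<le> vnorm BW (\<Theta> c)" using n1 W.op_vnorm_nonneg[OF \<Theta>_in[OF c]] by (simp add: mult_left_le)
    finally show "l \<le> vnorm BW (\<Theta> c) + e" by simp
  qed
qed

end

section \<open>The spaces of integrable functions as normed modules\<close>

lemma cmodule_pre_Lp: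
  assumes p: "1 \<le> p"
  shows "cmodule (pre_Lp_space p M)"
proof (rule cmoduleI_direct)
  show "f \<oplus>\<^bsub>pre_Lp_space p M\<^esub> g \<in> Lp p M" if "f \<in> Lp p M" "g \<in> Lp p M" for f g
    using Lp_add[OF p that] by (simp add: pre_Lp_space_def)
  show "c \<odot>\<^bsub>pre_Lp_space p M\<^esub> f \<in> Lp p M" if "f \<in> Lp p M" for c f
    using Lp_cmult[OF that, of c] by (simp add: pre_Lp_space_def)
  show "\<zero>\<^bsub>pre_Lp_space p M\<^esub> \<in> Lp p M"
    using Lp_zero[of p M] by (simp add: pre_Lp_space_def)
qed (auto simp: pre_Lp_space_def algebra_simps)

lemma pre_Lp_ops:
  "f \<oplus>\<^bsub>pre_Lp_space p M\<^esub> g = (\<lambda>x. f x + g x)" "c \<odot>\<^bsub>pre_Lp_space p M\<^esub> f = (\<lambda>x. c * f x)"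
  "\<zero>\<^bsub>pre_Lp_space p M\<^esub> = (\<lambda>x. 0)"
  by (simp_all add: pre_Lp_space_def)

lemma pre_Lp_minus:
  assumes "1 \<le> p" "f \<in> Lp p M" "g \<in> Lp p M"
  shows "f \<ominus>\<^bsub>pre_Lp_space p M\<^esub> g = (\<lambda>x. f x - g x)"
  using cmodule.minus_smult[OF cmodule_pre_Lp[OF assms(1)] assms(2,3)] by (simp add: pre_Lp_ops)

definition AE_class :: "real \<Rightarrow> 'x measure \<Rightarrow> ('x \<Rightarrow> complex) \<Rightarrow> ('x \<Rightarrow> complex) set" where
  "AE_class p M f = {g \<in> Lp p M. AE x in M. g x = f x}"

lemma AE_class_eq_iff:
  assumes "f \<in> Lp p M" "g \<in> Lp p M"
  shows "AE_class p M f = AE_class p M g \<longleftrightarrow> (AE x in M. f x = g x)"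
proof
  assume "AE_class p M f = AE_class p M g"
  moreover have "f \<in> AE_class p M f" using assms by (simp add: AE_class_def)
  ultimately show "AE x in M. f x = g x" by (simp add: AE_class_def)
next
  assume eq: "AE x in M. f x = g x"
  have "(AE x in M. h x = f x) \<longleftrightarrow> (AE x in M. h x = g x)" for h
    using eq by (intro eventually_subst) (auto elim!: eventually_mono)
  then show "AE_class p M f = AE_class p M g" by (simp add: AE_class_def)
qed

locale Lp_quotient =
  fixes p :: real and M :: "'x measure"
  assumes p: "1 \<le> p"
begin

abbreviation N where "N \<equiv> {f \<in> Lp p M. AE x in M. f x = 0}"

sublocale null_quotient "pre_Lp_space p M" N "AE_class p M"
proof -
  interpret cmodule "pre_Lp_space p M" by (rule cmodule_pre_Lp[OF p])
  show "null_quotient (pre_Lp_space p M) N (AE_class p M)"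
  proof
    show "f \<oplus>\<^bsub>pre_Lp_space p M\<^esub> g \<in> N" if "f \<in> N" "g \<in> N" for f g
      using that by (auto simp: pre_Lp_ops Lp_add[OF p])
    show "c \<odot>\<^bsub>pre_Lp_space p M\<^esub> f \<in> N" if "f \<in> N" for f c
      using that by (auto simp: pre_Lp_ops Lp_cmult)
    show "AE_class p M f = AE_class p M g \<longleftrightarrow> f \<ominus>\<^bsub>pre_Lp_space p M\<^esub> g \<in> N" if "f \<in> Lp p M" "g \<in> Lp p M" for f g
      using that by (simp add: AE_class_eq_iff pre_Lp_minus[OF p] Lp_diff[OF p])
    show "pnorm p M f = pnorm p M g" if "f \<in> Lp p M" "g \<in> Lp p M" "AE_class p M f = AE_class p M g" for f g
      using that by (intro pnorm_cong_AE) (auto simp: AE_class_eq_iff Lp_iff)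
  qed auto
qed

lemma Lp_space_eq: "Lp_space p M = Q"
  by (simp add: Lp_space_def)

lemma cls_Lp_eq_iff: "f \<in> Lp p M \<Longrightarrow> g \<in> Lp p M \<Longrightarrow> cls f = cls g \<longleftrightarrow> (AE x in M. f x = g x)"
  by (simp add: cls_eq_iff AE_class_eq_iff)

lemma minus_Q: "f \<in> Lp p M \<Longrightarrow> g \<in> Lp p M \<Longrightarrow> cls f \<ominus>\<^bsub>Q\<^esub> cls g = cls (\<lambda>x. f x - g x)"
  using module_map_diff[OF module_map_cls cmodule_axioms cmodule_Q, of f g] by (simp add: pre_Lp_minus[OF p])

lemma normed_module_Q: "normed_module Q"
proof -
  interpret Q: cmodule Q by (rule cmodule_Q)
  show ?thesis
  proof
    fix X assume "X \<in> carrier Q"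
    then obtain f where f: "f \<in> Lp p M" "X = cls f" by (auto simp: carrier_Q)
    show "0 \<le> vnorm Q X" by (simp add: f vnorm_Q pnorm_nonneg)
    show "vnorm Q X = 0 \<longleftrightarrow> X = \<zero>\<^bsub>Q\<^esub>"
      unfolding zero_Q f(2) vnorm_Q[OF f(1)] pnorm_eq_0_iff[OF p f(1)]
      using cls_Lp_eq_iff[OF f(1) zero_closed] by (simp add: pre_Lp_ops)
    show "vnorm Q (c \<odot>\<^bsub>Q\<^esub> X) = cmod c * vnorm Q X" for c
      using f(1) sm_closed[OF f(1), of c] by (simp add: f(2) smult_Q vnorm_Q) (simp add: pre_Lp_ops pnorm_cmult[OF p])
    fix Y assume "Y \<in> carrier Q"
    then obtain g where g: "g \<in> Lp p M" "Y = cls g" by (auto simp: carrier_Q)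
    show "vnorm Q (X \<oplus>\<^bsub>Q\<^esub> Y) \<le> vnorm Q X + vnorm Q Y"
      using f(1) g(1) by (simp add: f(2) g(2) add_Q vnorm_Q) (simp add: pre_Lp_ops minkowski[OF p])
  qed
qed

definition repr :: "('x \<Rightarrow> complex) set \<Rightarrow> 'x \<Rightarrow> complex" where
  "repr X = (SOME f. f \<in> X)"

lemma repr: "X \<in> carrier Q \<Longrightarrow> repr X \<in> Lp p M" "X \<in> carrier Q \<Longrightarrow> cls (repr X) = X"
proof -
  assume "X \<in> carrier Q"
  then obtain f where f: "f \<in> Lp p M" "X = cls f" by (auto simp: carrier_Q)
  have "repr X \<in> X" unfolding repr_def using cls_self[OF f(1)] f(2) by (metis someI)
  then show r: "repr X \<in> Lp p M" using f by (simp add: cls_eq)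
  show "cls (repr X) = X" using \<open>repr X \<in> X\<close> f cls_eq_iff[OF r f(1)] by (simp add: cls_eq)
qed

end

section \<open>Ultraproducts of spaces of integrable functions\<close>

context Lp_ultraproduct_basis
begin

interpretation Vj: Lp_quotient p "M j" for j by unfold_locales (rule p)
interpretation W: Lp_quotient p loeb_sum by unfold_locales (rule p)

text \<open>
  Hence \<open>J\<close> is well defined on families of classes of functions.
\<close>

lemma J_cong:
  assumes f: "fam f" and g: "fam g" and eq: "\<And>j. AE x in M j. f j x = g j x"
  shows "AE z in loeb_sum. J f z = J g z"
proof -
  have "pnorm p (M j) (\<lambda>x. f j x - g j x) = 0" for j
    using eq[of j] Lp_diff[OF p fam_Lp[OF f, of j] fam_Lp[OF g, of j]] by (simp add: pnorm_eq_0_iff[OF p])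
  then have "unorm (\<lambda>j x. f j x - g j x) = 0" by (simp add: unorm_def tendsto_Lim[OF proper])
  then have "pnorm p loeb_sum (\<lambda>z. J f z - J g z) = 0" by (simp add: pnorm_J_diff[OF f g])
  then show ?thesis using Lp_diff[OF p J_Lp(1)[OF f] J_Lp(1)[OF g]] by (simp add: pnorm_eq_0_iff[OF p])
qed

definition ulim :: "('j \<Rightarrow> ('x \<Rightarrow> complex) set) \<Rightarrow> (('j \<Rightarrow> 'x \<Rightarrow> complex) \<times> ('j \<Rightarrow> 'x) \<Rightarrow> complex) set" where
  "ulim X = W.cls (J (\<lambda>j. Vj.repr (X j)))"

definition bfam :: "('j \<Rightarrow> ('x \<Rightarrow> complex) set) \<Rightarrow> bool" where
  "bfam X \<longleftrightarrow> (\<forall>j. X j \<in> carrier (Lp_space p (M j))) \<and>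
     (\<exists>C. eventually (\<lambda>j. vnorm (Lp_space p (M j)) (X j) \<le> C) U)"

lemma bfam_repr:
  assumes "bfam X"
  shows "fam (\<lambda>j. Vj.repr (X j))" "pnorm p (M j) (Vj.repr (X j)) = vnorm (Lp_space p (M j)) (X j)"
proof -
  have X: "X j \<in> carrier (Vj.Q j)" for j using assms by (simp add: bfam_def Vj.Lp_space_eq)
  show eq: "pnorm p (M j) (Vj.repr (X j)) = vnorm (Lp_space p (M j)) (X j)" for j
    using Vj.vnorm_Q[OF Vj.repr(1)[OF X]] Vj.repr(2)[OF X] by (simp add: Vj.Lp_space_eq)
  obtain C where C: "eventually (\<lambda>j. vnorm (Lp_space p (M j)) (X j) \<le> C) U" using assms by (auto simp: bfam_def)
  show "fam (\<lambda>j. Vj.repr (X j))"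
    by (rule famI[OF Vj.repr(1)[OF X], where C=C]) (simp add: eq C)
qed

lemma ulim_cls:
  assumes f: "fam f"
  shows "bfam (\<lambda>j. Vj.cls j (f j))" "ulim (\<lambda>j. Vj.cls j (f j)) = W.cls (J f)"
proof -
  have fL: "f j \<in> Lp p (M j)" for j by (rule fam_Lp[OF f])
  show b: "bfam (\<lambda>j. Vj.cls j (f j))"
    using f fL by (simp add: bfam_def Vj.Lp_space_eq Vj.cls_in Vj.vnorm_Q fam_def)
  have r: "Vj.repr (Vj.cls j (f j)) \<in> Lp p (M j)" "AE x in M j. Vj.repr (Vj.cls j (f j)) x = f j x" for j
    using Vj.repr[OF Vj.cls_in[OF fL]] Vj.cls_Lp_eq_iff[OF _ fL] by auto
  show "ulim (\<lambda>j. Vj.cls j (f j)) = W.cls (J f)"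
    unfolding ulim_def W.cls_Lp_eq_iff[OF J_Lp(1)[OF bfam_repr(1)[OF b]] J_Lp(1)[OF f]]
    by (rule J_cong[OF bfam_repr(1)[OF b] f r(2)])
qed

lemma bfam_cls:
  assumes "bfam X"
  obtains f where "fam f" "X = (\<lambda>j. Vj.cls j (f j))"
proof -
  have "X j \<in> carrier (Vj.Q j)" for j using assms by (simp add: bfam_def Vj.Lp_space_eq)
  then have "X = (\<lambda>j. Vj.cls j (Vj.repr (X j)))" using Vj.repr(2) by auto
  then show thesis using that bfam_repr(1)[OF assms] by blast
qed

theorem ultraproduct_space_loeb_sum:
  "ultraproduct_space U (\<lambda>j. Lp_space p (M j)) (Lp_space p loeb_sum) ulim bfam"
proof (rule ultraproduct_space.intro)
  show "U \<noteq> bot" by (rule proper)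
  show "normed_module (Lp_space p (M j))" for j unfolding Vj.Lp_space_eq by (rule Vj.normed_module_Q)
  show "normed_module (Lp_space p loeb_sum)" unfolding W.Lp_space_eq by (rule W.normed_module_Q)
  show "bfam X \<longleftrightarrow> (\<forall>j. X j \<in> carrier (Lp_space p (M j))) \<and>
     (\<exists>C. eventually (\<lambda>j. vnorm (Lp_space p (M j)) (X j) \<le> C) U)" for X by (rule bfam_def)
  show "\<exists>X. bfam X \<and> ulim X = w" if w: "w \<in> carrier (Lp_space p loeb_sum)" for w
  proof -
    obtain \<xi> where \<xi>: "\<xi> \<in> Lp p loeb_sum" "w = W.cls \<xi>" using w by (auto simp: W.Lp_space_eq W.carrier_Q)
    obtain f where f: "fam f" "AE z in loeb_sum. J f z = \<xi> z" using J_surj[OF \<xi>(1)] .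
    have "W.cls (J f) = w" unfolding \<xi>(2) W.cls_Lp_eq_iff[OF J_Lp(1)[OF f(1)] \<xi>(1)] by (rule f(2))
    then show ?thesis using ulim_cls[OF f(1)] by blast
  qed
  fix X assume X: "bfam X"
  show "ulim X \<in> carrier (Lp_space p loeb_sum)"
    unfolding ulim_def W.Lp_space_eq by (intro W.cls_in J_Lp(1) bfam_repr X)
  have "vnorm (Lp_space p loeb_sum) (ulim X) = unorm (\<lambda>j. Vj.repr (X j))"
    unfolding ulim_def W.Lp_space_eq W.vnorm_Q[OF J_Lp(1)[OF bfam_repr(1)[OF X]]] by (rule J_Lp(2)[OF bfam_repr(1)[OF X]])
  then show "((\<lambda>j. vnorm (Lp_space p (M j)) (X j)) \<longlongrightarrow> vnorm (Lp_space p loeb_sum) (ulim X)) U"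
    using tendsto_unorm[OF bfam_repr(1)[OF X]] by (simp add: bfam_repr(2)[OF X])
  obtain f where f: "fam f" "X = (\<lambda>j. Vj.cls j (f j))" using bfam_cls[OF X] .
  have Jf: "J f \<in> Lp p loeb_sum" by (rule J_Lp(1)[OF f(1)])
  show "ulim (\<lambda>j. c \<odot>\<^bsub>Lp_space p (M j)\<^esub> X j) = c \<odot>\<^bsub>Lp_space p loeb_sum\<^esub> ulim X" for c
  proof -
    have cf: "fam (\<lambda>j x. c * f j x)" by (rule fam_cmult(1)[OF f(1)])
    have "(\<lambda>j. c \<odot>\<^bsub>Lp_space p (M j)\<^esub> X j) = (\<lambda>j. Vj.cls j (\<lambda>x. c * f j x))"
      unfolding f(2) Vj.Lp_space_eq using Vj.smult_Q[OF fam_Lp[OF f(1)]] by (simp add: pre_Lp_ops)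
    then have "ulim (\<lambda>j. c \<odot>\<^bsub>Lp_space p (M j)\<^esub> X j) = W.cls (J (\<lambda>j x. c * f j x))"
      using ulim_cls(2)[OF cf] by simp
    also have "\<dots> = W.cls (\<lambda>z. c * J f z)"
      unfolding W.cls_Lp_eq_iff[OF J_Lp(1)[OF cf] Lp_cmult[OF Jf]] by (rule J_cmult[OF f(1)])
    also have "\<dots> = c \<odot>\<^bsub>Lp_space p loeb_sum\<^esub> ulim X"
      unfolding f(2) ulim_cls(2)[OF f(1)] W.Lp_space_eq W.smult_Q[OF Jf] by (simp add: pre_Lp_ops)
    finally show ?thesis .
  qed
  fix Y assume Y: "bfam Y"
  obtain g where g: "fam g" "Y = (\<lambda>j. Vj.cls j (g j))" using bfam_cls[OF Y] .
  have Jg: "J g \<in> Lp p loeb_sum" by (rule J_Lp(1)[OF g(1)])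
  have fg: "fam (\<lambda>j x. f j x + g j x)" by (rule fam_add[OF f(1) g(1)])
  have "(\<lambda>j. X j \<oplus>\<^bsub>Lp_space p (M j)\<^esub> Y j) = (\<lambda>j. Vj.cls j (\<lambda>x. f j x + g j x))"
    unfolding f(2) g(2) Vj.Lp_space_eq using Vj.add_Q[OF fam_Lp[OF f(1)] fam_Lp[OF g(1)]] by (simp add: pre_Lp_ops)
  then have "ulim (\<lambda>j. X j \<oplus>\<^bsub>Lp_space p (M j)\<^esub> Y j) = W.cls (J (\<lambda>j x. f j x + g j x))"
    using ulim_cls(2)[OF fg] by simp
  also have "\<dots> = W.cls (\<lambda>z. J f z + J g z)"
    unfolding W.cls_Lp_eq_iff[OF J_Lp(1)[OF fg] Lp_add[OF p Jf Jg]] by (rule J_add[OF f(1) g(1)])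
  also have "\<dots> = ulim X \<oplus>\<^bsub>Lp_space p loeb_sum\<^esub> ulim Y"
    unfolding f(2) g(2) ulim_cls(2)[OF f(1)] ulim_cls(2)[OF g(1)] W.Lp_space_eq W.add_Q[OF Jf Jg] by (simp add: pre_Lp_ops)
  finally show "ulim (\<lambda>j. X j \<oplus>\<^bsub>Lp_space p (M j)\<^esub> Y j) = ulim X \<oplus>\<^bsub>Lp_space p loeb_sum\<^esub> ulim Y" .
qed

theorem Lp_space_loeb_sum_complete:
  assumes s: "Cauchy_in (Lp_space p loeb_sum) s"
  shows "\<exists>l\<in>carrier (Lp_space p loeb_sum). converges_in (Lp_space p loeb_sum) s l"
proof -
  have sQ: "s n \<in> carrier W.Q" for n using s by (simp add: Cauchy_in_def W.Lp_space_eq)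
  define \<xi> where "\<xi> n = W.repr (s n)" for n
  have \<xi>: "\<xi> n \<in> Lp p loeb_sum" "s n = W.cls (\<xi> n)" for n using W.repr[OF sQ] by (auto simp: \<xi>_def)
  have d: "vnorm W.Q (W.cls (\<xi> n) \<ominus>\<^bsub>W.Q\<^esub> W.cls \<eta>) = pnorm p loeb_sum (\<lambda>z. \<xi> n z - \<eta> z)" if "\<eta> \<in> Lp p loeb_sum" for n \<eta>
    using W.minus_Q[OF \<xi>(1) that] W.vnorm_Q[OF Lp_diff[OF p \<xi>(1) that]] by simp
  have dd: "vnorm W.Q (s m \<ominus>\<^bsub>W.Q\<^esub> s n) = pnorm p loeb_sum (\<lambda>z. \<xi> m z - \<xi> n z)" for m n
    using d[OF \<xi>(1), of m n] by (simp only: \<xi>(2))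
  have "\<exists>N. \<forall>m\<ge>N. \<forall>n\<ge>N. pnorm p loeb_sum (\<lambda>z. \<xi> m z - \<xi> n z) < e" if e: "0 < e" for e
  proof -
    have "\<forall>e>0. \<exists>N. \<forall>m\<ge>N. \<forall>n\<ge>N. vnorm W.Q (s m \<ominus>\<^bsub>W.Q\<^esub> s n) < e"
      using s by (simp add: Cauchy_in_def W.Lp_space_eq)
    with e show ?thesis by (simp only: dd)
  qed
  from Lp_loeb_sum_complete[of \<xi>, OF \<xi>(1) this]
  obtain \<eta> where \<eta>: "\<eta> \<in> Lp p loeb_sum" "(\<lambda>n. pnorm p loeb_sum (\<lambda>z. \<xi> n z - \<eta> z)) \<longlonglongrightarrow> 0" .
  have "vnorm W.Q (s n \<ominus>\<^bsub>W.Q\<^esub> W.cls \<eta>) = pnorm p loeb_sum (\<lambda>z. \<xi> n z - \<eta> z)" for n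
    using d[OF \<eta>(1), of n] by (simp only: \<xi>(2))
  then have "converges_in W.Q s (W.cls \<eta>)" using \<eta>(2) by (simp add: converges_in_def)
  then show ?thesis using W.cls_in[OF \<eta>(1)] unfolding W.Lp_space_eq by blast
qed

end

text \<open>
  A countably incomplete ultraproduct of \<open>L\<^sup>p\<close> spaces is a complete \<open>L\<^sup>p\<close> space.
\<close>

theorem Lp_ultraproduct_exists:
  fixes M :: "'j \<Rightarrow> 'x measure" and p :: real
  assumes U: "incomplete_ultrafilter U lev" and p: "1 \<le> p"
  obtains N :: "(('j \<Rightarrow> 'x \<Rightarrow> complex) \<times> ('j \<Rightarrow> 'x)) measure" and ulim bfam where
    "ultraproduct_space U (\<lambda>j. Lp_space p (M j)) (Lp_space p N) ulim bfam"
    "\<And>s. Cauchy_in (Lp_space p N) s \<Longrightarrow> \<exists>l\<in>carrier (Lp_space p N). converges_in (Lp_space p N) s l"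
proof -
  interpret U: incomplete_ultrafilter U lev by fact
  interpret Lp_ultraproduct U lev M p by unfold_locales (rule p)
  obtain D where D: "\<And>u. u \<in> D \<Longrightarrow> fam u" "\<And>u v. u \<in> D \<Longrightarrow> v \<in> D \<Longrightarrow> u \<noteq> v \<Longrightarrow> perp u v"
    "\<And>g. fam g \<Longrightarrow> (\<And>v. v \<in> D \<Longrightarrow> perp g v) \<Longrightarrow> unorm g = 0"
    using maximal_orthogonal_exists by blast
  interpret Lp_ultraproduct_basis U lev M p D
    by unfold_locales (fact D)+
  show thesis using that ultraproduct_space_loeb_sum Lp_space_loeb_sum_complete by blast
qed

section \<open>Direct limits of operator algebras on spaces of integrable functions\<close>

text \<open>
  The isomorphism onto the closed subalgebra is composed with the inclusion into all operators.
\<close>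

lemma Lp_operator_algebra_representation:
  assumes "Lp_operator_algebra TYPE('x) p A" "1 \<le> p"
  obtains M :: "'x measure" and h where "alg_map A (bounded_operators (Lp_space p M)) h"
    "\<And>a. a \<in> carrier A \<Longrightarrow> vnorm (bounded_operators (Lp_space p M)) (h a) = vnorm A a"
proof -
  obtain M :: "'x measure" and B where B: "complex_banach_algebra A" "closed_subalgebra B (bounded_operators (Lp_space p M))"
    "isometrically_isomorphic A ((bounded_operators (Lp_space p M))\<lparr>carrier := B\<rparr>)"
    using assms(1) by (auto simp: Lp_operator_algebra_def)
  interpret A: normed_complex_algebra A by (rule complex_banach_algebraD[OF B(1)])
  interpret Q: Lp_quotient p M by unfold_locales fact
  interpret V: operators_on "Lp_space p M"
    unfolding Q.Lp_space_eq by (rule operators_on.intro[OF Q.normed_module_Q])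
  interpret BV: cmodule V.B by (rule V.cmodule_B)
  obtain h where h: "h \<in> algebra_hom A (V.B\<lparr>carrier := B\<rparr>)" "\<forall>x\<in>carrier A. vnorm V.B (h x) = vnorm A x"
    using B(3) by (auto simp: isometrically_isomorphic_def)
  have "B \<subseteq> carrier V.B"
    using B(2) subgroup.subset[of B "add_monoid V.B"] by (auto simp: closed_subalgebra_def submodule_def)
  then have h1: "h a \<in> carrier V.B" if "a \<in> carrier A" for a
    using h(1) that by (auto simp: algebra_hom_def hom_def)
  have h2: "h (c \<odot>\<^bsub>A\<^esub> a) = c \<odot>\<^bsub>V.B\<^esub> h a" if "a \<in> carrier A" for a c
    using h(1) that by (auto simp: algebra_hom_def)
  have "h \<zero>\<^bsub>A\<^esub> = 0 \<odot>\<^bsub>V.B\<^esub> h \<zero>\<^bsub>A\<^esub>" using h2[OF A.zero_closed, of 0] by (simp add: A.sm_zero_r)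
  also have "\<dots> = \<zero>\<^bsub>V.B\<^esub>" by (rule BV.sm_zero[OF h1[OF A.zero_closed]])
  finally have "alg_map A V.B h"
    using h(1) h1 h2 by (auto simp: alg_map_def module_map_def algebra_hom_def hom_def)
  then show thesis using that h(2) by blast
qed

theorem theorem7p3:
  fixes p :: real
    and I :: "'i set" and r :: "'i rel"
    and A :: "'i \<Rightarrow> 'a normed_algebra"
    and \<phi> :: "'i \<Rightarrow> 'i \<Rightarrow> 'a \<Rightarrow> 'a"
  assumes "1 \<le> p"
    and "infinite I"
    and "contractive_direct_system I r A \<phi>"
    and "\<And>i. i \<in> I \<Longrightarrow> Lp_operator_algebra TYPE('x) p (A i)"
  shows "Lp_operator_algebra TYPE(('i, 'x) limit_points) p (direct_limit I r A \<phi>)"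
proof -
  interpret direct_system I r A \<phi> by unfold_locales fact
  have "\<forall>i\<in>I. \<exists>(M :: 'x measure) h. alg_map (A i) (bounded_operators (Lp_space p M)) h \<and>
      (\<forall>a\<in>carrier (A i). vnorm (bounded_operators (Lp_space p M)) (h a) = vnorm (A i) a)"
    using Lp_operator_algebra_representation[OF assms(4) assms(1)] by metis
  then obtain M :: "'i \<Rightarrow> 'x measure" and h where
    h: "\<And>i. i \<in> I \<Longrightarrow> alg_map (A i) (bounded_operators (Lp_space p (M i))) (h i)"
    and h_iso: "\<And>i a. i \<in> I \<Longrightarrow> a \<in> carrier (A i) \<Longrightarrow>
      vnorm (bounded_operators (Lp_space p (M i))) (h i a) = vnorm (A i) a"
    by metis
  \<comment> \<open>The natural numbers are adjoined to the index set to make the ultrafilter countably incomplete.\<close>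
  have "F \<times>\<^sub>F sequentially \<noteq> bot" using F_ne by (simp add: prod_filter_eq_bot)
  then obtain U :: "('i \<times> nat) filter" where U: "U \<le> F \<times>\<^sub>F sequentially" "U \<noteq> bot"
    "\<And>P. eventually P U \<or> eventually (\<lambda>x. \<not> P x) U"
    by (rule ultrafilter_exists) blast
  have fst_U: "filterlim fst F U" and snd_U: "filterlim snd sequentially U"
    using filterlim_fst[of F sequentially] filterlim_snd[of sequentially F] U(1) by (auto elim: filterlim_mono)
  have iU: "incomplete_ultrafilter U snd"
    by unfold_locales (use U snd_U in auto)
  obtain N :: "('i, 'x) limit_points measure" and ulim bfam where
    up: "ultraproduct_space U (\<lambda>j. Lp_space p (M (fst j))) (Lp_space p N) ulim bfam"
    and complete: "\<And>s. Cauchy_in (Lp_space p N) s \<Longrightarrow> \<exists>l\<in>carrier (Lp_space p N). converges_in (Lp_space p N) s l"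
    using Lp_ultraproduct_exists[OF iU assms(1), of "\<lambda>j. M (fst j)"] by blast
  interpret ultraproduct_space U "\<lambda>j. Lp_space p (M (fst j))" "Lp_space p N" ulim bfam by (rule up)
  have BW: "complex_banach_algebra BW"
    by (rule operators_on.complex_banach_algebra_B[OF operators_on.intro[OF normed_W] complete])
  interpret BW: cmodule BW by (rule operators_on.cmodule_B[OF operators_on.intro[OF normed_W]])

  \<comment> \<open>The action of the class of \<open>a \<in> A k\<close>; the value at the indices that do not lie above \<open>k\<close> is
    arbitrary, since the ultrafilter ignores them.\<close>
  define c where "c k a j = (if (k, fst j) \<in> r then h (fst j) (\<phi> (fst j) k a) else \<zero>\<^bsub>BV j\<^esub>)" for k a and j :: "'i \<times> nat"
  have later: "eventually (\<lambda>j. (k, fst j) \<in> r) U" if "k \<in> I" for k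
  proof -
    have "eventually (\<lambda>i. (k, i) \<in> r) F" using that by (auto simp: eventually_F)
    from eventually_compose_filterlim[OF this fst_U] show ?thesis .
  qed
  have c_norm: "vnorm (BV j) (c k a j) = vnorm (A (fst j)) (\<phi> (fst j) k a)"
    if "k \<in> I" "a \<in> carrier (A k)" "(k, fst j) \<in> r" for k a j
    using h_iso[of "fst j" "\<phi> (fst j) k a"] that \<phi>_in r_in by (auto simp: c_def)
  have c_op: "opfam (c k a)" if k: "k \<in> I" "a \<in> carrier (A k)" for k a
    unfolding opfam_def
  proof (intro conjI allI)
    show "c k a j \<in> carrier (BV j)" for j
    proof (cases "(k, fst j) \<in> r")
      case True
      then show ?thesis using alg_mapD(1)[OF h \<phi>_in[OF True k(2)]] r_in by (auto simp: c_def)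
    next
      case False
      then show ?thesis using operators_on.op_zero_in[OF V_ops, of j] by (simp add: c_def)
    qed
    have "eventually (\<lambda>j. vnorm (BV j) (c k a j) \<le> vnorm (A k) a) U"
      using later[OF k(1)] by eventually_elim (use c_norm[OF k] \<phi>_hom(2) k in auto)
    then show "\<exists>C. eventually (\<lambda>j. vnorm (BV j) (c k a j) \<le> C) U" by blast
  qed
  \<comment> \<open>Classes act through a representative; equivalent representatives give operators that agree
    eventually.\<close>
  define \<theta> where "\<theta> X = (case (SOME z. z \<in> X) of (k, a) \<Rightarrow> \<Theta> (c k a))" for X
  have \<theta>_\<iota>: "\<theta> (\<iota> k a) = \<Theta> (c k a)" if k: "k \<in> I" "a \<in> carrier (A k)" for k a
  proof -
    obtain i b where z: "(SOME z. z \<in> \<iota> k a) = (i, b)" by (cases "SOME z. z \<in> \<iota> k a")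
    have "(i, b) \<in> \<iota> k a" using someI[of "\<lambda>z. z \<in> \<iota> k a", OF \<iota>_self[OF k]] z by simp
    then obtain l where i: "i \<in> I" "b \<in> carrier (A i)" and l: "(k, l) \<in> r" "(i, l) \<in> r" "\<phi> l k a = \<phi> l i b"
      using k by (auto simp: mem_\<iota>)
    have "l \<in> I" using r_in[OF l(1)] by simp
    have "\<Theta> (c i b) = \<Theta> (c k a)"
    proof (rule \<Theta>_cong[OF c_op[OF i] c_op[OF k]])
      show "eventually (\<lambda>j. c i b j = c k a j) U"
        using later[OF \<open>l \<in> I\<close>]
      proof eventually_elim
        case (elim j)
        have "(k, fst j) \<in> r" "(i, fst j) \<in> r" using l elim r_trans by blast+
        then show ?case using agree_later[OF l elim k(2) i(2)] by (simp add: c_def)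
      qed
    qed
    then show ?thesis by (simp add: \<theta>_def z)
  qed
  have \<theta>_map: "alg_map L BW \<theta>"
    unfolding alg_map_def module_map_def
  proof (intro conjI ballI allI)
    show "\<theta> \<in> carrier L \<rightarrow> carrier BW"
      by (auto simp: carrier_L \<theta>_\<iota> intro: \<Theta>_in[OF c_op])
    fix X assume X: "X \<in> carrier L"
    show "\<theta> (s \<odot>\<^bsub>L\<^esub> X) = s \<odot>\<^bsub>BW\<^esub> \<theta> X" for s
    proof -
      obtain k a where k: "k \<in> I" "a \<in> carrier (A k)" "X = \<iota> k a" using X by (auto simp: carrier_L)
      have "\<Theta> (c k (s \<odot>\<^bsub>A k\<^esub> a)) = s \<odot>\<^bsub>BW\<^esub> \<Theta> (c k a)"
      proof (rule \<Theta>_smult[OF c_op[OF k(1,2)] c_op[OF k(1) sm_A[OF k(1,2)]]])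
        show "eventually (\<lambda>j. c k (s \<odot>\<^bsub>A k\<^esub> a) j = s \<odot>\<^bsub>BV j\<^esub> c k a j) U"
          using later[OF k(1)]
        proof eventually_elim
          case (elim j)
          show ?case
            using alg_mapD(3)[OF h \<phi>_in[OF elim k(2)]] elim r_in by (simp add: c_def \<phi>_smult[OF elim k(2)])
        qed
      qed
      then show ?thesis unfolding k(3) smult_L[OF k(1,2)] \<theta>_\<iota>[OF k(1,2)] \<theta>_\<iota>[OF k(1) sm_A[OF k(1,2)]] .
    qed
    fix Y assume Y: "Y \<in> carrier L"
    obtain k a b where k: "k \<in> I" "a \<in> carrier (A k)" "b \<in> carrier (A k)" "X = \<iota> k a" "Y = \<iota> k b"
      using common_index[OF X Y Y] by metis
    interpret Ak: normed_complex_algebra "A k" by (rule normed_A[OF k(1)])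
    have ab: "a \<oplus>\<^bsub>A k\<^esub> b \<in> carrier (A k)" "a \<otimes>\<^bsub>A k\<^esub> b \<in> carrier (A k)"
      using k by (auto simp: Ak.mult_closed)
    have "\<Theta> (c k (a \<oplus>\<^bsub>A k\<^esub> b)) = \<Theta> (c k a) \<oplus>\<^bsub>BW\<^esub> \<Theta> (c k b)"
    proof (rule \<Theta>_add[OF c_op[OF k(1,2)] c_op[OF k(1,3)] c_op[OF k(1) ab(1)]])
      show "eventually (\<lambda>j. c k (a \<oplus>\<^bsub>A k\<^esub> b) j = c k a j \<oplus>\<^bsub>BV j\<^esub> c k b j) U"
        using later[OF k(1)]
      proof eventually_elim
        case (elim j)
        show ?case
          using alg_mapD(2)[OF h \<phi>_in[OF elim k(2)] \<phi>_in[OF elim k(3)]] elim r_in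
          by (simp add: c_def \<phi>_add[OF elim k(2,3)])
      qed
    qed
    then show "\<theta> (X \<oplus>\<^bsub>L\<^esub> Y) = \<theta> X \<oplus>\<^bsub>BW\<^esub> \<theta> Y"
      unfolding k(4,5) add_L[OF k(1-3)] \<theta>_\<iota>[OF k(1,2)] \<theta>_\<iota>[OF k(1,3)] \<theta>_\<iota>[OF k(1) ab(1)] .
    have "\<Theta> (c k (a \<otimes>\<^bsub>A k\<^esub> b)) = \<Theta> (c k a) \<otimes>\<^bsub>BW\<^esub> \<Theta> (c k b)"
    proof (rule \<Theta>_mult[OF c_op[OF k(1,2)] c_op[OF k(1,3)] c_op[OF k(1) ab(2)]])
      show "eventually (\<lambda>j. c k (a \<otimes>\<^bsub>A k\<^esub> b) j = c k a j \<otimes>\<^bsub>BV j\<^esub> c k b j) U"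
        using later[OF k(1)]
      proof eventually_elim
        case (elim j)
        show ?case
          using alg_mapD(5)[OF h \<phi>_in[OF elim k(2)] \<phi>_in[OF elim k(3)]] elim r_in
          by (simp add: c_def \<phi>_mult[OF elim k(2,3)])
      qed
    qed
    then show "\<theta> (X \<otimes>\<^bsub>L\<^esub> Y) = \<theta> X \<otimes>\<^bsub>BW\<^esub> \<theta> Y"
      unfolding k(4,5) mult_L[OF k(1-3)] \<theta>_\<iota>[OF k(1,2)] \<theta>_\<iota>[OF k(1,3)] \<theta>_\<iota>[OF k(1) ab(2)] .
  next
    interpret L: complex_algebra L by (rule complex_algebra_L)
    obtain k where k: "k \<in> I" using I_ne by blast
    \<comment> \<open>Zero is sent to zero because it is fixed by multiplication with the scalar zero.\<close>
    have "\<Theta> (c k \<zero>\<^bsub>A k\<^esub>) = 0 \<odot>\<^bsub>BW\<^esub> \<Theta> (c k \<zero>\<^bsub>A k\<^esub>)"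
    proof (rule \<Theta>_smult[OF c_op[OF k zero_A[OF k]] c_op[OF k zero_A[OF k]]])
      show "eventually (\<lambda>j. c k \<zero>\<^bsub>A k\<^esub> j = 0 \<odot>\<^bsub>BV j\<^esub> c k \<zero>\<^bsub>A k\<^esub> j) U"
        using later[OF k]
      proof eventually_elim
        case (elim j)
        interpret Bj: cmodule "BV j" by (rule operators_on.cmodule_B[OF V_ops])
        have "fst j \<in> I" using r_in[OF elim] by simp
        then show ?case using elim alg_mapD(4)[OF h] by (simp add: c_def \<phi>_zero[OF elim] Bj.sm_zero_r)
      qed
    qed
    also have "\<dots> = \<zero>\<^bsub>BW\<^esub>" by (rule BW.sm_zero[OF \<Theta>_in[OF c_op[OF k zero_A[OF k]]]])
    finally show "\<theta> \<zero>\<^bsub>L\<^esub> = \<zero>\<^bsub>BW\<^esub>" unfolding zero_L[OF k] \<theta>_\<iota>[OF k zero_A[OF k]] .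
  qed
  have \<theta>_iso: "vnorm BW (\<theta> X) = vnorm L X" if X: "X \<in> carrier L" for X
  proof -
    obtain k a where k: "k \<in> I" "a \<in> carrier (A k)" "X = \<iota> k a" using X by (auto simp: carrier_L)
    have "((\<lambda>j. vnorm (A (fst j)) (\<phi> (fst j) k a)) \<longlongrightarrow> vnorm L X) U"
      unfolding k(3) by (rule filterlim_compose[OF tendsto_vnorm_L[OF k(1,2)] fst_U])
    moreover have "eventually (\<lambda>j. vnorm (A (fst j)) (\<phi> (fst j) k a) = vnorm (BV j) (c k a j)) U"
      using later[OF k(1)] by eventually_elim (use c_norm[OF k(1,2)] in simp)
    ultimately have "((\<lambda>j. vnorm (BV j) (c k a j)) \<longlongrightarrow> vnorm L X) U" by (rule Lim_transform_eventually)
    from vnorm_\<Theta>[OF c_op[OF k(1,2)] this] show ?thesis unfolding k(3) \<theta>_\<iota>[OF k(1,2)] .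
  qed
  from completed_quotient_representation[OF complex_algebra_L BW \<theta>_map \<theta>_iso]
  show ?thesis
    unfolding Lp_operator_algebra_def direct_limit_def Let_def by blast
qed

end
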